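(* Let $k$ be a field and let $A=k\times k$, $e=(1,0)$, $1_A=(1,1)$. Then every unital Hopf algebra action on $A$ is equivalent to one of the following three unital actions: (1) $\psi_1\colon k\otimes A\to A$, $\psi_1(\lambda\otimes a)=\lambda a$ for all $\lambda\in k$, $a\in A$. The cosupport $\mathrm{cosupp}\,\psi_1$ is one-dimensional and consists of all scalar operators on $A$. (2) $\psi_2\colon kC_2\otimes A\to A$, where $C_2=\langle c\rangle$ is the cyclic group of order $2$ and $\psi_2(c\otimes(\alpha,\beta))=(\beta,\alpha)$ for all $\alpha,\beta\in k$. The cosupport $\mathrm{cosupp}\,\psi_2$ is two-dimensional and consists of all linear operators on $A$ that have matrices of the form $\left(\begin{smallmatrix}\alpha&\beta\\ \beta&\alpha\end{smallmatrix}\right)$, $\alpha,\beta\in k$, in the basis $(1,0),(0,1)$. (3) $\psi_3=\rho_3^\vee(\varkappa\otimes\mathrm{id}_A)\colon (k\langle c,d,h\rangle/I)^\circ\otimes A\to A$, where $\rho_3\colon A\to A\otimes k\langle c,d,h\rangle/I$ is the unital coaction with $\rho_3(e)=1_A\otimes\bar h+e\otimes\bar c$, $k\langle c,d,h\rangle/I$ is the Hopf algebra defined in the context, and $\varkappa\colon (k\langle c,d,h\rangle/I)^\circ\hookrightarrow (k\langle c,d,h\rangle/I)^*$ is the inclusion. The cosupport $\mathrm{cosupp}\,\psi_3$ is three-dimensional and consists of all linear operators on $A$ that have upper triangular matrices in the basis $1_A,e$. If $\mathrm{char}\,k\ne 2$, then this class of equivalent actions contains the action $\psi_{3b}\colon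 H_4\otimes A\to A$ of the Sweedler algebra $H_4$ where $\psi_{3b}(c\otimes(\alpha,\beta))=(\beta,\alpha)$ and $\psi_{3b}(v\otimes(\alpha,\beta))=(\alpha-\beta,\alpha-\beta)$ for all $\alpha,\beta\in k$. Finally, for $i=1,2,3$ the action $\psi_i$ together with the corresponding Hopf algebra is $(\mathrm{cosupp}\,\psi_i)$-universal.
   Context: Actions. For a Hopf algebra $H$ over $k$ and a unital $k$-algebra $A$, an $H$-action on $A$ is a linear map $\psi\colon H\otimes A\to A$, written $\psi(h\otimes a)=ha$, making $A$ a left $H$-module with $h(ab)=(h_{(1)}a)(h_{(2)}b)$; it is unital if $h1_A=\varepsilon(h)1_A$ for all $h\in H$. A (unital) Hopf algebra action on $A$ is a (unital) $H$-action for some Hopf algebra $H$. An $H$-coaction on $A$ is an algebra homomorphism $\rho\colon A\to A\otimes H$ making $A$ a right $H$-comodule; it is unital if $\rho(1_A)=1_A\otimes1_H$; for it, $\rho^\vee\colon H^*\otimes A\to A$ is $\rho^\vee(\lambda\otimes a)=\lambda(a_{(1)})a_{(0)}$ where $\rho(a)=a_{(0)}\otimes a_{(1)}$. $H^\circ$ is the finite (Sweedler) dual of $H$: all $\lambda\in H^*$ vanishing on some two-sided ideal of finite codimension; it is a Hopf algebra. Cosupport and equivalence. $\mathrm{cosupp}\,\psi=\{\psi(h\otimes(-))\mid h\in H\}\subseteq\mathrm{End}_k(A)$, a unital subalgebra. Actions $\psi_1$ on $A_1$ and $\psi_2$ on $A_2$ are equivalent (via $\varphi$) if there is an algebra isomorphism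 $\varphi\colon A_1\to A_2$ with $\varphi(\mathrm{cosupp}\,\psi_1)\varphi^{-1}=\mathrm{cosupp}\,\psi_2$. Matrices of operators: the $j$-th column contains the coordinates of the image of the $j$-th basis vector. Universality. For a unital subalgebra $V\subseteq\mathrm{End}_k(A)$, a Hopf algebra $H_0$ with an $H_0$-action $\psi_0$ on $A$, $\mathrm{cosupp}\,\psi_0\subseteq V$, is $V$-universal if for every Hopf algebra $H$ and every $H$-action $\psi$ on $A$ with $\mathrm{cosupp}\,\psi\subseteq V$ there is a unique Hopf algebra homomorphism $\varphi\colon H\to H_0$ with $\psi=\psi_0(\varphi\otimes\mathrm{id}_A)$. Convention: (co)actions on unital associative algebras are assumed unital. The Hopf algebra $k\langle c,d,h\rangle/I$: $k\langle c,d,h\rangle$ is the free unital associative algebra, $I$ is the two-sided ideal generated by $cd-1$, $dc-1$, $h^2-h$, $hc+ch+c^2-c$; $\Delta,\varepsilon$ are induced by the unital algebra homomorphisms with $\Delta c=c\otimes c$, $\Delta d=d\otimes d$, $\Delta h=h\otimes c+1\otimes h$, $\varepsilon(c)=\varepsilon(d)=1$, $\varepsilon(h)=0$, and $S$ by the unital anti-homomorphism with $Sc=d$, $Sd=c$, $Sh=-hd$. Bars denote images in the quotient. Sweedler algebra $H_4$: generated as a unital algebra by $c,v$ with $c^2=1$, $v^2=0$, $vc=-cv$, basis $1,c,v,cv$; $\Delta c=c\otimes c$, $\Delta v=c\otimes v+v\otimes 1$, $\varepsilon(c)=1$, $\varepsilon(v)=0$, $Sc=c$, $Sv=-cv$.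 *)

theory Defs
  imports
    Complex_Main
    "HOL-Library.Poly_Mapping"
    "HOL-Library.Function_Algebras"
    "HOL-Library.Product_Plus"
    "HOL-Library.Z2"
begin

section \<open>Vector spaces, formal linear combinations and tensor products\<close>

text \<open>
  The ground field is a type of class \<open>field\<close>.  A vector space is a type of class
  \<open>ab_group_add\<close> together with a scalar multiplication satisfying the locale
  \<open>vector_space\<close>.  The type \<open>'x \<Rightarrow>\<^sub>0 'k\<close> is the vector space with basis \<open>'x\<close>; for an additive
  monoid \<open>'x\<close> its multiplication is that of the monoid algebra.
\<close>

definition pm_scale :: "'k::field \<Rightarrow> ('x \<Rightarrow>\<^sub>0 'k) \<Rightarrow> ('x \<Rightarrow>\<^sub>0 'k)" where
  "pm_scale c = Poly_Mapping.map ((*) c)"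

lemma lookup_pm_scale: "Poly_Mapping.lookup (pm_scale c p) x = c * Poly_Mapping.lookup p x"
  by (simp add: pm_scale_def Poly_Mapping.map.rep_eq when_def)

lemma vector_space_pm_scale: "vector_space (pm_scale :: 'k::field \<Rightarrow> ('x \<Rightarrow>\<^sub>0 'k) \<Rightarrow> _)"
  by (auto intro!: vector_space.intro poly_mapping_eqI
           simp: lookup_pm_scale lookup_add algebra_simps)

definition lin_ext ::
  "('k::field \<Rightarrow> 'v \<Rightarrow> 'v::ab_group_add) \<Rightarrow> ('x \<Rightarrow> 'v) \<Rightarrow> ('x \<Rightarrow>\<^sub>0 'k) \<Rightarrow> 'v" where
  "lin_ext s f p = (\<Sum>x\<in>Poly_Mapping.keys p. s (Poly_Mapping.lookup p x) (f x))"

text \<open>The formal sum of the basis vectors listed in \<open>xs\<close>.\<close>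

definition formal_sum :: "'x list \<Rightarrow> ('x \<Rightarrow>\<^sub>0 'k::field)" where
  "formal_sum xs = (\<Sum>x\<leftarrow>xs. Poly_Mapping.single x 1)"

text \<open>
  \<open>V \<otimes> W\<close> is the vector space with basis \<open>V \<times> W\<close> modulo the span of the bilinearity
  relations.  Its elements are cosets, and the space itself is the set \<open>tensor_space s t\<close> of
  all cosets (\<open>s\<close>, \<open>t\<close> being the scalar multiplications of \<open>V\<close>, \<open>W\<close>).
\<close>

type_synonym ('v, 'w, 'k) tensor = "('v \<times> 'w \<Rightarrow>\<^sub>0 'k) set"

definition tensor_rel ::
  "('k::field \<Rightarrow> 'v \<Rightarrow> 'v::ab_group_add) \<Rightarrow> ('k \<Rightarrow> 'w \<Rightarrow> 'w::ab_group_add) \<Rightarrow>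
   ('v \<times> 'w \<Rightarrow>\<^sub>0 'k) set" where
  "tensor_rel s t = module.span pm_scale
     ({Poly_Mapping.single (v + v', w) 1 - Poly_Mapping.single (v, w) 1
         - Poly_Mapping.single (v', w) 1 | v v' w. True} \<union>
      {Poly_Mapping.single (v, w + w') 1 - Poly_Mapping.single (v, w) 1
         - Poly_Mapping.single (v, w') 1 | v w w'. True} \<union>
      {Poly_Mapping.single (s c v, w) 1 - Poly_Mapping.single (v, w) c | c v w. True} \<union>
      {Poly_Mapping.single (v, t c w) 1 - Poly_Mapping.single (v, w) c | c v w. True})"

definition tensor_class ::
  "('k::field \<Rightarrow> 'v \<Rightarrow> 'v::ab_group_add) \<Rightarrow> ('k \<Rightarrow> 'w \<Rightarrow> 'w::ab_group_add) \<Rightarrow>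
   ('v \<times> 'w \<Rightarrow>\<^sub>0 'k) \<Rightarrow> ('v, 'w, 'k) tensor" where
  "tensor_class s t p = {q. q - p \<in> tensor_rel s t}"

definition tensor_space ::
  "('k::field \<Rightarrow> 'v \<Rightarrow> 'v::ab_group_add) \<Rightarrow> ('k \<Rightarrow> 'w \<Rightarrow> 'w::ab_group_add) \<Rightarrow>
   ('v, 'w, 'k) tensor set" where
  "tensor_space s t = range (tensor_class s t)"

text \<open>\<open>tens s t [(v\<^sub>1, w\<^sub>1), \<dots>, (v\<^sub>n, w\<^sub>n)]\<close> is \<open>v\<^sub>1 \<otimes> w\<^sub>1 + \<dots> + v\<^sub>n \<otimes> w\<^sub>n\<close>.\<close>

definition tens ::
  "('k::field \<Rightarrow> 'v \<Rightarrow> 'v::ab_group_add) \<Rightarrow> ('k \<Rightarrow> 'w \<Rightarrow> 'w::ab_group_add) \<Rightarrow>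
   ('v \<times> 'w) list \<Rightarrow> ('v, 'w, 'k) tensor" where
  "tens s t xs = tensor_class s t (formal_sum xs)"

text \<open>
  Sweedler notation: a chosen way of writing a tensor as a finite sum of pure tensors.  It is
  only ever fed into expressions that are bilinear in the two components, whose
  value does not depend on the choice.
\<close>

definition sweedler ::
  "('k::field \<Rightarrow> 'v \<Rightarrow> 'v::ab_group_add) \<Rightarrow> ('k \<Rightarrow> 'w \<Rightarrow> 'w::ab_group_add) \<Rightarrow>
   ('v, 'w, 'k) tensor \<Rightarrow> ('v \<times> 'w) list" where
  "sweedler s t T = (SOME xs. tens s t xs = T)"

text \<open>The threefold tensor product \<open>U \<otimes> V \<otimes> W\<close>, and the sum of the pure tensors in a list.\<close>

definition tensor_rel3 ::
  "('k::field \<Rightarrow> 'u \<Rightarrow> 'u::ab_group_add) \<Rightarrow> ('k \<Rightarrow> 'v \<Rightarrow> 'v::ab_group_add) \<Rightarrow>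
   ('k \<Rightarrow> 'w \<Rightarrow> 'w::ab_group_add) \<Rightarrow> ('u \<times> 'v \<times> 'w \<Rightarrow>\<^sub>0 'k) set" where
  "tensor_rel3 r s t = module.span pm_scale
     ({Poly_Mapping.single (u + u', v, w) 1 - Poly_Mapping.single (u, v, w) 1
         - Poly_Mapping.single (u', v, w) 1 | u u' v w. True} \<union>
      {Poly_Mapping.single (u, v + v', w) 1 - Poly_Mapping.single (u, v, w) 1
         - Poly_Mapping.single (u, v', w) 1 | u v v' w. True} \<union>
      {Poly_Mapping.single (u, v, w + w') 1 - Poly_Mapping.single (u, v, w) 1
         - Poly_Mapping.single (u, v, w') 1 | u v w w'. True} \<union>
      {Poly_Mapping.single (r c u, v, w) 1 - Poly_Mapping.single (u, v, w) c | c u v w. True} \<union>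
      {Poly_Mapping.single (u, s c v, w) 1 - Poly_Mapping.single (u, v, w) c | c u v w. True} \<union>
      {Poly_Mapping.single (u, v, t c w) 1 - Poly_Mapping.single (u, v, w) c | c u v w. True})"

definition tens3 ::
  "('k::field \<Rightarrow> 'u \<Rightarrow> 'u::ab_group_add) \<Rightarrow> ('k \<Rightarrow> 'v \<Rightarrow> 'v::ab_group_add) \<Rightarrow>
   ('k \<Rightarrow> 'w \<Rightarrow> 'w::ab_group_add) \<Rightarrow> ('u \<times> 'v \<times> 'w) list \<Rightarrow> ('u \<times> 'v \<times> 'w \<Rightarrow>\<^sub>0 'k) set" where
  "tens3 r s t xs = {q. q - formal_sum xs \<in> tensor_rel3 r s t}"

text \<open>Linearity of a map \<open>U \<rightarrow> V \<otimes> W\<close>, the operations on cosets being read off from members.\<close>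

definition tensor_linear ::
  "('k::field \<Rightarrow> 'u \<Rightarrow> 'u::ab_group_add) \<Rightarrow> ('k \<Rightarrow> 'v \<Rightarrow> 'v::ab_group_add) \<Rightarrow>
   ('k \<Rightarrow> 'w \<Rightarrow> 'w::ab_group_add) \<Rightarrow> ('u \<Rightarrow> ('v, 'w, 'k) tensor) \<Rightarrow> bool" where
  "tensor_linear r s t f \<longleftrightarrow>
     (\<forall>x. f x \<in> tensor_space s t) \<and>
     (\<forall>x y. \<forall>p\<in>f x. \<forall>q\<in>f y. p + q \<in> f (x + y)) \<and>
     (\<forall>c x. \<forall>p\<in>f x. pm_scale c p \<in> f (r c x))"


section \<open>Algebras and Hopf algebras\<close>

record ('k, 'a) alg =
  scl :: "'k \<Rightarrow> 'a \<Rightarrow> 'a"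
  mul :: "'a \<Rightarrow> 'a \<Rightarrow> 'a"
  unt :: 'a

definition algebra :: "('k::field, 'a::ab_group_add, 'z) alg_scheme \<Rightarrow> bool" where
  "algebra A \<longleftrightarrow>
     vector_space (scl A) \<and>
     (\<forall>a. Vector_Spaces.linear (scl A) (scl A) (\<lambda>b. mul A a b)) \<and>
     (\<forall>b. Vector_Spaces.linear (scl A) (scl A) (\<lambda>a. mul A a b)) \<and>
     (\<forall>a b c. mul A (mul A a b) c = mul A a (mul A b c)) \<and>
     (\<forall>a. mul A (unt A) a = a \<and> mul A a (unt A) = a)"

definition algebra_hom ::
  "('k::field, 'a::ab_group_add, 'y) alg_scheme \<Rightarrow> ('k, 'b::ab_group_add, 'z) alg_scheme \<Rightarrow>
   ('a \<Rightarrow> 'b) \<Rightarrow> bool" where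
  "algebra_hom A B f \<longleftrightarrow>
     Vector_Spaces.linear (scl A) (scl B) f \<and>
     (\<forall>x y. f (mul A x y) = mul B (f x) (f y)) \<and> f (unt A) = unt B"

definition two_sided_ideal :: "('k::field, 'a::ab_group_add, 'z) alg_scheme \<Rightarrow> 'a set \<Rightarrow> bool" where
  "two_sided_ideal A J \<longleftrightarrow>
     module.subspace (scl A) J \<and> (\<forall>a. \<forall>x\<in>J. mul A a x \<in> J \<and> mul A x a \<in> J)"

definition field_alg :: "('k::field, 'k) alg" where
  "field_alg = \<lparr>scl = (*), mul = (*), unt = 1\<rparr>"

record (overloaded) ('k::zero, 'h) hopf = "('k, 'h) alg" +
  comul :: "'h \<Rightarrow> ('h, 'h, 'k) tensor"
  counit :: "'h \<Rightarrow> 'k"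
  antipode :: "'h \<Rightarrow> 'h"

definition sw :: "('k::field, 'h::ab_group_add, 'z) hopf_scheme \<Rightarrow> 'h \<Rightarrow> ('h \<times> 'h) list" where
  "sw H h = sweedler (scl H) (scl H) (comul H h)"

definition hopf_algebra :: "('k::field, 'h::ab_group_add) hopf \<Rightarrow> bool" where
  "hopf_algebra H \<longleftrightarrow>
     algebra H \<and>
     tensor_linear (scl H) (scl H) (scl H) (comul H) \<and>
     (\<forall>h. tens3 (scl H) (scl H) (scl H) [(x, y, b). (a, b) \<leftarrow> sw H h, (x, y) \<leftarrow> sw H a] =
          tens3 (scl H) (scl H) (scl H) [(a, x, y). (a, b) \<leftarrow> sw H h, (x, y) \<leftarrow> sw H b]) \<and>
     (\<forall>h. (\<Sum>(a, b)\<leftarrow>sw H h. scl H (counit H a) b) = h) \<and>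
     (\<forall>h. (\<Sum>(a, b)\<leftarrow>sw H h. scl H (counit H b) a) = h) \<and>
     (\<forall>g h. comul H (mul H g h) =
        tens (scl H) (scl H) [(mul H a a', mul H b b'). (a, b) \<leftarrow> sw H g, (a', b') \<leftarrow> sw H h]) \<and>
     comul H (unt H) = tens (scl H) (scl H) [(unt H, unt H)] \<and>
     algebra_hom H field_alg (counit H) \<and>
     Vector_Spaces.linear (scl H) (scl H) (antipode H) \<and>
     (\<forall>h. (\<Sum>(a, b)\<leftarrow>sw H h. mul H (antipode H a) b) = scl H (counit H h) (unt H)) \<and>
     (\<forall>h. (\<Sum>(a, b)\<leftarrow>sw H h. mul H a (antipode H b)) = scl H (counit H h) (unt H))"

text \<open>
  A homomorphism of Hopf algebras is a homomorphism of the underlying algebras and coalgebras;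
  it automatically commutes with the antipodes.
\<close>

definition hopf_hom ::
  "('k::field, 'h::ab_group_add) hopf \<Rightarrow> ('k, 'g::ab_group_add) hopf \<Rightarrow> ('h \<Rightarrow> 'g) \<Rightarrow> bool" where
  "hopf_hom H G f \<longleftrightarrow>
     algebra_hom H G f \<and>
     (\<forall>h. comul G (f h) = tens (scl G) (scl G) [(f a, f b). (a, b) \<leftarrow> sw H h]) \<and>
     (\<forall>h. counit G (f h) = counit H h)"


section \<open>Actions, coactions, cosupports, universality\<close>

text \<open>
  A linear map \<open>H \<otimes> A \<rightarrow> A\<close> is given as the corresponding bilinear map, in curried form.
\<close>

definition hopf_action ::
  "('k::field, 'h::ab_group_add) hopf \<Rightarrow> ('k, 'a::ab_group_add) alg \<Rightarrow> ('h \<Rightarrow> 'a \<Rightarrow> 'a) \<Rightarrow> bool" where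
  "hopf_action H A \<psi> \<longleftrightarrow>
     hopf_algebra H \<and> algebra A \<and>
     (\<forall>h. Vector_Spaces.linear (scl A) (scl A) (\<lambda>a. \<psi> h a)) \<and>
     (\<forall>a. Vector_Spaces.linear (scl H) (scl A) (\<lambda>h. \<psi> h a)) \<and>
     (\<forall>a. \<psi> (unt H) a = a) \<and>
     (\<forall>g h a. \<psi> (mul H g h) a = \<psi> g (\<psi> h a)) \<and>
     (\<forall>h a b. \<psi> h (mul A a b) = (\<Sum>(x, y)\<leftarrow>sw H h. mul A (\<psi> x a) (\<psi> y b)))"

definition unital_hopf_action ::
  "('k::field, 'h::ab_group_add) hopf \<Rightarrow> ('k, 'a::ab_group_add) alg \<Rightarrow> ('h \<Rightarrow> 'a \<Rightarrow> 'a) \<Rightarrow> bool" where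
  "unital_hopf_action H A \<psi> \<longleftrightarrow>
     hopf_action H A \<psi> \<and> (\<forall>h. \<psi> h (unt A) = scl A (counit H h) (unt A))"

definition hopf_coaction ::
  "('k::field, 'h::ab_group_add) hopf \<Rightarrow> ('k, 'a::ab_group_add) alg \<Rightarrow>
   ('a \<Rightarrow> ('a, 'h, 'k) tensor) \<Rightarrow> bool" where
  "hopf_coaction H A \<rho> \<longleftrightarrow>
     (let sw\<rho> = (\<lambda>a. sweedler (scl A) (scl H) (\<rho> a)) in
     hopf_algebra H \<and> algebra A \<and>
     tensor_linear (scl A) (scl A) (scl H) \<rho> \<and>
     (\<forall>a b. \<rho> (mul A a b) =
        tens (scl A) (scl H) [(mul A x y, mul H g h). (x, g) \<leftarrow> sw\<rho> a, (y, h) \<leftarrow> sw\<rho> b]) \<and>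
     (\<forall>a. tens3 (scl A) (scl H) (scl H) [(y, g, h). (x, h) \<leftarrow> sw\<rho> a, (y, g) \<leftarrow> sw\<rho> x] =
          tens3 (scl A) (scl H) (scl H) [(x, g, g'). (x, h) \<leftarrow> sw\<rho> a, (g, g') \<leftarrow> sw H h]) \<and>
     (\<forall>a. (\<Sum>(x, h)\<leftarrow>sw\<rho> a. scl A (counit H h) x) = a))"

definition unital_hopf_coaction ::
  "('k::field, 'h::ab_group_add) hopf \<Rightarrow> ('k, 'a::ab_group_add) alg \<Rightarrow>
   ('a \<Rightarrow> ('a, 'h, 'k) tensor) \<Rightarrow> bool" where
  "unital_hopf_coaction H A \<rho> \<longleftrightarrow>
     hopf_coaction H A \<rho> \<and> \<rho> (unt A) = tens (scl A) (scl H) [(unt A, unt H)]"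

text \<open>The map \<open>\<rho>\<^sup>\<or> : H\<^sup>* \<otimes> A \<rightarrow> A\<close>, \<open>\<lambda> \<otimes> a \<mapsto> \<lambda>(a\<^sub>(\<^sub>1\<^sub>)) a\<^sub>(\<^sub>0\<^sub>)\<close>.\<close>

definition coaction_dual ::
  "('k::field, 'h::ab_group_add) hopf \<Rightarrow> ('k, 'a::ab_group_add) alg \<Rightarrow>
   ('a \<Rightarrow> ('a, 'h, 'k) tensor) \<Rightarrow> ('h \<Rightarrow> 'k) \<Rightarrow> 'a \<Rightarrow> 'a" where
  "coaction_dual H A \<rho> f a = (\<Sum>(x, h)\<leftarrow>sweedler (scl A) (scl H) (\<rho> a). scl A (f h) x)"

definition cosupp :: "('h \<Rightarrow> 'a \<Rightarrow> 'a) \<Rightarrow> ('a \<Rightarrow> 'a) set" where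
  "cosupp \<psi> = {\<psi> h | h. True}"

definition lin_End :: "('k::field, 'a::ab_group_add) alg \<Rightarrow> ('a \<Rightarrow> 'a) set" where
  "lin_End A = {T. Vector_Spaces.linear (scl A) (scl A) T}"

text \<open>Operators are added pointwise (theory \<open>Function_Algebras\<close>) and scaled pointwise.\<close>

definition op_scale :: "('k::field, 'a::ab_group_add) alg \<Rightarrow> 'k \<Rightarrow> ('a \<Rightarrow> 'a) \<Rightarrow> 'a \<Rightarrow> 'a" where
  "op_scale A c T = (\<lambda>a. scl A c (T a))"

definition unital_subalgebra_End ::
  "('k::field, 'a::ab_group_add) alg \<Rightarrow> ('a \<Rightarrow> 'a) set \<Rightarrow> bool" where
  "unital_subalgebra_End A V \<longleftrightarrow>
     V \<subseteq> lin_End A \<and> module.subspace (op_scale A) V \<and> id \<in> V \<and> (\<forall>S\<in>V. \<forall>T\<in>V. S \<circ> T \<in> V)"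

definition equivalent_actions ::
  "('k::field, 'a::ab_group_add) alg \<Rightarrow> ('h \<Rightarrow> 'a \<Rightarrow> 'a) \<Rightarrow>
   ('k, 'b::ab_group_add) alg \<Rightarrow> ('g \<Rightarrow> 'b \<Rightarrow> 'b) \<Rightarrow> bool" where
  "equivalent_actions A \<psi> B \<psi>' \<longleftrightarrow>
     (\<exists>\<phi>. algebra_hom A B \<phi> \<and> bij \<phi> \<and> (\<lambda>T. \<phi> \<circ> T \<circ> inv \<phi>) ` cosupp \<psi> = cosupp \<psi>')"

text \<open>
  The competing Hopf algebras range over all Hopf algebra structures on the type \<open>'h\<close>; a theorem
  with \<open>TYPE('h)\<close> for a type variable \<open>'h\<close> therefore covers all Hopf algebras.
\<close>

definition V_universal ::
  "'h::ab_group_add itself \<Rightarrow> ('k::field, 'a::ab_group_add) alg \<Rightarrow> ('a \<Rightarrow> 'a) set \<Rightarrow>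
   ('k, 'g::ab_group_add) hopf \<Rightarrow> ('g \<Rightarrow> 'a \<Rightarrow> 'a) \<Rightarrow> bool" where
  "V_universal _ A V H\<^sub>0 \<psi>\<^sub>0 \<longleftrightarrow>
     unital_subalgebra_End A V \<and> unital_hopf_action H\<^sub>0 A \<psi>\<^sub>0 \<and> cosupp \<psi>\<^sub>0 \<subseteq> V \<and>
     (\<forall>(H :: ('k, 'h) hopf) \<psi>. unital_hopf_action H A \<psi> \<and> cosupp \<psi> \<subseteq> V \<longrightarrow>
        (\<exists>!\<phi>. hopf_hom H H\<^sub>0 \<phi> \<and> (\<forall>h a. \<psi> h a = \<psi>\<^sub>0 (\<phi> h) a)))"

text \<open>\<open>T\<close> has the matrix with rows \<open>(m\<^sub>1\<^sub>1, m\<^sub>1\<^sub>2)\<close>, \<open>(m\<^sub>2\<^sub>1, m\<^sub>2\<^sub>2)\<close> in the basis \<open>b\<^sub>1, b\<^sub>2\<close>.\<close>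

definition has_matrix ::
  "('k::field, 'a::ab_group_add) alg \<Rightarrow> 'a \<times> 'a \<Rightarrow> ('a \<Rightarrow> 'a) \<Rightarrow> ('k \<times> 'k) \<times> ('k \<times> 'k) \<Rightarrow> bool" where
  "has_matrix A = (\<lambda>(b\<^sub>1, b\<^sub>2) T ((m\<^sub>1\<^sub>1, m\<^sub>1\<^sub>2), (m\<^sub>2\<^sub>1, m\<^sub>2\<^sub>2)).
     T b\<^sub>1 = scl A m\<^sub>1\<^sub>1 b\<^sub>1 + scl A m\<^sub>2\<^sub>1 b\<^sub>2 \<and> T b\<^sub>2 = scl A m\<^sub>1\<^sub>2 b\<^sub>1 + scl A m\<^sub>2\<^sub>2 b\<^sub>2)"


section \<open>Finite duals\<close>

definition finite_codim :: "('k::field \<Rightarrow> 'v \<Rightarrow> 'v::ab_group_add) \<Rightarrow> 'v set \<Rightarrow> bool" where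
  "finite_codim s J \<longleftrightarrow> (\<exists>F. finite F \<and> module.span s (F \<union> J) = UNIV)"

definition finite_dual :: "('k::field, 'a::ab_group_add, 'z) alg_scheme \<Rightarrow> ('a \<Rightarrow> 'k) set" where
  "finite_dual A = {f. Vector_Spaces.linear (scl A) (*) f \<and>
     (\<exists>J. two_sided_ideal A J \<and> finite_codim (scl A) J \<and> (\<forall>x\<in>J. f x = 0))}"

definition convolution ::
  "('k::field, 'h::ab_group_add) hopf \<Rightarrow> ('h \<Rightarrow> 'k) \<Rightarrow> ('h \<Rightarrow> 'k) \<Rightarrow> 'h \<Rightarrow> 'k" where
  "convolution H f g h = (\<Sum>(a, b)\<leftarrow>sw H h. f a * g b)"

lemma finite_codim_Int_aux:
  fixes s :: "'k::field \<Rightarrow> 'v \<Rightarrow> 'v::ab_group_add"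
  assumes vs: "vector_space s" and "finite F" and "module.subspace s J" and "module.subspace s W"
    and "W \<subseteq> module.span s (F \<union> J)"
  shows "\<exists>F'. finite F' \<and> W \<subseteq> module.span s (F' \<union> (J \<inter> W))"
proof -
  interpret vector_space s by fact
  show ?thesis
    using \<open>finite F\<close> assms(3,5)
  proof (induction F arbitrary: J rule: finite_induct)
    case empty
    then have "W \<subseteq> J" by (simp add: span_eq_iff[THEN iffD2])
    then show ?case by (intro exI[of _ "{}"]) (auto intro: span_base)
  next
    case (insert a F)
    define J' where "J' = span (insert a J)"
    have "W \<subseteq> span (F \<union> J')"
    proof -
      have "span (insert a F \<union> J) \<subseteq> span (F \<union> J')"
        by (rule span_minimal) (auto simp: J'_def intro: span_base)
      then show ?thesis using insert.prems by blast
    qed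
    moreover have "subspace J'" by (simp add: J'_def)
    ultimately obtain F' where F': "finite F'" "W \<subseteq> span (F' \<union> (J' \<inter> W))"
      using insert.IH by blast
    have "\<exists>w. J' \<inter> W \<subseteq> span (insert w (J \<inter> W))"
    proof (cases "J' \<inter> W \<subseteq> J")
      case True
      then show ?thesis by (intro exI[of _ 0]) (auto intro: span_base)
    next
      case False
      then obtain w where w: "w \<in> J'" "w \<in> W" "w \<notin> J" by blast
      obtain c where c: "w - s c a \<in> span J"
        using w(1) by (auto simp: J'_def span_insert)
      have spJ: "span J = J" using insert.prems(1) by (simp add: span_eq_iff)
      have "c \<noteq> 0" using c w(3) spJ by auto
      have "x \<in> span (insert w (J \<inter> W))" if x: "x \<in> J'" "x \<in> W" for x
      proof -
        obtain d where d: "x - s d a \<in> J" using x(1) spJ by (auto simp: J'_def span_insert)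
        have "x - s (d / c) w = (x - s d a) - s (d / c) (w - s c a)"
          using \<open>c \<noteq> 0\<close> by (simp add: scale_right_diff_distrib)
        then have "x - s (d / c) w \<in> J"
          using d c spJ insert.prems(1) by (metis subspace_diff subspace_scale)
        moreover have "x - s (d / c) w \<in> W"
          using x(2) w(2) assms(4) by (simp add: subspace_diff subspace_scale)
        ultimately show ?thesis by (auto simp: span_insert intro: span_base)
      qed
      then show ?thesis by blast
    qed
    then obtain w where w: "J' \<inter> W \<subseteq> span (insert w (J \<inter> W))" ..
    have "span (F' \<union> (J' \<inter> W)) \<subseteq> span (insert w F' \<union> (J \<inter> W))"
      using w span_mono[of "insert w (J \<inter> W)" "insert w F' \<union> (J \<inter> W)"]
      by (intro span_minimal) (auto intro: span_base)
    then show ?case using F' by (intro exI[of _ "insert w F'"]) auto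
  qed
qed

lemma finite_codim_Int:
  fixes s :: "'k::field \<Rightarrow> 'v \<Rightarrow> 'v::ab_group_add"
  assumes vs: "vector_space s" and "module.subspace s J" and "module.subspace s K"
    and "finite_codim s J" and "finite_codim s K"
  shows "finite_codim s (J \<inter> K)"
proof -
  interpret vector_space s by fact
  obtain F G where F: "finite F" "span (F \<union> J) = UNIV" and G: "finite G" "span (G \<union> K) = UNIV"
    using assms(4,5) by (auto simp: finite_codim_def)
  obtain F' where F': "finite F'" "K \<subseteq> span (F' \<union> (J \<inter> K))"
    using finite_codim_Int_aux[OF vs F(1) assms(2,3)] F(2) by auto
  have "span (G \<union> K) \<subseteq> span ((G \<union> F') \<union> (J \<inter> K))"
    using F'(2) span_mono[of "F' \<union> (J \<inter> K)" "(G \<union> F') \<union> (J \<inter> K)"]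
    by (intro span_minimal) (auto intro: span_base)
  then show ?thesis using F'(1) G by (auto simp: finite_codim_def intro!: exI[of _ "G \<union> F'"])
qed

lemma linear_functionalI:
  fixes f :: "'v::ab_group_add \<Rightarrow> 'k::field"
  assumes "vector_space s" "\<And>x y. f (x + y) = f x + f y" "\<And>c x. f (s c x) = c * f x"
  shows "Vector_Spaces.linear s (*) f"
proof -
  interpret vector_space s by fact
  show ?thesis by unfold_locales (use assms in \<open>auto simp: algebra_simps\<close>)
qed

lemma finite_dual_subspace:
  assumes vs: "vector_space (scl A)"
  shows "(\<lambda>_. 0) \<in> finite_dual A"
    and "f \<in> finite_dual A \<Longrightarrow> g \<in> finite_dual A \<Longrightarrow> (\<lambda>x. f x + g x) \<in> finite_dual A"
    and "f \<in> finite_dual A \<Longrightarrow> (\<lambda>x. c * f x) \<in> finite_dual A"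
proof -
  interpret vector_space "scl A" by fact
  have "two_sided_ideal A UNIV" "finite_codim (scl A) UNIV"
    by (auto simp: two_sided_ideal_def finite_codim_def)
  then show "(\<lambda>_. 0) \<in> finite_dual A"
    by (auto simp: finite_dual_def intro!: linear_functionalI vs)
  have add: "f (x + y) = f x + f y" and scale: "f (scl A c x) = c * f x"
    if "f \<in> finite_dual A" for f x y c
  proof -
    interpret f: Vector_Spaces.linear "scl A" "(*)" f using that by (simp add: finite_dual_def)
    show "f (x + y) = f x + f y" "f (scl A c x) = c * f x" by (simp_all add: f.add f.scale)
  qed
  show "(\<lambda>x. f x + g x) \<in> finite_dual A" if fg: "f \<in> finite_dual A" "g \<in> finite_dual A"
  proof -
    obtain J K where J: "two_sided_ideal A J" "finite_codim (scl A) J" "\<forall>x\<in>J. f x = 0"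
      and K: "two_sided_ideal A K" "finite_codim (scl A) K" "\<forall>x\<in>K. g x = 0"
      using fg by (auto simp: finite_dual_def)
    have "two_sided_ideal A (J \<inter> K)"
      using J(1) K(1) by (auto simp: two_sided_ideal_def intro: subspace_inter)
    moreover have "finite_codim (scl A) (J \<inter> K)"
      using J K by (intro finite_codim_Int vs) (auto simp: two_sided_ideal_def)
    moreover have "Vector_Spaces.linear (scl A) (*) (\<lambda>x. f x + g x)"
      using fg by (intro linear_functionalI vs) (auto simp: add scale algebra_simps)
    ultimately show ?thesis using J K unfolding finite_dual_def by fastforce
  qed
  show "(\<lambda>x. c * f x) \<in> finite_dual A" if f: "f \<in> finite_dual A"
  proof -
    have "Vector_Spaces.linear (scl A) (*) (\<lambda>x. c * f x)"
      using f by (intro linear_functionalI vs) (auto simp: add scale algebra_simps)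
    then show ?thesis using f unfolding finite_dual_def by fastforce
  qed
qed


section \<open>The Hopf algebra \<open>k\<langle>c, d, h\<rangle>/I\<close>\<close>

text \<open>
  Words under concatenation, written additively, so that \<open>'x fword \<Rightarrow>\<^sub>0 'k\<close> is the free unital
  associative algebra on \<open>'x\<close>.
\<close>

datatype 'x fword = FWord (letters: "'x list")

instantiation fword :: (type) monoid_add
begin

definition zero_fword :: "'a fword" where
  "0 = FWord []"

definition plus_fword :: "'a fword \<Rightarrow> 'a fword \<Rightarrow> 'a fword" where
  "u + v = FWord (letters u @ letters v)"

instance
  by standard (auto simp: zero_fword_def plus_fword_def)

end

definition free_alg :: "('k::field, 'x fword \<Rightarrow>\<^sub>0 'k) alg" where
  "free_alg = \<lparr>scl = pm_scale, mul = (*), unt = 1\<rparr>"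

definition free_gen :: "'x \<Rightarrow> ('x fword \<Rightarrow>\<^sub>0 'k::field)" where
  "free_gen x = Poly_Mapping.single (FWord [x]) 1"

datatype cdh_gen = Gen_c | Gen_d | Gen_h

definition cdh_ideal :: "(cdh_gen fword \<Rightarrow>\<^sub>0 'k::field) set" where
  "cdh_ideal = (let c = free_gen Gen_c; d = free_gen Gen_d; h = free_gen Gen_h in
     \<Inter>{J. two_sided_ideal free_alg J \<and>
          {c * d - 1, d * c - 1, h ^ 2 - h, h * c + c * h + c ^ 2 - c} \<subseteq> J})"

lemma cdh_ideal_subspace: "module.subspace pm_scale (cdh_ideal :: (cdh_gen fword \<Rightarrow>\<^sub>0 'k::field) set)"
proof -
  interpret vector_space "pm_scale :: 'k \<Rightarrow> (cdh_gen fword \<Rightarrow>\<^sub>0 'k) \<Rightarrow> _"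
    by (rule vector_space_pm_scale)
  show ?thesis
    unfolding cdh_ideal_def Let_def
    by (rule subspace_Inter) (auto simp: two_sided_ideal_def free_alg_def)
qed

lemma cdh_ideal_mult: "x \<in> cdh_ideal \<Longrightarrow> a * x \<in> cdh_ideal \<and> x * a \<in> cdh_ideal"
  by (auto simp: cdh_ideal_def Let_def two_sided_ideal_def free_alg_def)

lemma
  fixes x y :: "cdh_gen fword \<Rightarrow>\<^sub>0 'k::field"
  shows cdh_ideal_0: "0 \<in> (cdh_ideal :: (cdh_gen fword \<Rightarrow>\<^sub>0 'k) set)"
    and cdh_ideal_add: "x \<in> cdh_ideal \<Longrightarrow> y \<in> cdh_ideal \<Longrightarrow> x + y \<in> cdh_ideal"
    and cdh_ideal_diff: "x \<in> cdh_ideal \<Longrightarrow> y \<in> cdh_ideal \<Longrightarrow> x - y \<in> cdh_ideal"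
    and cdh_ideal_neg: "x \<in> cdh_ideal \<Longrightarrow> - x \<in> cdh_ideal"
    and cdh_ideal_scale: "x \<in> cdh_ideal \<Longrightarrow> pm_scale c x \<in> cdh_ideal"
proof -
  interpret vector_space "pm_scale :: 'k \<Rightarrow> (cdh_gen fword \<Rightarrow>\<^sub>0 'k) \<Rightarrow> _"
    by (rule vector_space_pm_scale)
  note * = cdh_ideal_subspace[where 'k = 'k]
  show "0 \<in> (cdh_ideal :: (cdh_gen fword \<Rightarrow>\<^sub>0 'k) set)"
    and "x \<in> cdh_ideal \<Longrightarrow> y \<in> cdh_ideal \<Longrightarrow> x + y \<in> cdh_ideal"
    and "x \<in> cdh_ideal \<Longrightarrow> y \<in> cdh_ideal \<Longrightarrow> x - y \<in> cdh_ideal"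
    and "x \<in> cdh_ideal \<Longrightarrow> - x \<in> cdh_ideal"
    and "x \<in> cdh_ideal \<Longrightarrow> pm_scale c x \<in> cdh_ideal"
    by (auto intro: subspace_0[OF *] subspace_add[OF *] subspace_diff[OF *] subspace_neg[OF *]
          subspace_scale[OF *])
qed

definition cdh_rel :: "(cdh_gen fword \<Rightarrow>\<^sub>0 'k::field) \<Rightarrow> (cdh_gen fword \<Rightarrow>\<^sub>0 'k) \<Rightarrow> bool" where
  "cdh_rel x y \<longleftrightarrow> x - y \<in> cdh_ideal"

lemma equivp_cdh_rel: "equivp cdh_rel"
proof (rule equivpI)
  show "reflp cdh_rel" by (auto simp: reflp_def cdh_rel_def cdh_ideal_0)
  show "symp cdh_rel"
    by (auto simp: symp_def cdh_rel_def) (metis cdh_ideal_neg minus_diff_eq)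
  show "transp cdh_rel"
    by (auto simp: transp_def cdh_rel_def) (metis cdh_ideal_add diff_add_cancel add_diff_eq)
qed

quotient_type (overloaded) 'k cdh = "cdh_gen fword \<Rightarrow>\<^sub>0 'k::field" / cdh_rel
  by (rule equivp_cdh_rel)

instantiation cdh :: (field) "{ring, monoid_mult}"
begin

lift_definition zero_cdh :: "'a cdh" is 0 .

lift_definition one_cdh :: "'a cdh" is 1 .

lift_definition plus_cdh :: "'a cdh \<Rightarrow> 'a cdh \<Rightarrow> 'a cdh" is "(+)"
  unfolding cdh_rel_def by (metis add_diff_add cdh_ideal_add)

lift_definition minus_cdh :: "'a cdh \<Rightarrow> 'a cdh \<Rightarrow> 'a cdh" is "(-)"
proof -
  fix x x' y y' :: "cdh_gen fword \<Rightarrow>\<^sub>0 'a"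
  assume "cdh_rel x x'" "cdh_rel y y'"
  then have "(x - x') - (y - y') \<in> cdh_ideal" unfolding cdh_rel_def by (rule cdh_ideal_diff)
  then show "cdh_rel (x - y) (x' - y')" by (simp add: cdh_rel_def algebra_simps)
qed

lift_definition uminus_cdh :: "'a cdh \<Rightarrow> 'a cdh" is uminus
proof -
  fix x x' :: "cdh_gen fword \<Rightarrow>\<^sub>0 'a"
  assume "cdh_rel x x'"
  then have "- (x - x') \<in> cdh_ideal" unfolding cdh_rel_def by (rule cdh_ideal_neg)
  then show "cdh_rel (- x) (- x')" by (simp add: cdh_rel_def)
qed

lift_definition times_cdh :: "'a cdh \<Rightarrow> 'a cdh \<Rightarrow> 'a cdh" is "(*)"
proof -
  fix x x' y y' :: "cdh_gen fword \<Rightarrow>\<^sub>0 'a"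
  assume "cdh_rel x x'" "cdh_rel y y'"
  then have "(x - x') * y + x' * (y - y') \<in> cdh_ideal"
    unfolding cdh_rel_def by (simp add: cdh_ideal_add cdh_ideal_mult)
  then show "cdh_rel (x * y) (x' * y')" by (simp add: cdh_rel_def algebra_simps)
qed

instance
  by standard (transfer, simp add: cdh_rel_def cdh_ideal_0 algebra_simps)+

end

lift_definition cdh_scale :: "'k::field \<Rightarrow> 'k cdh \<Rightarrow> 'k cdh" is pm_scale
proof -
  fix c :: 'k and x y :: "cdh_gen fword \<Rightarrow>\<^sub>0 'k"
  assume "cdh_rel x y"
  then have "pm_scale c (x - y) \<in> cdh_ideal" unfolding cdh_rel_def by (rule cdh_ideal_scale)
  moreover have "pm_scale c (x - y) = pm_scale c x - pm_scale c y"
    by (auto intro!: poly_mapping_eqI simp: lookup_pm_scale lookup_minus right_diff_distrib)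
  ultimately show "cdh_rel (pm_scale c x) (pm_scale c y)" by (simp add: cdh_rel_def)
qed

lift_definition cdh_gen :: "cdh_gen \<Rightarrow> 'k::field cdh" is free_gen .

abbreviation c_bar :: "'k::field cdh" where "c_bar \<equiv> cdh_gen Gen_c"
abbreviation d_bar :: "'k::field cdh" where "d_bar \<equiv> cdh_gen Gen_d"
abbreviation h_bar :: "'k::field cdh" where "h_bar \<equiv> cdh_gen Gen_h"

text \<open>The structure maps on generators, extended to words and then linearly.\<close>

fun cdh_comul_gen :: "cdh_gen \<Rightarrow> ('k::field cdh \<times> 'k cdh) list" where
  "cdh_comul_gen Gen_c = [(c_bar, c_bar)]"
| "cdh_comul_gen Gen_d = [(d_bar, d_bar)]"
| "cdh_comul_gen Gen_h = [(h_bar, c_bar), (1, h_bar)]"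

fun cdh_comul_letters :: "cdh_gen list \<Rightarrow> ('k::field cdh \<times> 'k cdh) list" where
  "cdh_comul_letters [] = [(1, 1)]"
| "cdh_comul_letters (x # xs) =
     [(a * a', b * b'). (a, b) \<leftarrow> cdh_comul_gen x, (a', b') \<leftarrow> cdh_comul_letters xs]"

fun cdh_counit_gen :: "cdh_gen \<Rightarrow> 'k::field" where
  "cdh_counit_gen Gen_c = 1"
| "cdh_counit_gen Gen_d = 1"
| "cdh_counit_gen Gen_h = 0"

fun cdh_antipode_gen :: "cdh_gen \<Rightarrow> 'k::field cdh" where
  "cdh_antipode_gen Gen_c = d_bar"
| "cdh_antipode_gen Gen_d = c_bar"
| "cdh_antipode_gen Gen_h = - (h_bar * d_bar)"

definition cdh_hopf :: "('k::field, 'k cdh) hopf" where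
  "cdh_hopf = \<lparr>scl = cdh_scale, mul = (*), unt = 1,
     comul = (\<lambda>x. tensor_class cdh_scale cdh_scale
       (lin_ext pm_scale (\<lambda>w. formal_sum (cdh_comul_letters (letters w))) (rep_cdh x))),
     counit = (\<lambda>x. lin_ext (*) (\<lambda>w. \<Prod>y\<leftarrow>letters w. cdh_counit_gen y) (rep_cdh x)),
     antipode = (\<lambda>x. lin_ext cdh_scale (\<lambda>w. \<Prod>y\<leftarrow>rev (letters w). cdh_antipode_gen y) (rep_cdh x))\<rparr>"

lemma vector_space_cdh_scale: "vector_space (cdh_scale :: 'k::field \<Rightarrow> 'k cdh \<Rightarrow> _)"
proof -
  interpret vector_space "pm_scale :: 'k \<Rightarrow> (cdh_gen fword \<Rightarrow>\<^sub>0 'k) \<Rightarrow> _"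
    by (rule vector_space_pm_scale)
  show ?thesis
    by (intro vector_space.intro; transfer)
       (simp_all add: cdh_rel_def cdh_ideal_0 scale_right_distrib scale_left_distrib)
qed


section \<open>The finite dual of \<open>k\<langle>c, d, h\<rangle>/I\<close>\<close>

typedef (overloaded) 'k cdh_dual = "finite_dual (cdh_hopf :: ('k::field, 'k cdh) hopf)"
  by (rule exI, rule finite_dual_subspace(1)) (simp add: cdh_hopf_def vector_space_cdh_scale)

setup_lifting type_definition_cdh_dual

lemmas cdh_finite_dual_subspace =
  finite_dual_subspace[of cdh_hopf, unfolded cdh_hopf_def alg.simps, OF vector_space_cdh_scale,
    folded cdh_hopf_def]

instantiation cdh_dual :: (field) ab_group_add
begin

lift_definition zero_cdh_dual :: "'a cdh_dual" is "\<lambda>_. 0"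
  by (rule cdh_finite_dual_subspace)

lift_definition plus_cdh_dual :: "'a cdh_dual \<Rightarrow> 'a cdh_dual \<Rightarrow> 'a cdh_dual" is "\<lambda>f g x. f x + g x"
  by (rule cdh_finite_dual_subspace)

lift_definition uminus_cdh_dual :: "'a cdh_dual \<Rightarrow> 'a cdh_dual" is "\<lambda>f x. - f x"
  using cdh_finite_dual_subspace(3)[of _ "-1"] by simp

lift_definition minus_cdh_dual :: "'a cdh_dual \<Rightarrow> 'a cdh_dual \<Rightarrow> 'a cdh_dual" is "\<lambda>f g x. f x - g x"
  using cdh_finite_dual_subspace(2)[OF _ cdh_finite_dual_subspace(3)[of _ "-1"]] by simp

instance
  by standard (transfer, simp add: algebra_simps)+

end

lift_definition cdh_dual_scale :: "'k::field \<Rightarrow> 'k cdh_dual \<Rightarrow> 'k cdh_dual" is "\<lambda>c f x. c * f x"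
  by (rule cdh_finite_dual_subspace)

text \<open>
  The comultiplication sends \<open>\<lambda>\<close> to the unique \<open>\<Sum> \<lambda>\<^sub>i \<otimes> \<mu>\<^sub>i\<close> with \<open>\<lambda>(x y) = \<Sum> \<lambda>\<^sub>i(x) \<mu>\<^sub>i(y)\<close>.
\<close>

definition cdh_dual_hopf :: "('k::field, 'k cdh_dual) hopf" where
  "cdh_dual_hopf = \<lparr>scl = cdh_dual_scale,
     mul = (\<lambda>f g. Abs_cdh_dual (convolution cdh_hopf (Rep_cdh_dual f) (Rep_cdh_dual g))),
     unt = Abs_cdh_dual (counit cdh_hopf),
     comul = (\<lambda>f. THE T. T \<in> tensor_space cdh_dual_scale cdh_dual_scale \<and>
       (\<forall>x y. Rep_cdh_dual f (x * y) =
          (\<Sum>(p, q)\<leftarrow>sweedler cdh_dual_scale cdh_dual_scale T. Rep_cdh_dual p x * Rep_cdh_dual q y))),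
     counit = (\<lambda>f. Rep_cdh_dual f 1),
     antipode = (\<lambda>f. Abs_cdh_dual (\<lambda>x. Rep_cdh_dual f (antipode cdh_hopf x)))\<rparr>"


section \<open>The algebra \<open>k \<times> k\<close> and the actions on it\<close>

definition kk :: "('k::field, 'k \<times> 'k) alg" where
  "kk = \<lparr>scl = (\<lambda>c (a, b). (c * a, c * b)), mul = (\<lambda>(a, b) (a', b'). (a * a', b * b')),
     unt = (1, 1)\<rparr>"

definition field_hopf :: "('k::field, 'k) hopf" where
  "field_hopf = \<lparr>scl = (*), mul = (*), unt = 1,
     comul = (\<lambda>x. tens (*) (*) [(x, 1)]), counit = id, antipode = id\<rparr>"

definition psi1 :: "'k::field \<Rightarrow> 'k \<times> 'k \<Rightarrow> 'k \<times> 'k" where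
  "psi1 x a = scl kk x a"

definition group_hopf :: "('k::field, 'g::group_add \<Rightarrow>\<^sub>0 'k) hopf" where
  "group_hopf = \<lparr>scl = pm_scale, mul = (*), unt = 1,
     comul = (\<lambda>x. tensor_class pm_scale pm_scale (lin_ext pm_scale
       (\<lambda>g. Poly_Mapping.single (Poly_Mapping.single g 1, Poly_Mapping.single g 1) 1) x)),
     counit = (\<lambda>x. lin_ext (*) (\<lambda>g. 1) x),
     antipode = (\<lambda>x. lin_ext pm_scale (\<lambda>g. Poly_Mapping.single (- g) 1) x)\<rparr>"

text \<open>The cyclic group of order two is the additive group of \<open>bit\<close>, with generator \<open>1\<close>.\<close>

definition C2_gen :: "bit \<Rightarrow>\<^sub>0 'k::field" where
  "C2_gen = Poly_Mapping.single 1 1"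

definition psi2 :: "(bit \<Rightarrow>\<^sub>0 'k::field) \<Rightarrow> 'k \<times> 'k \<Rightarrow> 'k \<times> 'k" where
  "psi2 x a = lin_ext (scl kk) (\<lambda>g. if g = 0 then a else prod.swap a) x"

text \<open>The coaction determined by \<open>(1, 1) \<mapsto> (1, 1) \<otimes> 1\<close> and \<open>(1, 0) \<mapsto> (1, 1) \<otimes> h + (1, 0) \<otimes> c\<close>.\<close>

definition rho3 :: "'k::field \<times> 'k \<Rightarrow> ('k \<times> 'k, 'k cdh, 'k) tensor" where
  "rho3 = (\<lambda>(a, b). tens (scl kk) (scl cdh_hopf)
     [((b, b), 1), ((a - b, a - b), h_bar), ((a - b, 0), c_bar)])"

definition psi3 :: "'k::field cdh_dual \<Rightarrow> 'k \<times> 'k \<Rightarrow> 'k \<times> 'k" where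
  "psi3 f = coaction_dual cdh_hopf kk rho3 (Rep_cdh_dual f)"

text \<open>The Sweedler algebra: \<open>(x\<^sub>1, x\<^sub>c, x\<^sub>v, x\<^sub>w)\<close> stands for \<open>x\<^sub>1 1 + x\<^sub>c c + x\<^sub>v v + x\<^sub>w cv\<close>.\<close>

type_synonym 'k h4 = "'k \<times> 'k \<times> 'k \<times> 'k"

definition h4_scale :: "'k::field \<Rightarrow> 'k h4 \<Rightarrow> 'k h4" where
  "h4_scale = (\<lambda>r (x1, xc, xv, xw). (r * x1, r * xc, r * xv, r * xw))"

definition h4_mult :: "'k::field h4 \<Rightarrow> 'k h4 \<Rightarrow> 'k h4" where
  "h4_mult = (\<lambda>(x1, xc, xv, xw) (y1, yc, yv, yw).
     (x1 * y1 + xc * yc,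
      x1 * yc + xc * y1,
      x1 * yv + xv * y1 + xc * yw - xw * yc,
      x1 * yw + xw * y1 + xc * yv - xv * yc))"

definition h4_one :: "'k::field h4" where "h4_one = (1, 0, 0, 0)"
definition h4_c :: "'k::field h4" where "h4_c = (0, 1, 0, 0)"
definition h4_v :: "'k::field h4" where "h4_v = (0, 0, 1, 0)"
definition h4_cv :: "'k::field h4" where "h4_cv = h4_mult h4_c h4_v"

lemma h4_relations:
  "h4_mult h4_c h4_c = h4_one" "h4_mult h4_v h4_v = 0"
  "h4_mult h4_v h4_c = - h4_cv" "h4_cv = (0, 0, 0, 1)"
  by (simp_all add: h4_mult_def h4_one_def h4_c_def h4_v_def h4_cv_def zero_prod_def)

text \<open>\<open>\<Delta>(cv) = (c \<otimes> c) (c \<otimes> v + v \<otimes> 1) = 1 \<otimes> cv + cv \<otimes> c\<close> and \<open>S(cv) = S(v) S(c) = - c v c = v\<close>.\<close>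

definition h4_hopf :: "('k::field, 'k h4) hopf" where
  "h4_hopf = \<lparr>scl = h4_scale, mul = h4_mult, unt = h4_one,
     comul = (\<lambda>(x1, xc, xv, xw). tens h4_scale h4_scale
       [(h4_scale x1 h4_one, h4_one), (h4_scale xc h4_c, h4_c),
        (h4_scale xv h4_c, h4_v), (h4_scale xv h4_v, h4_one),
        (h4_scale xw h4_one, h4_cv), (h4_scale xw h4_cv, h4_c)]),
     counit = (\<lambda>(x1, xc, xv, xw). x1 + xc),
     antipode = (\<lambda>(x1, xc, xv, xw). (x1, xc, xw, - xv))\<rparr>"

text \<open>\<open>cv\<close> acts as the composite of the operators of \<open>c\<close> and \<open>v\<close>.\<close>

definition psi3b :: "'k::field h4 \<Rightarrow> 'k \<times> 'k \<Rightarrow> 'k \<times> 'k" where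
  "psi3b = (\<lambda>(x1, xc, xv, xw) a.
     let c = prod.swap; v = (\<lambda>(\<alpha>, \<beta>). (\<alpha> - \<beta>, \<alpha> - \<beta>)) in
     scl kk x1 a + scl kk xc (c a) + scl kk xv (v a) + scl kk xw (c (v a)))"

end

theory Submission
  imports Defs
begin

text \<open>
  Put \<open>e = (1, 0)\<close>.  A unital action of \<open>H\<close> on \<open>k \<times> k\<close> fixes the line of \<open>1\<close>, so it is determined by the
  two functionals in \<open>h e = \<alpha>(h) 1 + \<beta>(h) e\<close>, and every operator is upper triangular in the basis
  \<open>1, e\<close> with entries \<open>\<epsilon>(h)\<close>, \<open>\<alpha>(h)\<close>, \<open>\<beta>(h)\<close>.  The axioms of an action translate into
  identities for these functionals: associativity gives \<open>\<Delta>(\<beta>) = \<beta> \<otimes> \<beta>\<close> and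
  \<open>\<Delta>(\<alpha>) = \<alpha> \<otimes> \<beta> + \<epsilon> \<otimes> \<alpha>\<close> (\<open>coefficients_mul\<close>), and \<open>e\<^sup>2 = e\<close> gives \<open>\<alpha>\<^sup>2 = \<alpha>\<close> and
  \<open>\<alpha>\<beta> + \<beta>\<alpha> + \<beta>\<^sup>2 = \<beta>\<close> for the convolution product (\<open>coefficients_idempotent\<close>).  The character \<open>\<beta>\<close>
  has the convolution inverse \<open>\<beta> \<circ> S\<close>.  These are the relations and the comultiplication of
  \<open>k\<langle>c, d, h\<rangle>/I\<close> with \<open>c \<mapsto> \<beta>\<close>, \<open>d \<mapsto> \<beta> \<circ> S\<close> and \<open>h \<mapsto> \<alpha>\<close>.

  Classification.  If \<open>\<epsilon>\<close>, \<open>\<alpha>\<close>, \<open>\<beta>\<close> are linearly independent, then all upper triangular operators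
  occur (\<open>cosupp_full\<close>).  Otherwise \<open>\<epsilon> = \<beta> + 2\<alpha>\<close> (\<open>dependent_coefficients\<close>), so that \<open>H\<close> acts by
  combinations of the identity and of the swap of the coordinates, and \<open>\<alpha> = 0\<close> or \<open>\<alpha> \<noteq> 0\<close> decides
  between the first two cosupports (\<open>cosupp_cases\<close>).  The cosupports coincide with those of \<open>\<psi>\<^sub>1\<close>,
  \<open>\<psi>\<^sub>2\<close>, \<open>\<psi>\<^sub>3\<close>, so the identity of \<open>k \<times> k\<close> is an equivalence.  That \<open>\<psi>\<^sub>3\<close> has full cosupport
  needs enough elements in the finite dual, and these come from two-dimensional representations
  of \<open>k\<langle>c, d, h\<rangle>/I\<close> (\<open>cdh_dual_interpolation\<close>).

  Universality.  For \<open>\<psi>\<^sub>1\<close> the homomorphism is the counit.  For \<open>\<psi>\<^sub>2\<close> the two coefficients of the identity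
  and of the swap are orthogonal idempotents with sum \<open>\<epsilon>\<close>, which makes them the coordinates of a
  homomorphism into the group algebra.  For \<open>\<psi>\<^sub>3\<close> the identities above give an algebra homomorphism
  from \<open>k\<langle>c, d, h\<rangle>/I\<close> to the dual of \<open>H\<close>, and its transpose takes values in the finite dual
  (\<open>hopf_hom_transpose\<close>, \<open>transpose_unique\<close>).

  Two devices keep the verification of Hopf algebra axioms manageable.  Tensors are equal when products of
  functionals from point separating families agree on them (\<open>tens_eqI\<close>, \<open>tens3_eqI\<close>), so axioms of a
  Hopf algebra become identities for convolutions of functionals (\<open>hopf_algebraI\<close>).  And a map out of
  \<open>k\<langle>c, d, h\<rangle>/I\<close> is obtained from operators that satisfy the defining relations, by letting the algebra
  act on a vector (\<open>cdh_module\<close>).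
\<close>

section \<open>Linear, bilinear and trilinear maps\<close>

abbreviation functional :: "('k::field \<Rightarrow> 'v \<Rightarrow> 'v::ab_group_add) \<Rightarrow> ('v \<Rightarrow> 'k) \<Rightarrow> bool" where
  "functional s f \<equiv> Vector_Spaces.linear s (*) f"

lemma linearD:
  assumes "Vector_Spaces.linear s t f"
  shows "f (x + y) = f x + f y" "f (s c x) = t c (f x)" "f 0 = 0" "f (- x) = - f x" "f (x - y) = f x - f y"
    "f (sum_list xs) = (\<Sum>x\<leftarrow>xs. f x)"
proof -
  interpret Vector_Spaces.linear s t f by fact
  show "f (x + y) = f x + f y" "f (s c x) = t c (f x)" "f 0 = 0" "f (- x) = - f x" "f (x - y) = f x - f y"
    by (simp_all add: add scale zero neg diff)
  show "f (sum_list xs) = (\<Sum>x\<leftarrow>xs. f x)"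
    by (induction xs) (simp_all add: add zero)
qed

lemma linear_space:
  assumes "Vector_Spaces.linear s t f"
  shows "vector_space s" "vector_space t"
  using assms by (simp_all add: Vector_Spaces.linear_iff)

lemma linear_mapI:
  assumes "vector_space s" "vector_space t" "\<And>x y. f (x + y) = f x + f y" "\<And>c x. f (s c x) = t c (f x)"
  shows "Vector_Spaces.linear s t f"
  using assms by (simp add: Vector_Spaces.linear_iff)

lemma vector_spaceD:
  assumes "vector_space s"
  shows "s a (x + y) = s a x + s a y" "s (a + b) x = s a x + s b x" "s a (s b x) = s (a * b) x"
    "s 1 x = x" "s 0 x = 0" "s a 0 = 0"
proof -
  interpret vector_space s by fact
  show "s a (x + y) = s a x + s a y" "s (a + b) x = s a x + s b x" "s a (s b x) = s (a * b) x"
    "s 1 x = x" "s 0 x = 0" "s a 0 = 0"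
    by (simp_all add: scale_right_distrib scale_left_distrib)
qed

lemma vector_space_diff:
  assumes "vector_space s"
  shows "s a (x - y) = s a x - s a y" "s (a - b) x = s a x - s b x"
proof -
  interpret vector_space s by fact
  show "s a (x - y) = s a x - s a y" "s (a - b) x = s a x - s b x"
    by (simp_all add: scale_left_diff_distrib scale_right_diff_distrib)
qed

lemma subspace_UNIV:
  assumes "vector_space s"
  shows "module.subspace s UNIV"
  using assms by (simp add: module.subspace_UNIV module_iff_vector_space)

lemma vector_space_mult: "vector_space ((*) :: 'k::field \<Rightarrow> 'k \<Rightarrow> 'k)"
  by unfold_locales (simp_all add: algebra_simps)

lemma linear_compose':
  assumes "Vector_Spaces.linear s t f" "Vector_Spaces.linear t r g"
  shows "Vector_Spaces.linear s r (\<lambda>x. g (f x))"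
  using assms by (simp add: Vector_Spaces.linear_iff)

lemma linear_plus:
  assumes "Vector_Spaces.linear s t f" "Vector_Spaces.linear s t g"
  shows "Vector_Spaces.linear s t (\<lambda>x. f x + g x)"
  using assms by (simp add: Vector_Spaces.linear_iff vector_spaceD)

lemma linear_zero_map:
  assumes "vector_space s" "vector_space t"
  shows "Vector_Spaces.linear s t (\<lambda>x. 0)"
  using assms by (simp add: Vector_Spaces.linear_iff vector_spaceD)

lemma linear_scaled:
  assumes "Vector_Spaces.linear s t f"
  shows "Vector_Spaces.linear s t (\<lambda>x. t c (f x))"
  using assms by (auto simp: Vector_Spaces.linear_iff vector_spaceD mult.commute)

lemma linear_sum_list:
  assumes "vector_space s" "vector_space t" "\<And>z. z \<in> set zs \<Longrightarrow> Vector_Spaces.linear s t (\<lambda>x. f x z)"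
  shows "Vector_Spaces.linear s t (\<lambda>x. \<Sum>z\<leftarrow>zs. f x z)"
  using assms by (induction zs) (auto intro: linear_plus linear_zero_map)

lemma functional_mult_right: "functional s f \<Longrightarrow> functional s (\<lambda>x. f x * c)"
  by (simp add: Vector_Spaces.linear_iff algebra_simps)

lemma functional_mult_left: "functional s f \<Longrightarrow> functional s (\<lambda>x. c * f x)"
  by (simp add: Vector_Spaces.linear_iff algebra_simps)

definition bilinear_map ::
  "('k::field \<Rightarrow> 'v \<Rightarrow> 'v::ab_group_add) \<Rightarrow> ('k \<Rightarrow> 'w \<Rightarrow> 'w::ab_group_add) \<Rightarrow>
   ('k \<Rightarrow> 'x \<Rightarrow> 'x::ab_group_add) \<Rightarrow> ('v \<Rightarrow> 'w \<Rightarrow> 'x) \<Rightarrow> bool" where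
  "bilinear_map s t r B \<longleftrightarrow>
     (\<forall>v. Vector_Spaces.linear t r (B v)) \<and> (\<forall>w. Vector_Spaces.linear s r (\<lambda>v. B v w))"

definition trilinear_map ::
  "('k::field \<Rightarrow> 'u \<Rightarrow> 'u::ab_group_add) \<Rightarrow> ('k \<Rightarrow> 'v \<Rightarrow> 'v::ab_group_add) \<Rightarrow>
   ('k \<Rightarrow> 'w \<Rightarrow> 'w::ab_group_add) \<Rightarrow> ('k \<Rightarrow> 'x \<Rightarrow> 'x::ab_group_add) \<Rightarrow>
   ('u \<Rightarrow> 'v \<Rightarrow> 'w \<Rightarrow> 'x) \<Rightarrow> bool" where
  "trilinear_map q s t r T \<longleftrightarrow>
     (\<forall>u. bilinear_map s t r (T u)) \<and> (\<forall>v w. Vector_Spaces.linear q r (\<lambda>u. T u v w))"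

lemma bilinear_mapD:
  assumes "bilinear_map s t r B"
  shows "Vector_Spaces.linear t r (B v)" "Vector_Spaces.linear s r (\<lambda>v. B v w)"
    "vector_space s" "vector_space t" "vector_space r"
    "B (v + v') w = B v w + B v' w" "B v (w + w') = B v w + B v w'"
    "B (s c v) w = r c (B v w)" "B v (t c w) = r c (B v w)"
  using assms unfolding bilinear_map_def Vector_Spaces.linear_iff by auto

lemma bilinear_product:
  assumes "functional s f" "functional t g"
  shows "bilinear_map s t (*) (\<lambda>v w. f v * g w)"
  using assms unfolding bilinear_map_def by (auto intro: functional_mult_left functional_mult_right)

lemma trilinear_product:
  assumes "functional s f" "functional t g" "functional r h"
  shows "trilinear_map s t r (*) (\<lambda>u v w. f u * g v * h w)"
  using assms unfolding trilinear_map_def bilinear_map_def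
  by (auto intro!: functional_mult_left functional_mult_right)

text \<open>
  Vectors can be compared by evaluating functionals; a family of functionals that is smaller than
  the whole dual space is often more convenient, for instance the coordinates of a basis, or the
  evaluations at points for a space of functions.
\<close>

definition point_separating ::
  "('k::field \<Rightarrow> 'v \<Rightarrow> 'v::ab_group_add) \<Rightarrow> ('v \<Rightarrow> 'k) set \<Rightarrow> bool" where
  "point_separating s F \<longleftrightarrow>
     vector_space s \<and> (\<forall>f\<in>F. functional s f) \<and> (\<forall>v. (\<forall>f\<in>F. f v = 0) \<longrightarrow> v = 0)"

lemma point_separating_eqI:
  assumes F: "point_separating s F" and eq: "\<And>f. f \<in> F \<Longrightarrow> f v = f w"
  shows "v = w"
proof -
  have "f (v - w) = 0" if f: "f \<in> F" for f
  proof -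
    have "functional s f" using F f by (simp add: point_separating_def)
    then show ?thesis using eq[OF f] by (simp add: linearD(5)[of s "(*)" f])
  qed
  then have "v - w = 0" using F unfolding point_separating_def by blast
  then show ?thesis by simp
qed

text \<open>
  A basis of the subspace stays independent when a vector outside is added, so a functional on the
  enlarged set may be prescribed freely and extended.
\<close>

lemma annihilating_functional:
  fixes s :: "'k::field \<Rightarrow> 'v \<Rightarrow> 'v::ab_group_add"
  assumes "vector_space s" "module.subspace s S" "p \<notin> S"
  shows "\<exists>f. functional s f \<and> (\<forall>x\<in>S. f x = 0) \<and> f p = 1"
proof -
  interpret vector_space_pair s "(*) :: 'k \<Rightarrow> _"
    by (intro vector_space_pair.intro assms vector_space_mult)
  obtain B where B: "B \<subseteq> S" "vs1.independent B" "S \<subseteq> vs1.span B"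
    by (rule vs1.maximal_independent_subset)
  have spB: "vs1.span B = S"
    using B assms(2) by (simp add: vs1.span_minimal subset_antisym)
  have "vs1.independent (insert p B)"
    using assms(3) B(2) spB by (simp add: vs1.independent_insertI)
  then obtain f where f: "functional s f" "\<forall>x\<in>insert p B. f x = (if x = p then 1 else 0)"
    using linear_independent_extend[of "insert p B" "\<lambda>x. if x = p then 1 else 0"] by blast
  have "p \<notin> B" using B(1) assms(3) by auto
  have "f x = 0" if "x \<in> S" for x
    using that unfolding spB[symmetric]
  proof (induction rule: vs1.span_induct_alt)
    case base
    then show ?case by (simp add: linearD[OF f(1)])
  next
    case (step c x y)
    then show ?case using f(2) \<open>p \<notin> B\<close> by (auto simp: linearD[OF f(1)])
  qed
  then show ?thesis using f by auto
qed

lemma point_separating_dual: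
  assumes "vector_space s"
  shows "point_separating s {f. functional s f}"
  unfolding point_separating_def
proof (intro conjI allI impI ballI assms)
  interpret vector_space s by fact
  fix v assume *: "\<forall>f\<in>{f. functional s f}. f v = 0"
  show "v = 0"
  proof (rule ccontr)
    assume "v \<noteq> 0"
    then obtain f where "functional s f" "f v = 1"
      using annihilating_functional[OF assms, of "{0}" v] by auto
    then show False using * by auto
  qed
qed auto

section \<open>Sums over lists of pure tensors\<close>

text \<open>
  A list of pairs stands for a sum of pure tensors, and summation over the list evaluates on it the
  linear map that a bilinear map induces on the tensor product.
\<close>

definition tsum :: "('v \<times> 'w) list \<Rightarrow> ('v \<Rightarrow> 'w \<Rightarrow> 'x::comm_monoid_add) \<Rightarrow> 'x" where
  "tsum xs B = (\<Sum>(a, b)\<leftarrow>xs. B a b)"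

definition tsum3 :: "('u \<times> 'v \<times> 'w) list \<Rightarrow> ('u \<Rightarrow> 'v \<Rightarrow> 'w \<Rightarrow> 'x::comm_monoid_add) \<Rightarrow> 'x" where
  "tsum3 xs T = (\<Sum>(a, b, c)\<leftarrow>xs. T a b c)"

lemma tsum_simps [simp]:
  "tsum [] B = 0" "tsum ((a, b) # xs) B = B a b + tsum xs B" "tsum (xs @ ys) B = tsum xs B + tsum ys B"
  by (simp_all add: tsum_def)

lemma tsum_0 [simp]: "tsum xs (\<lambda>a b. 0) = 0"
  by (induction xs) auto

lemma tsum_add: "tsum xs (\<lambda>a b. B a b + C a b) = tsum xs B + tsum xs C"
  by (induction xs) (auto simp: algebra_simps)

lemma tsum_diff: "tsum xs (\<lambda>a b. B a b - C a b) = tsum xs B - (tsum xs C :: _::ab_group_add)"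
  by (induction xs) (auto simp: algebra_simps)

lemma tsum_linear:
  assumes "Vector_Spaces.linear s t f"
  shows "f (tsum xs B) = tsum xs (\<lambda>a b. f (B a b))"
  by (induction xs) (auto simp: linearD[OF assms])

lemma tsum_mult:
  "tsum xs (\<lambda>a b. c * B a b) = c * (tsum xs B :: _::semiring_0)"
  "tsum xs (\<lambda>a b. B a b * c) = tsum xs B * (c :: _::semiring_0)"
  by (induction xs) (auto simp: algebra_simps)

lemma tsum_neg: "tsum xs (\<lambda>a b. - B a b) = - (tsum xs B :: _::ab_group_add)"
  by (induction xs) auto

lemma tsum_product:
  "tsum xs B * tsum ys C = tsum xs (\<lambda>a b. tsum ys (\<lambda>c d. B a b * (C c d :: _::semiring_0)))"
  by (simp add: tsum_mult)

lemma tsum_swap: "tsum xs (\<lambda>a b. tsum ys (B a b)) = tsum ys (\<lambda>c d. tsum xs (\<lambda>a b. B a b c d))"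
  by (induction xs) (auto simp: tsum_add)

lemma tsum_concat: "tsum (concat (map (\<lambda>(a, b). g a b) xs)) B = tsum xs (\<lambda>a b. tsum (g a b) B)"
  by (induction xs) auto

lemma tsum_map: "tsum (map (\<lambda>(a, b). (f a b, g a b)) xs) B = tsum xs (\<lambda>a b. B (f a b) (g a b))"
  by (induction xs) auto

lemma tsum3_simps [simp]:
  "tsum3 [] B = 0" "tsum3 ((a, b, c) # xs) B = B a b c + tsum3 xs B"
  "tsum3 (xs @ ys) B = tsum3 xs B + tsum3 ys B"
  by (simp_all add: tsum3_def)

lemma tsum3_concat: "tsum3 (concat (map (\<lambda>(a, b). g a b) xs)) B = tsum xs (\<lambda>a b. tsum3 (g a b) B)"
  by (induction xs) auto

lemma tsum3_map:
  "tsum3 (map (\<lambda>(a, b). (f a b, g a b, h a b)) xs) B = tsum xs (\<lambda>a b. B (f a b) (g a b) (h a b))"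
  by (induction xs) auto

lemma tsum3_map_Pair: "tsum3 (map (Pair a) xs) T = tsum xs (T a)"
  by (induction xs) auto

lemma linear_tsum:
  assumes "vector_space s" "vector_space t" "\<And>a b. Vector_Spaces.linear s t (\<lambda>x. f x a b)"
  shows "Vector_Spaces.linear s t (\<lambda>x. tsum zs (f x))"
  unfolding tsum_def by (rule linear_sum_list) (use assms in \<open>auto simp: case_prod_unfold\<close>)

section \<open>Linear extension\<close>

lemma lin_ext_superset:
  assumes "vector_space s" "finite A" "Poly_Mapping.keys p \<subseteq> A"
  shows "lin_ext s f p = (\<Sum>x\<in>A. s (Poly_Mapping.lookup p x) (f x))"
  unfolding lin_ext_def
  by (rule sum.mono_neutral_left)
    (use assms in \<open>auto simp: in_keys_iff vector_spaceD\<close>)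

lemma linear_lin_ext:
  fixes s :: "'k::field \<Rightarrow> 'v \<Rightarrow> 'v::ab_group_add" and f :: "'x \<Rightarrow> 'v"
  assumes "vector_space s"
  shows "Vector_Spaces.linear pm_scale s (lin_ext s f)"
proof (rule linear_mapI[OF vector_space_pm_scale assms])
  interpret vector_space s by fact
  fix p q :: "'x \<Rightarrow>\<^sub>0 'k"
  let ?A = "Poly_Mapping.keys p \<union> Poly_Mapping.keys q"
  have "Poly_Mapping.keys (p + q) \<subseteq> ?A" by (rule keys_add)
  then show "lin_ext s f (p + q) = lin_ext s f p + lin_ext s f q"
    by (simp add: lin_ext_superset[OF assms, of ?A] lookup_add scale_left_distrib sum.distrib)
next
  interpret vector_space s by fact
  fix c and p :: "'x \<Rightarrow>\<^sub>0 'k"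
  have "Poly_Mapping.keys (pm_scale c p) \<subseteq> Poly_Mapping.keys p"
    by (auto simp: in_keys_iff lookup_pm_scale)
  then show "lin_ext s f (pm_scale c p) = s c (lin_ext s f p)"
    by (simp add: lin_ext_superset[OF assms, of "Poly_Mapping.keys p"] lookup_pm_scale scale_sum_right)
qed

lemmas lin_ext_linearD = linearD[OF linear_lin_ext]

lemma lin_ext_single [simp]:
  assumes "vector_space s"
  shows "lin_ext s f (Poly_Mapping.single x c) = s c (f x)"
  by (subst lin_ext_superset[OF assms, of "{x}"]) auto

lemma lin_ext_formal_sum [simp]:
  assumes "vector_space s"
  shows "lin_ext s f (formal_sum xs) = (\<Sum>x\<leftarrow>xs. f x)"
  unfolding formal_sum_def
  by (induction xs) (simp_all add: lin_ext_linearD assms vector_spaceD)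

lemma pm_eq_sum_single: "p = (\<Sum>x\<in>Poly_Mapping.keys p. Poly_Mapping.single x (Poly_Mapping.lookup p x))"
  by (rule poly_mapping_eqI)
    (auto simp: lookup_sum lookup_single when_def in_keys_iff if_distrib cong: if_cong)

lemma pm_induct [case_names single add]:
  assumes "\<And>x c. P (Poly_Mapping.single x c)" "\<And>p q. P p \<Longrightarrow> P q \<Longrightarrow> P (p + q)"
  shows "P (p :: 'x \<Rightarrow>\<^sub>0 'k::ab_group_add)"
proof -
  have "P (\<Sum>x\<in>A. Poly_Mapping.single x (Poly_Mapping.lookup p x))" if "finite A" for A
    using that by (induction rule: finite_induct)
      (auto intro: assms, metis assms(1) single_zero)
  then show ?thesis by (metis pm_eq_sum_single finite_keys)
qed

text \<open>A linear map out of a space with a basis is the linear extension of its values on the basis.\<close>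

lemma linear_eq_lin_ext:
  assumes "Vector_Spaces.linear pm_scale s L"
  shows "L p = lin_ext s (\<lambda>x. L (Poly_Mapping.single x 1)) p"
proof (induction p rule: pm_induct)
  case (single x c)
  have "Poly_Mapping.single x c = pm_scale c (Poly_Mapping.single x (1::'a))"
    by (rule poly_mapping_eqI) (simp add: lookup_pm_scale lookup_single when_def)
  then have "L (Poly_Mapping.single x c) = s c (L (Poly_Mapping.single x 1))"
    by (simp only: linearD(2)[OF assms])
  then show ?case by (simp add: linear_space(2)[OF assms])
next
  case (add p q)
  then show ?case by (simp add: linearD[OF assms] lin_ext_linearD[OF linear_space(2)[OF assms]])
qed

lemma pm_scale_single: "pm_scale a (Poly_Mapping.single w c) = Poly_Mapping.single w (a * c)"
  by (rule poly_mapping_eqI) (simp add: lookup_pm_scale lookup_single when_def)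

lemma pm_scale_mult:
  fixes p q :: "'x::monoid_add \<Rightarrow>\<^sub>0 'k::field"
  shows "pm_scale a p * q = pm_scale a (p * q)" "p * pm_scale a q = pm_scale a (p * q)"
proof -
  interpret pm: vector_space "pm_scale :: 'k \<Rightarrow> ('x \<Rightarrow>\<^sub>0 'k) \<Rightarrow> _"
    by (rule vector_space_pm_scale)
  have "pm_scale a p * q = pm_scale a (p * q) \<and> p * pm_scale a q = pm_scale a (p * q)"
  proof (induction p rule: pm_induct)
    case (single u b)
    show ?case
      by (induction q rule: pm_induct)
        (auto simp: mult_single pm_scale_single pm.scale_right_distrib distrib_left mult.assoc mult.left_commute)
  next
    case (add p q)
    then show ?case by (simp add: distrib_right pm.scale_right_distrib)
  qed
  then show "pm_scale a p * q = pm_scale a (p * q)" "p * pm_scale a q = pm_scale a (p * q)" by simp_all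
qed

lemma lin_ext_compose:
  assumes "Vector_Spaces.linear s t f"
  shows "f (lin_ext s g p) = lin_ext t (\<lambda>x. f (g x)) p"
proof -
  interpret Vector_Spaces.linear s t f by fact
  show ?thesis by (simp add: lin_ext_def sum scale)
qed

section \<open>Tensor products\<close>

lemma tensor_rel_bilinear:
  assumes B: "bilinear_map s t r B" and p: "p \<in> tensor_rel s t"
  shows "lin_ext r (\<lambda>(v, w). B v w) p = 0"
proof -
  interpret pm: vector_space "pm_scale :: 'a \<Rightarrow> ('b \<times> 'c \<Rightarrow>\<^sub>0 'a) \<Rightarrow> _"
    by (rule vector_space_pm_scale)
  note bd = bilinear_mapD[OF B]
  interpret r: vector_space r by (rule bd)
  note vd = lin_ext_linearD[OF bd(5)] lin_ext_single[OF bd(5)]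
  show ?thesis using p unfolding tensor_rel_def
  proof (induction rule: pm.span_induct_alt)
    case base
    then show ?case by (simp add: vd)
  next
    case (step c x y)
    have "lin_ext r (\<lambda>(v, w). B v w) x = 0"
      using step(1) by (elim UnE CollectE exE conjE) (simp_all add: vd bd(6-9))
    then show ?case using step(2) by (simp add: vd)
  qed
qed

lemma tensor_rel_subspace: "module.subspace pm_scale (tensor_rel s t)"
proof -
  interpret pm: vector_space "pm_scale :: 'a \<Rightarrow> ('b \<times> 'c \<Rightarrow>\<^sub>0 'a) \<Rightarrow> _"
    by (rule vector_space_pm_scale)
  show ?thesis unfolding tensor_rel_def by (rule pm.subspace_span)
qed

text \<open>
  The relations are exactly the common kernel of the bilinear forms: a formal combination outside
  their span is detected by a functional that vanishes on the span, and such a functional is a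
  bilinear form.
\<close>

lemma in_tensor_rel_bilinear:
  fixes s :: "'k::field \<Rightarrow> 'v \<Rightarrow> 'v::ab_group_add" and t :: "'k \<Rightarrow> 'w \<Rightarrow> 'w::ab_group_add"
  assumes "vector_space s" "vector_space t"
    and *: "\<And>B. bilinear_map s t (*) B \<Longrightarrow> lin_ext (*) (\<lambda>(v, w). B v w) p = 0"
  shows "p \<in> tensor_rel s t"
proof (rule ccontr)
  interpret pm: vector_space "pm_scale :: 'k \<Rightarrow> ('v \<times> 'w \<Rightarrow>\<^sub>0 'k) \<Rightarrow> _"
    by (rule vector_space_pm_scale)
  assume "p \<notin> tensor_rel s t"
  then obtain L where L: "functional pm_scale L" "\<And>x. x \<in> tensor_rel s t \<Longrightarrow> L x = 0" "L p = 1"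
    using annihilating_functional[OF vector_space_pm_scale tensor_rel_subspace] by blast
  have scale: "L (Poly_Mapping.single x c) = c * L (Poly_Mapping.single x 1)" for x c
    by (subst linear_eq_lin_ext[OF L(1)]) (simp add: vector_space_mult)
  define B where "B v w = L (Poly_Mapping.single (v, w) 1)" for v w
  note zero = L(2)[unfolded tensor_rel_def, OF pm.span_base] and dist = linearD[OF L(1)]
  have 1: "B (v + v') w = B v w + B v' w" for v v' w
  proof -
    have "L (Poly_Mapping.single (v + v', w) 1 - Poly_Mapping.single (v, w) 1
        - Poly_Mapping.single (v', w) 1) = 0" by (rule zero) blast
    then show ?thesis by (simp add: B_def dist algebra_simps)
  qed
  have 2: "B v (w + w') = B v w + B v w'" for v w w'
  proof -
    have "L (Poly_Mapping.single (v, w + w') 1 - Poly_Mapping.single (v, w) 1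
        - Poly_Mapping.single (v, w') 1) = 0" by (rule zero) blast
    then show ?thesis by (simp add: B_def dist algebra_simps)
  qed
  have 3: "B (s c v) w = c * B v w" for c v w
  proof -
    have "L (Poly_Mapping.single (s c v, w) 1 - Poly_Mapping.single (v, w) c) = 0" by (rule zero) blast
    then show ?thesis by (simp add: B_def dist scale[of _ c])
  qed
  have 4: "B v (t c w) = c * B v w" for c v w
  proof -
    have "L (Poly_Mapping.single (v, t c w) 1 - Poly_Mapping.single (v, w) c) = 0" by (rule zero) blast
    then show ?thesis by (simp add: B_def dist scale[of _ c])
  qed
  have "bilinear_map s t (*) B"
    unfolding bilinear_map_def Vector_Spaces.linear_iff by (simp add: assms vector_space_mult 1 2 3 4)
  from *[OF this] have "L p = 0"
    by (subst linear_eq_lin_ext[OF L(1)]) (simp add: B_def case_prod_unfold)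
  then show False using L(3) by simp
qed

text \<open>
  Expanding the first factor in a basis turns an arbitrary form into a finite sum of products, so
  that vanishing of all products of functionals forces vanishing of the form.  The second factor
  ranges over an arbitrary type, which may itself be a type of pairs; this covers twofold and
  threefold tensor products alike.
\<close>

lemma tsum_eq_0_by_products:
  fixes s :: "'k::field \<Rightarrow> 'v \<Rightarrow> 'v::ab_group_add"
  assumes F: "point_separating s F"
    and zero: "\<And>f b. f \<in> F \<Longrightarrow> b \<in> \<B> \<Longrightarrow> tsum xs (\<lambda>u z. f u * b z) = 0"
    and T: "\<And>z. functional s (\<lambda>u. T u z)" "\<And>u. T u \<in> \<B>"
  shows "tsum xs T = 0"
proof -
  have vs: "vector_space s" using F by (simp add: point_separating_def)
  interpret vector_space s by fact
  define E where "E = extend_basis {}"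
  have E: "independent E" "span E = UNIV"
    by (simp_all add: E_def independent_extend_basis span_extend_basis independent_empty)
  define A where "A = (\<Union>u\<in>fst ` set xs. {e. representation E u e \<noteq> 0})"
  have finA: "finite A" by (simp add: A_def finite_representation)
  have expand: "T u z = (\<Sum>e\<in>A. representation E u e * T e z)" if "(u, z) \<in> set xs" for u z
  proof -
    interpret Vector_Spaces.linear s "(*)" "\<lambda>u. T u z" by (rule T)
    have "u = (\<Sum>e\<in>{e. representation E u e \<noteq> 0}. s (representation E u e) e)"
      by (simp add: sum_nonzero_representation_eq E)
    also have "\<dots> = (\<Sum>e\<in>A. s (representation E u e) e)"
      by (rule sum.mono_neutral_left) (use finA that in \<open>force simp: A_def\<close>)+
    finally have "T u z = T (\<Sum>e\<in>A. s (representation E u e) e) z" by simp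
    then show ?thesis by (simp add: sum scale)
  qed
  have coord: "tsum xs (\<lambda>u z. representation E u e * T e z) = 0" for e
  proof -
    have "tsum xs (\<lambda>u z. s (T e z) u) = 0"
    proof (rule point_separating_eqI[OF F])
      fix f assume f: "f \<in> F"
      then have lf: "functional s f" using F by (simp add: point_separating_def)
      have "f (tsum xs (\<lambda>u z. s (T e z) u)) = tsum xs (\<lambda>u z. f u * T e z)"
        by (simp add: tsum_linear[OF lf] linearD[OF lf] mult.commute)
      also have "\<dots> = 0" using f T(2) by (rule zero)
      finally show "f (tsum xs (\<lambda>u z. s (T e z) u)) = f 0" by (simp add: linearD[OF lf])
    qed
    moreover have "representation E (tsum xs (\<lambda>u z. s (T e z) u)) e =
        tsum xs (\<lambda>u z. representation E u e * T e z)"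
      by (simp add: tsum_linear[OF linear_representation[OF E]] representation_scale E mult.commute)
    ultimately show ?thesis by (simp add: representation_zero)
  qed
  have "tsum xs T = (\<Sum>(u, z)\<leftarrow>xs. \<Sum>e\<in>A. representation E u e * T e z)"
    unfolding tsum_def by (rule arg_cong[where f = sum_list], rule map_cong) (auto simp: expand)
  also have "\<dots> = (\<Sum>e\<in>A. tsum xs (\<lambda>u z. representation E u e * T e z))"
    unfolding tsum_def by (induction xs) (auto simp: sum.distrib)
  finally show ?thesis by (simp add: coord)
qed

lemma bilinear_eq_0_by_products:
  assumes F: "point_separating s F" and G: "point_separating t G"
    and zero: "\<And>f g. f \<in> F \<Longrightarrow> g \<in> G \<Longrightarrow> tsum xs (\<lambda>v w. f v * g w) = 0"
    and B: "bilinear_map s t (*) B"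
  shows "tsum xs B = 0"
proof (rule tsum_eq_0_by_products[OF F, where \<B> = "{g. functional t g}"])
  fix f g assume f: "f \<in> F" and g: "g \<in> {g. functional t g}"
  have "tsum xs (\<lambda>v w. t (f v) w) = 0"
  proof (rule point_separating_eqI[OF G])
    fix h assume h: "h \<in> G"
    then have lh: "functional t h" using G by (simp add: point_separating_def)
    show "h (tsum xs (\<lambda>v w. t (f v) w)) = h 0"
      using zero[OF f h] by (simp add: tsum_linear[OF lh] linearD[OF lh])
  qed
  moreover have lg: "functional t g" using g by simp
  ultimately have "g (tsum xs (\<lambda>v w. t (f v) w)) = 0" by (simp add: linearD(3)[OF lg])
  then show "tsum xs (\<lambda>u z. f u * g z) = 0" by (simp add: tsum_linear[OF lg] linearD(2)[OF lg])
qed (use B in \<open>auto simp: bilinear_map_def\<close>)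

lemma trilinear_eq_0_by_products:
  assumes F: "point_separating q F" and G: "point_separating s G" and H: "point_separating t H"
    and zero: "\<And>f g h. f \<in> F \<Longrightarrow> g \<in> G \<Longrightarrow> h \<in> H \<Longrightarrow> tsum3 xs (\<lambda>u v w. f u * g v * h w) = 0"
    and T: "trilinear_map q s t (*) T"
  shows "tsum3 xs T = 0"
proof -
  have "tsum xs (\<lambda>u z. T u (fst z) (snd z)) = 0"
  proof (rule tsum_eq_0_by_products[OF F, where \<B> = "{\<lambda>z. B (fst z) (snd z) |B. bilinear_map s t (*) B}"])
    fix f b assume f: "f \<in> F" and "b \<in> {\<lambda>z. B (fst z) (snd z) |B. bilinear_map s t (*) B}"
    then obtain B where b: "b = (\<lambda>z. B (fst z) (snd z))" and B: "bilinear_map s t (*) B" by auto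
    have "vector_space s" using G by (simp add: point_separating_def)
    have "tsum (map (\<lambda>(u, v, w). (s (f u) v, w)) xs) B = 0"
    proof (rule bilinear_eq_0_by_products[OF G H _ B])
      fix g h assume "g \<in> G" "h \<in> H"
      moreover have lg: "functional s g" using G \<open>g \<in> G\<close> by (simp add: point_separating_def)
      ultimately show "tsum (map (\<lambda>(u, v, w). (s (f u) v, w)) xs) (\<lambda>v w. g v * h w) = 0"
        using zero[OF f \<open>g \<in> G\<close> \<open>h \<in> H\<close>]
        by (simp add: tsum_def tsum3_def case_prod_unfold comp_def linearD[OF lg])
    qed
    then show "tsum xs (\<lambda>u z. f u * b z) = 0"
      by (simp add: b tsum_def case_prod_unfold comp_def bilinear_mapD[OF B])
  qed (use T in \<open>auto simp: trilinear_map_def\<close>)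
  then show ?thesis by (simp add: tsum_def tsum3_def case_prod_unfold)
qed

text \<open>Absorbing the coefficients into the first factor writes a formal combination as a list.\<close>

lemma pm_as_list:
  fixes s :: "'k::field \<Rightarrow> 'v \<Rightarrow> 'v::ab_group_add" and p :: "'v \<times> 'w \<Rightarrow>\<^sub>0 'k"
  obtains xs where
    "\<And>B. (\<And>w. functional s (\<lambda>v. B v w)) \<Longrightarrow> tsum xs B = lin_ext (*) (\<lambda>(v, w). B v w) p"
proof -
  have "\<exists>xs. \<forall>B. (\<forall>w. functional s (\<lambda>v. B v w)) \<longrightarrow> tsum xs B = lin_ext (*) (\<lambda>(v, w). B v w) p"
  proof (induction p rule: pm_induct)
    case (single x c)
    have "B (s c (fst x)) (snd x) = c * B (fst x) (snd x)"
      if "\<forall>w. functional s (\<lambda>v. B v w)" for B :: "'v \<Rightarrow> 'w \<Rightarrow> 'k"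
      using that by (simp add: Vector_Spaces.linear_iff)
    then show ?case
      by (intro exI[of _ "[(s c (fst x), snd x)]"]) (auto simp: vector_space_mult case_prod_unfold)
  next
    case (add p q)
    then obtain xs ys where
      "\<forall>B. (\<forall>w. functional s (\<lambda>v. B v w)) \<longrightarrow> tsum xs B = lin_ext (*) (\<lambda>(v, w). B v w) p"
      "\<forall>B. (\<forall>w. functional s (\<lambda>v. B v w)) \<longrightarrow> tsum ys B = lin_ext (*) (\<lambda>(v, w). B v w) q"
      by blast
    then show ?case
      by (intro exI[of _ "xs @ ys"]) (auto simp: vector_space_mult lin_ext_linearD)
  qed
  then show ?thesis using that by blast
qed

text \<open>
  Products of functionals from point separating families separate the points of the tensor product;
  equalities between tensors are established in this way.
\<close>

lemma in_tensor_rel: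
  assumes F: "point_separating s F" and G: "point_separating t G"
    and zero: "\<And>f g. f \<in> F \<Longrightarrow> g \<in> G \<Longrightarrow> lin_ext (*) (\<lambda>(v, w). f v * g w) p = 0"
  shows "p \<in> tensor_rel s t"
proof (rule in_tensor_rel_bilinear)
  show "vector_space s" "vector_space t" using F G by (simp_all add: point_separating_def)
  fix B assume B: "bilinear_map s t (*) B"
  obtain xs where xs: "\<And>B. (\<And>w. functional s (\<lambda>v. B v w)) \<Longrightarrow> tsum xs B = lin_ext (*) (\<lambda>(v, w). B v w) p"
    by (rule pm_as_list[of s p]) blast
  have "tsum xs B = 0"
  proof (rule bilinear_eq_0_by_products[OF F G _ B])
    fix f g assume fg: "f \<in> F" "g \<in> G"
    then have "functional s f" using F by (simp add: point_separating_def)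
    then show "tsum xs (\<lambda>v w. f v * g w) = 0"
      using zero[OF fg] xs[of "\<lambda>v w. f v * g w"] by (simp add: functional_mult_right)
  qed
  then show "lin_ext (*) (\<lambda>(v, w). B v w) p = 0"
    using xs[of B] bilinear_mapD(2)[OF B] by simp
qed

lemma tensor_class_eq_iff:
  fixes s :: "'k::field \<Rightarrow> 'v \<Rightarrow> 'v::ab_group_add" and t :: "'k \<Rightarrow> 'w \<Rightarrow> 'w::ab_group_add"
  shows "tensor_class s t p = tensor_class s t q \<longleftrightarrow> p - q \<in> tensor_rel s t"
proof -
  interpret pm: vector_space "pm_scale :: 'k \<Rightarrow> ('v \<times> 'w \<Rightarrow>\<^sub>0 'k) \<Rightarrow> _"
    by (rule vector_space_pm_scale)
  note sub = tensor_rel_subspace[of s t]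
  have "p - q \<in> tensor_rel s t" if "tensor_class s t p = tensor_class s t q"
  proof -
    have "p \<in> tensor_class s t p" using pm.subspace_0[OF sub] by (simp add: tensor_class_def)
    then have "p \<in> tensor_class s t q" by (simp only: that)
    then show ?thesis by (simp add: tensor_class_def)
  qed
  moreover have "tensor_class s t p = tensor_class s t q" if "p - q \<in> tensor_rel s t"
  proof -
    have "r - p \<in> tensor_rel s t \<longleftrightarrow> r - q \<in> tensor_rel s t" for r
    proof -
      have "(r - p) + (p - q) = r - q" "(r - q) - (p - q) = r - p" by simp_all
      then show ?thesis
        using pm.subspace_add[OF sub _ that] pm.subspace_diff[OF sub _ that] by metis
    qed
    then show ?thesis by (simp add: tensor_class_def)
  qed
  ultimately show ?thesis by blast
qed

lemma in_tensor_class_iff: "q \<in> tensor_class s t p \<longleftrightarrow> tensor_class s t q = tensor_class s t p"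
  by (simp add: tensor_class_eq_iff) (simp add: tensor_class_def)

lemma tensor_class_eqI:
  assumes "point_separating s F" "point_separating t G"
    and "\<And>f g. f \<in> F \<Longrightarrow> g \<in> G \<Longrightarrow>
      lin_ext (*) (\<lambda>(v, w). f v * g w) p = lin_ext (*) (\<lambda>(v, w). f v * g w) q"
  shows "tensor_class s t p = tensor_class s t q"
  unfolding tensor_class_eq_iff
  by (rule in_tensor_rel[OF assms(1,2)]) (simp add: lin_ext_linearD(5)[OF vector_space_mult] assms(3))

lemma tensor_class_eqD:
  assumes "tensor_class s t p = tensor_class s t q" "bilinear_map s t r B"
  shows "lin_ext r (\<lambda>(v, w). B v w) p = lin_ext r (\<lambda>(v, w). B v w) q"
  using tensor_rel_bilinear[OF assms(2), of "p - q"] assms(1)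
  by (simp add: tensor_class_eq_iff lin_ext_linearD(5)[OF bilinear_mapD(5)[OF assms(2)]])

lemma tens_eqI:
  assumes "point_separating s F" "point_separating t G"
    and "\<And>f g. f \<in> F \<Longrightarrow> g \<in> G \<Longrightarrow> tsum xs (\<lambda>v w. f v * g w) = tsum ys (\<lambda>v w. f v * g w)"
  shows "tens s t xs = tens s t ys"
  unfolding tens_def
  by (rule tensor_class_eqI[OF assms(1,2)]) (use assms(3) in \<open>simp add: vector_space_mult tsum_def\<close>)

lemma tens_eqD:
  assumes "tens s t xs = tens s t ys" "bilinear_map s t r B"
  shows "tsum xs B = tsum ys B"
  using tensor_class_eqD[OF assms(1)[unfolded tens_def] assms(2)] bilinear_mapD(5)[OF assms(2)]
  by (simp add: tsum_def)

lemma tensor_class_eq_tens: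
  assumes "vector_space s" "vector_space t"
  shows "\<exists>xs. tensor_class s t p = tens s t xs"
proof -
  obtain xs where xs: "\<And>B. (\<And>w. functional s (\<lambda>v. B v w)) \<Longrightarrow> tsum xs B = lin_ext (*) (\<lambda>(v, w). B v w) p"
    by (rule pm_as_list[of s p]) blast
  have "tensor_class s t p = tens s t xs"
    unfolding tens_def
  proof (rule tensor_class_eqI[OF point_separating_dual[OF assms(1)] point_separating_dual[OF assms(2)]])
    fix f g assume "f \<in> {f. functional s f}"
    then show "lin_ext (*) (\<lambda>(v, w). f v * g w) p = lin_ext (*) (\<lambda>(v, w). f v * g w) (formal_sum xs)"
      using xs[of "\<lambda>v w. f v * g w"] by (simp add: functional_mult_right vector_space_mult tsum_def)
  qed
  then show ?thesis ..
qed

lemma tens_sweedler: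
  assumes "vector_space s" "vector_space t" "T \<in> tensor_space s t"
  shows "tens s t (sweedler s t T) = T"
proof -
  obtain p where "T = tensor_class s t p" using assms(3) by (auto simp: tensor_space_def)
  then show ?thesis
    unfolding sweedler_def using tensor_class_eq_tens[OF assms(1,2), of p] by (metis (mono_tags) someI_ex)
qed

lemma tens_in_tensor_space [simp]: "tens s t xs \<in> tensor_space s t"
  by (simp add: tens_def tensor_space_def)

text \<open>Sums over a chosen representation may be computed from any other one.\<close>

lemma tsum_sweedler_tens:
  assumes "bilinear_map s t r B"
  shows "tsum (sweedler s t (tens s t xs)) B = tsum xs B"
  by (rule tens_eqD[OF tens_sweedler assms]) (use bilinear_mapD[OF assms] in auto)

lemma tsum_sweedler_class:
  assumes "bilinear_map s t r B"
  shows "tsum (sweedler s t (tensor_class s t p)) B = lin_ext r (\<lambda>(v, w). B v w) p"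
proof -
  have "tensor_class s t (formal_sum (sweedler s t (tensor_class s t p))) = tensor_class s t p"
    using tens_sweedler[of s t "tensor_class s t p"] bilinear_mapD(3,4)[OF assms]
    by (simp add: tens_def tensor_space_def)
  from tensor_class_eqD[OF this assms] show ?thesis
    using bilinear_mapD(5)[OF assms] by (simp add: tsum_def)
qed

lemma tensor_eqI:
  assumes "point_separating s F" "point_separating t G" "T \<in> tensor_space s t" "T' \<in> tensor_space s t"
    and "\<And>f g. f \<in> F \<Longrightarrow> g \<in> G \<Longrightarrow>
      tsum (sweedler s t T) (\<lambda>v w. f v * g w) = tsum (sweedler s t T') (\<lambda>v w. f v * g w)"
  shows "T = T'"
proof -
  have "vector_space s" "vector_space t" using assms(1,2) by (simp_all add: point_separating_def)
  then show ?thesis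
    using tens_eqI[OF assms(1,2), of "sweedler s t T" "sweedler s t T'"] assms(3-5)
    by (simp add: tens_sweedler)
qed

lemma tensor_linear_tsum:
  assumes f: "tensor_linear q s t f" and "vector_space q" and B: "bilinear_map s t r B"
  shows "Vector_Spaces.linear q r (\<lambda>x. tsum (sweedler s t (f x)) B)"
proof -
  note bd = bilinear_mapD[OF B]
  have val: "tsum (sweedler s t (f x)) B = lin_ext r (\<lambda>(v, w). B v w) p" if "p \<in> f x" for x p
  proof -
    have "f x \<in> tensor_space s t" using f by (simp add: tensor_linear_def)
    then obtain p' where p': "f x = tensor_class s t p'" by (auto simp: tensor_space_def)
    then have "f x = tensor_class s t p" using that by (simp add: in_tensor_class_iff)
    then show ?thesis using tsum_sweedler_class[OF B] by simp
  qed
  have ex: "\<exists>p. p \<in> f x" for x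
  proof -
    have "f x \<in> tensor_space s t" using f by (simp add: tensor_linear_def)
    then obtain p' where "f x = tensor_class s t p'" by (auto simp: tensor_space_def)
    then show ?thesis using in_tensor_class_iff[of p' s t p'] by auto
  qed
  show ?thesis
  proof (rule linear_mapI[OF \<open>vector_space q\<close> bd(5)])
    fix x y
    obtain p p' where p: "p \<in> f x" "p' \<in> f y" using ex by blast
    then have "p + p' \<in> f (x + y)" using f by (simp add: tensor_linear_def)
    then show "tsum (sweedler s t (f (x + y))) B = tsum (sweedler s t (f x)) B + tsum (sweedler s t (f y)) B"
      using p by (simp add: val lin_ext_linearD bd(5))
  next
    fix c x
    obtain p where p: "p \<in> f x" using ex by blast
    then have "pm_scale c p \<in> f (q c x)" using f by (simp add: tensor_linear_def)
    then show "tsum (sweedler s t (f (q c x))) B = r c (tsum (sweedler s t (f x)) B)"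
      using p by (simp add: val lin_ext_linearD bd(5))
  qed
qed

text \<open>
  A map into the tensor product is linear if its composites with the products of functionals are,
  since representatives of a class are recognised by their values under these products.
\<close>

lemma tensor_linearI:
  assumes F: "point_separating s F" and G: "point_separating t G"
    and space: "\<And>x. f x \<in> tensor_space s t"
    and lin: "\<And>f' g. f' \<in> F \<Longrightarrow> g \<in> G \<Longrightarrow> functional q (\<lambda>x. tsum (sweedler s t (f x)) (\<lambda>v w. f' v * g w))"
  shows "tensor_linear q s t f"
proof -
  have bil: "bilinear_map s t (*) (\<lambda>v w. f' v * g w)" if "f' \<in> F" "g \<in> G" for f' g
    using that F G by (simp add: point_separating_def bilinear_product)
  have val: "p \<in> f x \<longleftrightarrow> (\<forall>f'\<in>F. \<forall>g\<in>G. tsum (sweedler s t (f x)) (\<lambda>v w. f' v * g w) =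
      lin_ext (*) (\<lambda>(v, w). f' v * g w) p)" for x p
  proof -
    obtain p' where p': "f x = tensor_class s t p'" using space[of x] by (auto simp: tensor_space_def)
    have "p \<in> f x \<longleftrightarrow> (\<forall>f'\<in>F. \<forall>g\<in>G.
        lin_ext (*) (\<lambda>(v, w). f' v * g w) p' = lin_ext (*) (\<lambda>(v, w). f' v * g w) p)"
      unfolding p' in_tensor_class_iff
    proof
      assume "tensor_class s t p = tensor_class s t p'"
      then show "\<forall>f'\<in>F. \<forall>g\<in>G.
          lin_ext (*) (\<lambda>(v, w). f' v * g w) p' = lin_ext (*) (\<lambda>(v, w). f' v * g w) p"
        using tensor_class_eqD[OF _ bil, of p' p] by simp
    next
      assume *: "\<forall>f'\<in>F. \<forall>g\<in>G.
          lin_ext (*) (\<lambda>(v, w). f' v * g w) p' = lin_ext (*) (\<lambda>(v, w). f' v * g w) p"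
      show "tensor_class s t p = tensor_class s t p'"
        by (rule tensor_class_eqI[OF F G]) (simp add: *)
    qed
    then show ?thesis by (simp add: p' tsum_sweedler_class[OF bil])
  qed
  show ?thesis
    unfolding tensor_linear_def
  proof (intro conjI allI ballI space)
    fix x y p p' assume "p \<in> f x" "p' \<in> f y"
    then show "p + p' \<in> f (x + y)"
      by (simp add: val linearD(1)[OF lin] lin_ext_linearD(1)[OF vector_space_mult])
  next
    fix c x p assume "p \<in> f x"
    then show "pm_scale c p \<in> f (q c x)"
      by (simp add: val linearD(2)[OF lin] lin_ext_linearD(2)[OF vector_space_mult])
  qed
qed

section \<open>Threefold tensor products\<close>

lemma trilinear_mapD:
  assumes "trilinear_map q s t r T"
  shows "vector_space q" "vector_space s" "vector_space t" "vector_space r"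
    "T (u + u') v w = T u v w + T u' v w" "T u (v + v') w = T u v w + T u v' w"
    "T u v (w + w') = T u v w + T u v w'"
    "T (q c u) v w = r c (T u v w)" "T u (s c v) w = r c (T u v w)" "T u v (t c w) = r c (T u v w)"
    "bilinear_map s t r (T u)" "bilinear_map q t r (\<lambda>u w. T u v w)" "bilinear_map q s r (\<lambda>u v. T u v w)"
  using assms unfolding trilinear_map_def bilinear_map_def Vector_Spaces.linear_iff by auto

lemma tensor_rel3_trilinear:
  assumes T: "trilinear_map q s t r T" and p: "p \<in> tensor_rel3 q s t"
  shows "lin_ext r (\<lambda>(u, v, w). T u v w) p = 0"
proof -
  interpret pm: vector_space "pm_scale :: 'a \<Rightarrow> ('b \<times> 'c \<times> 'd \<Rightarrow>\<^sub>0 'a) \<Rightarrow> _"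
    by (rule vector_space_pm_scale)
  note td = trilinear_mapD[OF T]
  interpret r: vector_space r by (rule td)
  note vd = lin_ext_linearD[OF td(4)] lin_ext_single[OF td(4)]
  show ?thesis using p unfolding tensor_rel3_def
  proof (induction rule: pm.span_induct_alt)
    case base
    then show ?case by (simp add: vd)
  next
    case (step c x y)
    have "lin_ext r (\<lambda>(u, v, w). T u v w) x = 0"
      using step(1) by (elim UnE CollectE exE conjE) (simp_all add: vd td(5-10))
    then show ?case using step(2) by (simp add: vd)
  qed
qed

lemma tensor_rel3_subspace: "module.subspace pm_scale (tensor_rel3 q s t)"
proof -
  interpret pm: vector_space "pm_scale :: 'a \<Rightarrow> ('b \<times> 'c \<times> 'd \<Rightarrow>\<^sub>0 'a) \<Rightarrow> _"
    by (rule vector_space_pm_scale)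
  show ?thesis unfolding tensor_rel3_def by (rule pm.subspace_span)
qed

lemma in_tensor_rel3_trilinear:
  fixes q :: "'k::field \<Rightarrow> 'u \<Rightarrow> 'u::ab_group_add" and s :: "'k::field \<Rightarrow> 'v \<Rightarrow> 'v::ab_group_add"
    and t :: "'k \<Rightarrow> 'w \<Rightarrow> 'w::ab_group_add"
  assumes "vector_space q" "vector_space s" "vector_space t"
    and *: "\<And>T. trilinear_map q s t (*) T \<Longrightarrow> lin_ext (*) (\<lambda>(u, v, w). T u v w) p = 0"
  shows "p \<in> tensor_rel3 q s t"
proof (rule ccontr)
  interpret pm: vector_space "pm_scale :: 'k \<Rightarrow> ('u \<times> 'v \<times> 'w \<Rightarrow>\<^sub>0 'k) \<Rightarrow> _"
    by (rule vector_space_pm_scale)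
  assume "p \<notin> tensor_rel3 q s t"
  then obtain L where L: "functional pm_scale L" "\<And>x. x \<in> tensor_rel3 q s t \<Longrightarrow> L x = 0" "L p = 1"
    using annihilating_functional[OF vector_space_pm_scale tensor_rel3_subspace] by blast
  have scale: "L (Poly_Mapping.single x c) = c * L (Poly_Mapping.single x 1)" for x c
    by (subst linear_eq_lin_ext[OF L(1)]) (simp add: vector_space_mult)
  define T where "T u v w = L (Poly_Mapping.single (u, v, w) 1)" for u v w
  \<comment> \<open>Each family of generating relations is one term of a sixfold union; the chains of introduction
    rules below select it.\<close>
  note zero = L(2)[unfolded tensor_rel3_def, OF pm.span_base] and dist = linearD[OF L(1)]
  have 1: "T (u + u') v w = T u v w + T u' v w" for u u' v w
  proof -
    have "L (Poly_Mapping.single (u + u', v, w) 1 - Poly_Mapping.single (u, v, w) 1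
        - Poly_Mapping.single (u', v, w) 1) = 0" by (rule zero) (rule UnI1, rule UnI1, rule UnI1, rule UnI1, rule UnI1, blast)
    then show ?thesis by (simp add: T_def dist algebra_simps)
  qed
  have 2: "T u (v + v') w = T u v w + T u v' w" for u v v' w
  proof -
    have "L (Poly_Mapping.single (u, v + v', w) 1 - Poly_Mapping.single (u, v, w) 1
        - Poly_Mapping.single (u, v', w) 1) = 0" by (rule zero) (rule UnI1, rule UnI1, rule UnI1, rule UnI1, rule UnI2, blast)
    then show ?thesis by (simp add: T_def dist algebra_simps)
  qed
  have 3: "T u v (w + w') = T u v w + T u v w'" for u v w w'
  proof -
    have "L (Poly_Mapping.single (u, v, w + w') 1 - Poly_Mapping.single (u, v, w) 1
        - Poly_Mapping.single (u, v, w') 1) = 0" by (rule zero) (rule UnI1, rule UnI1, rule UnI1, rule UnI2, blast)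
    then show ?thesis by (simp add: T_def dist algebra_simps)
  qed
  have 4: "T (q c u) v w = c * T u v w" for c u v w
  proof -
    have "L (Poly_Mapping.single (q c u, v, w) 1 - Poly_Mapping.single (u, v, w) c) = 0"
      by (rule zero) (rule UnI1, rule UnI1, rule UnI2, blast)
    then show ?thesis by (simp add: T_def dist scale[of _ c])
  qed
  have 5: "T u (s c v) w = c * T u v w" for c u v w
  proof -
    have "L (Poly_Mapping.single (u, s c v, w) 1 - Poly_Mapping.single (u, v, w) c) = 0"
      by (rule zero) (rule UnI1, rule UnI2, blast)
    then show ?thesis by (simp add: T_def dist scale[of _ c])
  qed
  have 6: "T u v (t c w) = c * T u v w" for c u v w
  proof -
    have "L (Poly_Mapping.single (u, v, t c w) 1 - Poly_Mapping.single (u, v, w) c) = 0"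
      by (rule zero) (rule UnI2, blast)
    then show ?thesis by (simp add: T_def dist scale[of _ c])
  qed
  have "trilinear_map q s t (*) T"
    unfolding trilinear_map_def bilinear_map_def Vector_Spaces.linear_iff
    by (simp add: assms vector_space_mult 1 2 3 4 5 6)
  from *[OF this] have "L p = 0"
    by (subst linear_eq_lin_ext[OF L(1)]) (simp add: T_def case_prod_unfold)
  then show False using L(3) by simp
qed

lemma tens3_eqD:
  fixes q :: "'k::field \<Rightarrow> 'u \<Rightarrow> 'u::ab_group_add" and s :: "'k::field \<Rightarrow> 'v \<Rightarrow> 'v::ab_group_add"
    and t :: "'k \<Rightarrow> 'w \<Rightarrow> 'w::ab_group_add"
  assumes "tens3 q s t xs = tens3 q s t ys" "trilinear_map q s t r T"
  shows "tsum3 xs T = tsum3 ys T"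
proof -
  interpret pm: vector_space "pm_scale :: 'k \<Rightarrow> ('u \<times> 'v \<times> 'w \<Rightarrow>\<^sub>0 'k) \<Rightarrow> _"
    by (rule vector_space_pm_scale)
  note vs = trilinear_mapD(4)[OF assms(2)]
  have "formal_sum xs \<in> tens3 q s t xs"
    using pm.subspace_0[OF tensor_rel3_subspace] by (simp add: tens3_def)
  then have "formal_sum xs \<in> tens3 q s t ys" by (simp only: assms(1))
  then have "formal_sum xs - formal_sum ys \<in> tensor_rel3 q s t" by (simp add: tens3_def)
  from tensor_rel3_trilinear[OF assms(2) this] show ?thesis
    by (simp add: lin_ext_linearD(5)[OF vs] lin_ext_formal_sum[OF vs] tsum3_def)
qed

lemma tens3_eqI:
  fixes q :: "'k::field \<Rightarrow> 'u \<Rightarrow> 'u::ab_group_add" and s :: "'k::field \<Rightarrow> 'v \<Rightarrow> 'v::ab_group_add"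
    and t :: "'k \<Rightarrow> 'w \<Rightarrow> 'w::ab_group_add"
  assumes F: "point_separating q F" and G: "point_separating s G" and H: "point_separating t H"
    and eq: "\<And>f g h. f \<in> F \<Longrightarrow> g \<in> G \<Longrightarrow> h \<in> H \<Longrightarrow>
      tsum3 xs (\<lambda>u v w. f u * g v * h w) = tsum3 ys (\<lambda>u v w. f u * g v * h w)"
  shows "tens3 q s t xs = tens3 q s t ys"
proof -
  interpret pm: vector_space "pm_scale :: 'k \<Rightarrow> ('u \<times> 'v \<times> 'w \<Rightarrow>\<^sub>0 'k) \<Rightarrow> _"
    by (rule vector_space_pm_scale)
  interpret q: vector_space q using F by (simp add: point_separating_def)
  have neg: "tsum3 (map (\<lambda>(u, z). (- u, z)) ys) T = - tsum3 ys T"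
    if "\<And>v w. functional q (\<lambda>u. T u v w)" for T
    by (induction ys) (auto simp: linearD(4)[OF that])
  have rel: "formal_sum xs - formal_sum ys \<in> tensor_rel3 q s t"
  proof (rule in_tensor_rel3_trilinear)
    show "vector_space q" "vector_space s" "vector_space t"
      using F G H by (simp_all add: point_separating_def)
    fix T assume T: "trilinear_map q s t (*) T"
    have "tsum3 (xs @ map (\<lambda>(u, z). (- u, z)) ys) T = 0"
    proof (rule trilinear_eq_0_by_products[OF F G H _ T])
      fix f g h assume fgh: "f \<in> F" "g \<in> G" "h \<in> H"
      then have "functional q f" using F by (simp add: point_separating_def)
      then show "tsum3 (xs @ map (\<lambda>(u, z). (- u, z)) ys) (\<lambda>u v w. f u * g v * h w) = 0"
        using eq[OF fgh] by (simp add: neg functional_mult_right)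
    qed
    moreover have "functional q (\<lambda>u. T u v w)" for v w using T by (simp add: trilinear_map_def)
    ultimately have "tsum3 xs T = tsum3 ys T" by (simp add: neg)
    then show "lin_ext (*) (\<lambda>(u, v, w). T u v w) (formal_sum xs - formal_sum ys) = 0"
      by (simp add: lin_ext_linearD(5)[OF vector_space_mult] lin_ext_formal_sum[OF vector_space_mult] tsum3_def)
  qed
  note sub = tensor_rel3_subspace[of q s t]
  have "r - formal_sum xs \<in> tensor_rel3 q s t \<longleftrightarrow> r - formal_sum ys \<in> tensor_rel3 q s t" for r
  proof -
    have "(r - formal_sum xs) + (formal_sum xs - formal_sum ys) = r - formal_sum ys"
      "(r - formal_sum ys) - (formal_sum xs - formal_sum ys) = r - formal_sum xs" by simp_all
    then show ?thesis
      using pm.subspace_add[OF sub _ rel] pm.subspace_diff[OF sub _ rel] by metis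
  qed
  then show ?thesis by (simp add: tens3_def)
qed

section \<open>Hopf algebras through their dual spaces\<close>

lemma algebraD:
  assumes "algebra A"
  shows "vector_space (scl A)" "mul A (mul A a b) c = mul A a (mul A b c)"
    "mul A (unt A) a = a" "mul A a (unt A) = a"
    "Vector_Spaces.linear (scl A) (scl A) (\<lambda>b. mul A a b)"
    "Vector_Spaces.linear (scl A) (scl A) (\<lambda>a. mul A a b)"
    "bilinear_map (scl A) (scl A) (scl A) (mul A)"
  using assms by (auto simp: algebra_def bilinear_map_def)

lemma convolution_tsum: "convolution H f g h = tsum (sw H h) (\<lambda>a b. f a * g b)"
  by (simp add: convolution_def tsum_def)

lemma convolution_plus:
  "convolution H (\<lambda>a. f a + f' a) g h = convolution H f g h + convolution H f' g h"
  "convolution H f (\<lambda>a. g a + g' a) h = convolution H f g h + convolution H f g' h"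
  by (simp_all add: convolution_tsum distrib_left distrib_right tsum_add)

lemma algebra_hom_field_alg_iff:
  "algebra_hom A field_alg f \<longleftrightarrow>
     functional (scl A) f \<and> (\<forall>x y. f (mul A x y) = f x * f y) \<and> f (unt A) = 1"
  by (simp add: algebra_hom_def field_alg_def)

text \<open>
  Products of functionals from a point separating family detect equality of tensors, so each axiom
  of a coalgebra may be read as an identity for the convolution of such functionals.
\<close>

lemma hopf_algebraI:
  fixes H :: "('k::field, 'h::ab_group_add) hopf"
  assumes alg: "algebra H" and F: "point_separating (scl H) F"
    and space: "\<And>h. comul H h \<in> tensor_space (scl H) (scl H)"
    and lin: "\<And>f g. f \<in> F \<Longrightarrow> g \<in> F \<Longrightarrow> functional (scl H) (convolution H f g)"
    and coassoc: "\<And>f g k h. f \<in> F \<Longrightarrow> g \<in> F \<Longrightarrow> k \<in> F \<Longrightarrow>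
      convolution H (convolution H f g) k h = convolution H f (convolution H g k) h"
    and counit_left: "\<And>f h. f \<in> F \<Longrightarrow> convolution H (counit H) f h = f h"
    and counit_right: "\<And>f h. f \<in> F \<Longrightarrow> convolution H f (counit H) h = f h"
    and mult: "\<And>f g x y. f \<in> F \<Longrightarrow> g \<in> F \<Longrightarrow> convolution H f g (mul H x y) =
      tsum (sw H x) (\<lambda>a b. tsum (sw H y) (\<lambda>a' b'. f (mul H a a') * g (mul H b b')))"
    and unit: "\<And>f g. f \<in> F \<Longrightarrow> g \<in> F \<Longrightarrow> convolution H f g (unt H) = f (unt H) * g (unt H)"
    and counit_hom: "algebra_hom H field_alg (counit H)"
    and antipode_linear: "Vector_Spaces.linear (scl H) (scl H) (antipode H)"
    and antipode_left: "\<And>f h. f \<in> F \<Longrightarrow>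
      tsum (sw H h) (\<lambda>a b. f (mul H (antipode H a) b)) = counit H h * f (unt H)"
    and antipode_right: "\<And>f h. f \<in> F \<Longrightarrow>
      tsum (sw H h) (\<lambda>a b. f (mul H a (antipode H b))) = counit H h * f (unt H)"
  shows "hopf_algebra H"
proof -
  have lf: "functional (scl H) f" if "f \<in> F" for f using F that by (simp add: point_separating_def)
  have tl: "tensor_linear (scl H) (scl H) (scl H) (comul H)"
    using lin by (intro tensor_linearI[OF F F space]) (simp add: convolution_tsum[abs_def] sw_def)
  have co: "tens (scl H) (scl H) (sw H h) = comul H h" for h
    by (simp add: sw_def tens_sweedler algebraD(1)[OF alg] space)
  have vec: "tsum (sw H h) B = v"
    if "\<And>f. f \<in> F \<Longrightarrow> tsum (sw H h) (\<lambda>a b. f (B a b)) = f v" for h B v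
  proof (rule point_separating_eqI[OF F])
    fix f assume f: "f \<in> F"
    show "f (tsum (sw H h) B) = f v" using that[OF f] by (simp add: tsum_linear[OF lf[OF f]])
  qed
  show ?thesis
    unfolding hopf_algebra_def tsum_def[symmetric]
  proof (intro conjI allI alg tl counit_hom antipode_linear)
    fix h
    show "tens3 (scl H) (scl H) (scl H) [(x, y, b). (a, b) \<leftarrow> sw H h, (x, y) \<leftarrow> sw H a] =
          tens3 (scl H) (scl H) (scl H) [(a, x, y). (a, b) \<leftarrow> sw H h, (x, y) \<leftarrow> sw H b]"
    proof (rule tens3_eqI[OF F F F])
      fix f g k assume fgk: "f \<in> F" "g \<in> F" "k \<in> F"
      show "tsum3 [(x, y, b). (a, b) \<leftarrow> sw H h, (x, y) \<leftarrow> sw H a] (\<lambda>u v w. f u * g v * k w) =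
          tsum3 [(a, x, y). (a, b) \<leftarrow> sw H h, (x, y) \<leftarrow> sw H b] (\<lambda>u v w. f u * g v * k w)"
        using coassoc[OF fgk, of h]
        by (simp add: tsum3_concat tsum3_map tsum3_map_Pair convolution_tsum tsum_mult[symmetric] mult.assoc)
    qed
  next
    fix h
    show "tsum (sw H h) (\<lambda>a b. scl H (counit H a) b) = h"
      using counit_left by (intro vec) (simp add: linearD(2)[OF lf] convolution_tsum)
    show "tsum (sw H h) (\<lambda>a b. scl H (counit H b) a) = h"
      using counit_right by (intro vec) (simp add: linearD(2)[OF lf] convolution_tsum mult.commute)
    show "tsum (sw H h) (\<lambda>a b. mul H (antipode H a) b) = scl H (counit H h) (unt H)"
      using antipode_left by (intro vec) (simp add: linearD(2)[OF lf])
    show "tsum (sw H h) (\<lambda>a b. mul H a (antipode H b)) = scl H (counit H h) (unt H)"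
      using antipode_right by (intro vec) (simp add: linearD(2)[OF lf])
  next
    fix g h
    have "tens (scl H) (scl H) (sw H (mul H g h)) =
        tens (scl H) (scl H) [(mul H a a', mul H b b'). (a, b) \<leftarrow> sw H g, (a', b') \<leftarrow> sw H h]"
      by (rule tens_eqI[OF F F]) (use mult in \<open>simp add: tsum_concat tsum_map convolution_tsum\<close>)
    then show "comul H (mul H g h) =
        tens (scl H) (scl H) [(mul H a a', mul H b b'). (a, b) \<leftarrow> sw H g, (a', b') \<leftarrow> sw H h]"
      by (simp add: co)
  next
    have "tens (scl H) (scl H) (sw H (unt H)) = tens (scl H) (scl H) [(unt H, unt H)]"
      by (rule tens_eqI[OF F F]) (use unit in \<open>simp add: convolution_tsum\<close>)
    then show "comul H (unt H) = tens (scl H) (scl H) [(unt H, unt H)]" by (simp add: co)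
  qed
qed

locale hopf =
  fixes H :: "('k::field, 'h::ab_group_add) hopf"
  assumes hopf: "hopf_algebra H"
begin

lemma alg: "algebra H" using hopf by (simp add: hopf_algebra_def)

lemmas vs = algebraD(1)[OF alg]

abbreviation Sw :: "'h \<Rightarrow> ('h \<Rightarrow> 'h \<Rightarrow> 'x::comm_monoid_add) \<Rightarrow> 'x" where
  "Sw h \<equiv> tsum (sw H h)"

lemma comul_linear: "tensor_linear (scl H) (scl H) (scl H) (comul H)"
  using hopf by (simp add: hopf_algebra_def)

lemma comul_eq_tens: "comul H h = tens (scl H) (scl H) (sw H h)"
  using comul_linear by (simp add: sw_def tens_sweedler vs tensor_linear_def)

lemma Sw_linear:
  assumes "bilinear_map (scl H) (scl H) r B"
  shows "Vector_Spaces.linear (scl H) r (\<lambda>h. Sw h B)"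
  using tensor_linear_tsum[OF comul_linear vs assms] by (simp add: sw_def)

lemma Sw_coassoc:
  assumes "trilinear_map (scl H) (scl H) (scl H) r T"
  shows "Sw h (\<lambda>a b. Sw a (\<lambda>x y. T x y b)) = Sw h (\<lambda>a b. Sw b (\<lambda>x y. T a x y))"
proof -
  have "tens3 (scl H) (scl H) (scl H) [(x, y, b). (a, b) \<leftarrow> sw H h, (x, y) \<leftarrow> sw H a] =
        tens3 (scl H) (scl H) (scl H) [(a, x, y). (a, b) \<leftarrow> sw H h, (x, y) \<leftarrow> sw H b]"
    using hopf by (simp add: hopf_algebra_def)
  from tens3_eqD[OF this assms] show ?thesis by (simp add: tsum3_concat tsum3_map tsum3_map_Pair)
qed

lemma counit_functional: "functional (scl H) (counit H)"
  and counit_mul: "counit H (mul H x y) = counit H x * counit H y"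
  and counit_unt: "counit H (unt H) = 1"
  using hopf by (simp_all add: hopf_algebra_def algebra_hom_field_alg_iff)

lemma Sw_counit:
  assumes "Vector_Spaces.linear (scl H) r f"
  shows "Sw h (\<lambda>a b. r (counit H a) (f b)) = f h" "Sw h (\<lambda>a b. r (counit H b) (f a)) = f h"
proof -
  have "Sw h (\<lambda>a b. scl H (counit H a) b) = h" "Sw h (\<lambda>a b. scl H (counit H b) a) = h"
    using hopf by (simp_all add: hopf_algebra_def tsum_def)
  then have "f (Sw h (\<lambda>a b. scl H (counit H a) b)) = f h" "f (Sw h (\<lambda>a b. scl H (counit H b) a)) = f h"
    by simp_all
  then show "Sw h (\<lambda>a b. r (counit H a) (f b)) = f h" "Sw h (\<lambda>a b. r (counit H b) (f a)) = f h"
    by (simp_all add: tsum_linear[OF assms] linearD(2)[OF assms])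
qed

lemma Sw_mul:
  assumes "bilinear_map (scl H) (scl H) r B"
  shows "Sw (mul H g h) B = Sw g (\<lambda>a b. Sw h (\<lambda>a' b'. B (mul H a a') (mul H b b')))"
proof -
  have "comul H (mul H g h) =
        tens (scl H) (scl H) [(mul H a a', mul H b b'). (a, b) \<leftarrow> sw H g, (a', b') \<leftarrow> sw H h]"
    using hopf by (simp add: hopf_algebra_def)
  from tens_eqD[OF this[unfolded comul_eq_tens] assms] show ?thesis by (simp add: tsum_concat tsum_map)
qed

lemma Sw_unt:
  assumes "bilinear_map (scl H) (scl H) r B"
  shows "Sw (unt H) B = B (unt H) (unt H)"
proof -
  have "comul H (unt H) = tens (scl H) (scl H) [(unt H, unt H)]"
    using hopf by (simp add: hopf_algebra_def)
  from tens_eqD[OF this[unfolded comul_eq_tens] assms] show ?thesis by simp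
qed

lemma antipode_linear: "Vector_Spaces.linear (scl H) (scl H) (antipode H)"
  using hopf by (simp add: hopf_algebra_def)

lemma Sw_antipode:
  assumes "Vector_Spaces.linear (scl H) r f"
  shows "Sw h (\<lambda>a b. f (mul H (antipode H a) b)) = r (counit H h) (f (unt H))"
    and "Sw h (\<lambda>a b. f (mul H a (antipode H b))) = r (counit H h) (f (unt H))"
proof -
  have "Sw h (\<lambda>a b. mul H (antipode H a) b) = scl H (counit H h) (unt H)"
    "Sw h (\<lambda>a b. mul H a (antipode H b)) = scl H (counit H h) (unt H)"
    using hopf by (simp_all add: hopf_algebra_def tsum_def)
  then have "f (Sw h (\<lambda>a b. mul H (antipode H a) b)) = f (scl H (counit H h) (unt H))"
    "f (Sw h (\<lambda>a b. mul H a (antipode H b))) = f (scl H (counit H h) (unt H))"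
    by simp_all
  then show "Sw h (\<lambda>a b. f (mul H (antipode H a) b)) = r (counit H h) (f (unt H))"
    "Sw h (\<lambda>a b. f (mul H a (antipode H b))) = r (counit H h) (f (unt H))"
    by (simp_all add: tsum_linear[OF assms] linearD(2)[OF assms])
qed

lemma antipode_unt: "antipode H (unt H) = unt H"
proof -
  have "bilinear_map (scl H) (scl H) (scl H) (\<lambda>a b. mul H (antipode H a) b)"
    using algebraD(5,6)[OF alg] antipode_linear
    by (simp add: bilinear_map_def Vector_Spaces.linear_iff)
  from Sw_unt[OF this] Sw_antipode(1)[of "scl H" "\<lambda>x. x" "unt H"] show ?thesis
    using vs by (simp add: algebraD[OF alg] counit_unt linear_mapI vector_spaceD)
qed

text \<open>The dual space is an associative algebra under convolution, with the counit as its unit.\<close>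

lemma convolution_functional:
  assumes "functional (scl H) f" "functional (scl H) g"
  shows "functional (scl H) (convolution H f g)"
  using Sw_linear[OF bilinear_product[OF assms]] by (simp add: convolution_tsum[abs_def])

lemma convolution_assoc:
  assumes "functional (scl H) f" "functional (scl H) g" "functional (scl H) k"
  shows "convolution H (convolution H f g) k = convolution H f (convolution H g k)"
  using Sw_coassoc[OF trilinear_product[OF assms]]
  by (auto simp: convolution_tsum tsum_mult[symmetric] mult.assoc)

lemma convolution_counit:
  assumes "functional (scl H) f"
  shows "convolution H (counit H) f = f" "convolution H f (counit H) = f"
  using Sw_counit[OF assms] by (auto simp: convolution_tsum mult.commute)

lemma convolution_antipode:
  assumes "functional (scl H) f" "\<And>x y. f (mul H x y) = f x * f y" "f (unt H) = 1"
  shows "convolution H f (\<lambda>h. f (antipode H h)) = counit H"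
    "convolution H (\<lambda>h. f (antipode H h)) f = counit H"
  using Sw_antipode[OF assms(1)] assms(2,3) by (auto simp: convolution_tsum)

text \<open>
  The composite of a character with the antipode is its convolution inverse, and inverses are
  unique; comparing inverses in one argument at a time shows that this composite is again a
  character.
\<close>

lemma character_antipode_mul:
  assumes f: "functional (scl H) f" and f_mul: "\<And>x y. f (mul H x y) = f x * f y" and f_unt: "f (unt H) = 1"
  shows "f (antipode H (mul H x y)) = f (antipode H x) * f (antipode H y)"
proof -
  define g where "g h = f (antipode H h)" for h
  have g: "functional (scl H) g"
    using linear_compose'[OF antipode_linear f] by (simp add: g_def[abs_def])
  have fg: "convolution H f g = counit H" and gf: "convolution H g f = counit H"
    using convolution_antipode[OF f f_mul f_unt] by (simp_all add: g_def[abs_def])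
  note mul_lin = algebraD(5,6)[OF alg]
  \<comment> \<open>A functional is determined by its convolution with the invertible functional \<open>f\<close>.\<close>
  have cancel: "p h = c * g h" if p: "functional (scl H) p" and eq: "\<And>h. convolution H p f h = c * counit H h" for p c h
  proof -
    have "p h = convolution H (convolution H p f) g h"
      by (simp add: convolution_assoc p f g fg convolution_counit)
    also have "\<dots> = c * convolution H (counit H) g h"
      by (simp add: convolution_tsum eq[unfolded convolution_tsum] tsum_mult[symmetric] mult.assoc)
    finally show ?thesis by (simp add: convolution_counit g)
  qed
  have first: "Sw h (\<lambda>a b. g (mul H x a) * f b) = counit H h * g x" for x h
  proof (rule cancel)
    show "functional (scl H) (\<lambda>x. Sw h (\<lambda>a b. g (mul H x a) * f b))"
      by (intro linear_tsum vs vector_space_mult functional_mult_right linear_compose'[OF mul_lin(2) g])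
    fix x
    have "convolution H (\<lambda>x. Sw h (\<lambda>a b. g (mul H x a) * f b)) f x =
        Sw x (\<lambda>a b. Sw h (\<lambda>a' b'. g (mul H a a') * f (mul H b b')))"
      by (simp add: convolution_tsum f_mul tsum_mult[symmetric] algebra_simps)
    also have "\<dots> = convolution H g f (mul H x h)"
      by (simp add: Sw_mul[OF bilinear_product[OF g f]] convolution_tsum)
    finally show "convolution H (\<lambda>x. Sw h (\<lambda>a b. g (mul H x a) * f b)) f x = counit H h * counit H x"
      by (simp add: gf counit_mul)
  qed
  have "g (mul H x y) = g x * g y"
  proof (rule cancel[of "\<lambda>y. g (mul H x y)"])
    show "functional (scl H) (\<lambda>y. g (mul H x y))" by (rule linear_compose'[OF mul_lin(1) g])
    show "convolution H (\<lambda>y. g (mul H x y)) f h = g x * counit H h" for h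
      using first[of h x] by (simp add: convolution_tsum mult.commute)
  qed
  then show ?thesis by (simp add: g_def)
qed

end

section \<open>Modules over the algebra \<open>k\<langle>c, d, h\<rangle>/I\<close>\<close>

text \<open>
  Four linear operators are extended to words letter by letter.  If they satisfy the defining
  relations, then the elements of the free algebra that act as zero form a two-sided ideal
  containing the relations, so the quotient algebra acts from the right.  Every map out of the
  quotient in this development is obtained by letting it act on a suitable vector.
\<close>

locale cdh_module =
  fixes s :: "'k::field \<Rightarrow> 'm \<Rightarrow> 'm::ab_group_add" and M :: "'m set" and op :: "cdh_gen \<Rightarrow> 'm \<Rightarrow> 'm"
  assumes vs: "vector_space s" and sub: "module.subspace s M"
    and op_closed: "m \<in> M \<Longrightarrow> op g m \<in> M"
    and op_add: "m \<in> M \<Longrightarrow> n \<in> M \<Longrightarrow> op g (m + n) = op g m + op g n"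
    and op_scale: "m \<in> M \<Longrightarrow> op g (s c m) = s c (op g m)"
    and rel_cd: "m \<in> M \<Longrightarrow> op Gen_d (op Gen_c m) = m"
    and rel_dc: "m \<in> M \<Longrightarrow> op Gen_c (op Gen_d m) = m"
    and rel_hh: "m \<in> M \<Longrightarrow> op Gen_h (op Gen_h m) = op Gen_h m"
    and rel_hc: "m \<in> M \<Longrightarrow>
      op Gen_c (op Gen_h m) + op Gen_h (op Gen_c m) + op Gen_c (op Gen_c m) = op Gen_c m"
begin

sublocale vector_space s by (rule vs)

definition free_act :: "'m \<Rightarrow> (cdh_gen fword \<Rightarrow>\<^sub>0 'k) \<Rightarrow> 'm" where
  "free_act m p = lin_ext s (\<lambda>w. fold op (letters w) m) p"

definition act :: "'m \<Rightarrow> 'k cdh \<Rightarrow> 'm" where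
  "act m x = free_act m (rep_cdh x)"

lemma fold_closed: "m \<in> M \<Longrightarrow> fold op ws m \<in> M"
  by (induction ws arbitrary: m) (auto intro: op_closed)

lemma fold_add: "m \<in> M \<Longrightarrow> n \<in> M \<Longrightarrow> fold op ws (m + n) = fold op ws m + fold op ws n"
  by (induction ws arbitrary: m n) (auto simp: op_add op_closed)

lemma fold_scale: "m \<in> M \<Longrightarrow> fold op ws (s c m) = s c (fold op ws m)"
  by (induction ws arbitrary: m) (auto simp: op_scale op_closed)

lemmas free_act_linear = lin_ext_linearD[OF vs, where f = "\<lambda>w. fold op (letters w) m" for m, folded free_act_def]

lemma free_act_single: "free_act m (Poly_Mapping.single w c) = s c (fold op (letters w) m)"
  by (simp add: free_act_def vs)

lemma free_act_closed: "m \<in> M \<Longrightarrow> free_act m p \<in> M"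
  by (induction p rule: pm_induct)
    (auto simp: free_act_single free_act_linear intro!: subspace_scale[OF sub] subspace_add[OF sub] fold_closed)

lemma free_act_add: "m \<in> M \<Longrightarrow> n \<in> M \<Longrightarrow> free_act (m + n) p = free_act m p + free_act n p"
  by (induction p rule: pm_induct)
    (auto simp: free_act_single free_act_linear fold_add scale_right_distrib)

lemma free_act_scale: "m \<in> M \<Longrightarrow> free_act (s c m) p = s c (free_act m p)"
  by (induction p rule: pm_induct)
    (auto simp: free_act_single free_act_linear fold_scale scale_right_distrib mult.commute)

lemma free_act_one: "free_act m 1 = m"
  by (subst single_one[symmetric]) (simp add: free_act_single zero_fword_def)

lemma free_act_times:
  assumes "m \<in> M"
  shows "free_act m (p * q) = free_act (free_act m p) q"
proof (induction p rule: pm_induct)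
  case (single u a)
  show ?case
  proof (induction q rule: pm_induct)
    case (single v b)
    then show ?case
      using assms by (simp add: mult_single free_act_single plus_fword_def fold_scale fold_closed mult.commute)
  next
    case (add p q)
    then show ?case by (simp add: distrib_left free_act_linear)
  qed
next
  case (add p q)
  then show ?case using assms by (simp add: distrib_right free_act_linear free_act_add free_act_closed)
qed

lemma free_act_gen: "free_act m (free_gen g) = op g m"
  by (simp add: free_gen_def free_act_single)

lemma free_act_ideal:
  assumes p: "p \<in> cdh_ideal" and "m \<in> M"
  shows "free_act m p = 0"
proof -
  interpret pm: vector_space "pm_scale :: 'k \<Rightarrow> (cdh_gen fword \<Rightarrow>\<^sub>0 'k) \<Rightarrow> _"
    by (rule vector_space_pm_scale)
  let ?J = "{p. \<forall>m\<in>M. free_act m p = 0}"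
  have "free_act 0 q = 0" for q
    using free_act_scale[of 0 0 q] subspace_0[OF sub] by simp
  then have "two_sided_ideal free_alg ?J"
    unfolding two_sided_ideal_def free_alg_def
    by (auto intro!: pm.subspaceI simp: free_act_linear free_act_times free_act_closed)
  moreover have "{free_gen Gen_c * free_gen Gen_d - 1, free_gen Gen_d * free_gen Gen_c - 1,
      free_gen Gen_h ^ 2 - free_gen Gen_h, free_gen Gen_h * free_gen Gen_c +
      free_gen Gen_c * free_gen Gen_h + free_gen Gen_c ^ 2 - free_gen Gen_c} \<subseteq> ?J"
    by (auto simp: free_act_linear free_act_times free_act_one free_act_gen power2_eq_square
        rel_cd rel_dc rel_hh rel_hc)
  ultimately have "?J \<in> {J. two_sided_ideal free_alg J \<and> {free_gen Gen_c * free_gen Gen_d - 1, free_gen Gen_d * free_gen Gen_c - 1,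
      free_gen Gen_h ^ 2 - free_gen Gen_h, free_gen Gen_h * free_gen Gen_c +
      free_gen Gen_c * free_gen Gen_h + free_gen Gen_c ^ 2 - free_gen Gen_c} \<subseteq> J}" by blast
  then have "p \<in> ?J" using p unfolding cdh_ideal_def Let_def by (rule InterD[rotated])
  then show ?thesis using \<open>m \<in> M\<close> by simp
qed

lemma act_abs: "m \<in> M \<Longrightarrow> act m (abs_cdh p) = free_act m p"
proof -
  assume m: "m \<in> M"
  have "cdh_rel (rep_cdh (abs_cdh p)) p"
    by (rule Quotient3_rep_abs[OF Quotient3_cdh]) (rule equivp_reflp[OF equivp_cdh_rel])
  then have "free_act m (rep_cdh (abs_cdh p) - p) = 0"
    using m by (simp add: cdh_rel_def free_act_ideal)
  then show ?thesis by (simp add: act_def free_act_linear)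
qed

lemma act_closed: "m \<in> M \<Longrightarrow> act m x \<in> M"
  by (simp add: act_def free_act_closed)

lemma act_times: "m \<in> M \<Longrightarrow> act m (x * y) = act (act m x) y"
  by (induction x, induction y) (simp add: times_cdh.abs_eq act_abs free_act_times free_act_closed)

lemma act_plus: "m \<in> M \<Longrightarrow> act m (x + y) = act m x + act m y"
  by (induction x, induction y) (simp add: plus_cdh.abs_eq act_abs free_act_linear)

lemma act_cdh_scale: "m \<in> M \<Longrightarrow> act m (cdh_scale c x) = s c (act m x)"
  by (induction x) (simp add: cdh_scale.abs_eq act_abs free_act_linear)

lemma act_one: "m \<in> M \<Longrightarrow> act m 1 = m"
  by (simp add: one_cdh.abs_eq act_abs free_act_one)

lemma act_gen: "m \<in> M \<Longrightarrow> act m (cdh_gen g) = op g m"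
  by (simp add: cdh_gen.abs_eq act_abs free_act_gen)

lemma act_times_gen: "m \<in> M \<Longrightarrow> act m (x * cdh_gen g) = op g (act m x)"
  by (simp add: act_times act_gen act_closed)

lemma act_linear: "m \<in> M \<Longrightarrow> Vector_Spaces.linear cdh_scale s (act m)"
  by (rule linear_mapI[OF vector_space_cdh_scale vs]) (simp_all add: act_plus act_cdh_scale)

end

text \<open>
  Words, built by appending one letter at a time, span the quotient.  Appending on the right matches
  the recursion equations of the right actions.
\<close>

lemma cdh_induct [case_names one gen plus scale]:
  assumes "P 1" "\<And>x g. P x \<Longrightarrow> P (x * cdh_gen g)" "\<And>x y. P x \<Longrightarrow> P y \<Longrightarrow> P (x + y)"
    "\<And>c x. P x \<Longrightarrow> P (cdh_scale c x)"
  shows "P (x :: 'k::field cdh)"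
proof -
  have word: "P (abs_cdh (Poly_Mapping.single (FWord ws) 1))" for ws
  proof (induction ws rule: rev_induct)
    case Nil
    then show ?case using assms(1) by (simp add: one_cdh.abs_eq single_one[symmetric] zero_fword_def)
  next
    case (snoc g ws)
    have "abs_cdh (Poly_Mapping.single (FWord (ws @ [g])) (1::'k)) =
        abs_cdh (Poly_Mapping.single (FWord ws) 1) * cdh_gen g"
      by (simp add: cdh_gen.abs_eq times_cdh.abs_eq free_gen_def mult_single plus_fword_def)
    then show ?case using assms(2)[OF snoc] by simp
  qed
  have "P (abs_cdh p)" for p
  proof (induction p rule: pm_induct)
    case (single w c)
    have "Poly_Mapping.single w c = pm_scale c (Poly_Mapping.single w (1::'k))"
      by (rule poly_mapping_eqI) (simp add: lookup_pm_scale lookup_single when_def)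
    then show ?case
      using assms(4)[OF word[of "letters w"], of c] by (simp add: cdh_scale.abs_eq)
  next
    case (add p q)
    then show ?case using assms(3) by (simp add: plus_cdh.abs_eq[symmetric])
  qed
  then show ?thesis by (induction x) simp
qed

lemma cdh_relations:
  "c_bar * d_bar = (1 :: 'k::field cdh)" "d_bar * c_bar = (1 :: 'k cdh)" "h_bar * h_bar = (h_bar :: 'k cdh)"
  "h_bar * c_bar + c_bar * h_bar + c_bar * c_bar = (c_bar :: 'k cdh)"
proof -
  have gens: "{free_gen Gen_c * free_gen Gen_d - 1, free_gen Gen_d * free_gen Gen_c - 1,
      free_gen Gen_h ^ 2 - free_gen Gen_h, free_gen Gen_h * free_gen Gen_c +
      free_gen Gen_c * free_gen Gen_h + free_gen Gen_c ^ 2 - free_gen Gen_c} \<subseteq>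
      (cdh_ideal :: (cdh_gen fword \<Rightarrow>\<^sub>0 'k) set)"
    unfolding cdh_ideal_def Let_def by (rule Inter_greatest) blast
  then show "c_bar * d_bar = (1 :: 'k::field cdh)" "d_bar * c_bar = (1 :: 'k cdh)"
      "h_bar * h_bar = (h_bar :: 'k cdh)"
      "h_bar * c_bar + c_bar * h_bar + c_bar * c_bar = (c_bar :: 'k cdh)"
    by (simp_all add: cdh_gen.abs_eq one_cdh.abs_eq times_cdh.abs_eq plus_cdh.abs_eq
        cdh.abs_eq_iff cdh_rel_def power2_eq_square)
qed

lemma cdh_relations_assoc:
  fixes x :: "'k::field cdh"
  shows "c_bar * (d_bar * x) = x" "d_bar * (c_bar * x) = x" "h_bar * (h_bar * x) = h_bar * x"
    "x * c_bar * d_bar = x" "x * d_bar * c_bar = x" "x * h_bar * h_bar = x * h_bar"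
  using cdh_relations[where 'k = 'k] by (simp_all add: mult.assoc[symmetric]) (simp_all add: mult.assoc)

lemma cdh_scale_mult: "cdh_scale a x * y = cdh_scale a (x * y)" "x * cdh_scale a y = cdh_scale a (x * y)"
  by (induction x, induction y, simp add: cdh_scale.abs_eq times_cdh.abs_eq pm_scale_mult)+

lemma cdh_hopf_simps [simp]:
  "scl cdh_hopf = cdh_scale" "mul cdh_hopf = (*)" "unt cdh_hopf = 1"
  by (simp_all add: cdh_hopf_def)

lemma algebra_cdh: "algebra (cdh_hopf :: ('k::field, 'k cdh) hopf)"
  by (auto simp: algebra_def vector_space_cdh_scale cdh_scale_mult algebra_simps
      intro!: linear_mapI)

lemma cdh_linear_times:
  assumes "Vector_Spaces.linear cdh_scale t f"
  shows "Vector_Spaces.linear cdh_scale t (\<lambda>x. f (y * x))" "Vector_Spaces.linear cdh_scale t (\<lambda>x. f (x * y))"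
  using assms by (auto simp: Vector_Spaces.linear_iff cdh_scale_mult distrib_left distrib_right)

section \<open>The structure maps of \<open>k\<langle>c, d, h\<rangle>/I\<close>\<close>

interpretation counit_module: cdh_module "(*)" UNIV "\<lambda>g a. cdh_counit_gen g * (a :: 'k::field)"
  by unfold_locales (simp_all add: distrib_left distrib_right mult.left_commute subspace_UNIV vector_space_mult)

lemma counit_cdh_act: "counit cdh_hopf x = counit_module.act 1 x"
proof -
  have "fold (\<lambda>g a. cdh_counit_gen g * a) ws a = (\<Prod>y\<leftarrow>ws. cdh_counit_gen y) * a" for ws and a :: 'a
    by (induction ws arbitrary: a) auto
  then show ?thesis
    by (simp add: cdh_hopf_def counit_module.act_def counit_module.free_act_def)
qed

lemma counit_cdh:
  "counit cdh_hopf 1 = 1" "counit cdh_hopf (x * cdh_gen g) = cdh_counit_gen g * counit cdh_hopf x"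
  "counit cdh_hopf (x + y) = counit cdh_hopf x + counit cdh_hopf y"
  "counit cdh_hopf (cdh_scale a x) = a * counit cdh_hopf x"
  by (simp_all add: counit_cdh_act counit_module.act_one counit_module.act_times_gen
      counit_module.act_plus counit_module.act_cdh_scale)

lemma counit_cdh_functional: "functional cdh_scale (counit cdh_hopf)"
  by (rule linear_mapI) (simp_all add: counit_cdh vector_space_cdh_scale vector_space_mult)

lemma counit_cdh_times: "counit cdh_hopf (x * y) = counit cdh_hopf x * counit cdh_hopf y"
proof (induction y rule: cdh_induct)
  case (gen y g)
  have "counit cdh_hopf (x * (y * cdh_gen g)) = counit cdh_hopf (x * y * cdh_gen g)"
    by (simp only: mult.assoc)
  then show ?case by (simp add: counit_cdh gen mult.left_commute)
qed (simp_all add: counit_cdh cdh_scale_mult distrib_left)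

text \<open>
  Multiplying \<open>hc + ch + c\<^sup>2 = c\<close> by \<open>d\<close> on both sides gives \<open>dh + hd + 1 = d\<close>, and \<open>h\<close> on the right then
  yields the claim.  It makes \<open>S(h) = -hd\<close> idempotent, as the antipode must preserve \<open>h\<^sup>2 = h\<close>.
\<close>

lemma cdh_hdh: "h_bar * d_bar * h_bar = - (h_bar :: 'k::field cdh)"
proof -
  have "d_bar * (h_bar * c_bar + c_bar * h_bar + c_bar * c_bar) * d_bar = d_bar * c_bar * (d_bar :: 'k cdh)"
    by (simp only: cdh_relations)
  then have hd: "d_bar * h_bar + h_bar * d_bar + 1 = (d_bar :: 'k cdh)"
    by (simp add: distrib_left distrib_right mult.assoc cdh_relations(1,2) cdh_relations_assoc add.commute)
  have "(d_bar * h_bar + h_bar * d_bar + 1) * h_bar = d_bar * (h_bar :: 'k cdh)"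
    by (simp only: hd)
  then have "h_bar * d_bar * h_bar + h_bar = (0 :: 'k cdh)"
    by (simp add: distrib_right mult.assoc cdh_relations)
  then show ?thesis by (simp add: eq_neg_iff_add_eq_0)
qed

text \<open>Left multiplication by \<open>S(g)\<close> gives a right action, since an anti-homomorphism reverses words.\<close>

interpretation antipode_module: cdh_module cdh_scale UNIV "\<lambda>g m. cdh_antipode_gen g * (m :: 'k::field cdh)"
proof unfold_locales
  fix m :: "'k cdh"
  show "cdh_antipode_gen Gen_h * (cdh_antipode_gen Gen_h * m) = cdh_antipode_gen Gen_h * m"
    using cdh_hdh[where 'k = 'k] by (simp add: mult.assoc[symmetric])
  have "d_bar * (h_bar * c_bar + c_bar * h_bar + c_bar * c_bar) * (d_bar * d_bar) =
      d_bar * c_bar * (d_bar * (d_bar :: 'k cdh))"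
    by (simp only: cdh_relations)
  then have "h_bar * d_bar * d_bar + d_bar * h_bar * d_bar + d_bar = (d_bar * d_bar :: 'k cdh)"
    by (simp add: distrib_left distrib_right mult.assoc cdh_relations(1,2) cdh_relations_assoc add.commute)
  then have "- (d_bar * (h_bar * d_bar)) - (h_bar * d_bar) * d_bar + d_bar * d_bar = (d_bar :: 'k cdh)"
    by (simp add: algebra_simps)
  then have "(- (d_bar * (h_bar * d_bar)) - (h_bar * d_bar) * d_bar + d_bar * d_bar) * m = d_bar * m"
    by simp
  then show "cdh_antipode_gen Gen_c * (cdh_antipode_gen Gen_h * m) +
      cdh_antipode_gen Gen_h * (cdh_antipode_gen Gen_c * m) +
      cdh_antipode_gen Gen_c * (cdh_antipode_gen Gen_c * m) = cdh_antipode_gen Gen_c * m"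
    by (simp add: algebra_simps)
qed (simp_all add: vector_space_cdh_scale subspace_UNIV distrib_left cdh_scale_mult cdh_relations_assoc
    vector_spaceD[OF vector_space_cdh_scale])

lemma antipode_cdh_act: "antipode cdh_hopf x = antipode_module.act 1 x"
proof -
  have "fold (\<lambda>g m. cdh_antipode_gen g * m) ws m = (\<Prod>y\<leftarrow>rev ws. cdh_antipode_gen y) * m"
    for ws and m :: "'a cdh"
    by (induction ws arbitrary: m) (auto simp: mult.assoc)
  then show ?thesis
    by (simp add: cdh_hopf_def antipode_module.act_def antipode_module.free_act_def)
qed

lemma antipode_cdh:
  "antipode cdh_hopf 1 = 1"
  "antipode cdh_hopf (x * cdh_gen g) = cdh_antipode_gen g * antipode cdh_hopf x"
  "antipode cdh_hopf (x + y) = antipode cdh_hopf x + antipode cdh_hopf y"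
  "antipode cdh_hopf (cdh_scale a x) = cdh_scale a (antipode cdh_hopf x)"
  by (simp_all add: antipode_cdh_act antipode_module.act_one antipode_module.act_times_gen
      antipode_module.act_plus antipode_module.act_cdh_scale)

lemma antipode_cdh_linear: "Vector_Spaces.linear cdh_scale cdh_scale (antipode cdh_hopf)"
  by (rule linear_mapI) (simp_all add: antipode_cdh vector_space_cdh_scale)

lemma antipode_cdh_times: "antipode cdh_hopf (x * y) = antipode cdh_hopf y * antipode cdh_hopf x"
proof (induction y rule: cdh_induct)
  case (gen y g)
  have "antipode cdh_hopf (x * (y * cdh_gen g)) = antipode cdh_hopf (x * y * cdh_gen g)"
    by (simp only: mult.assoc)
  also have "\<dots> = cdh_antipode_gen g * (antipode cdh_hopf y * antipode cdh_hopf x)"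
    by (simp only: antipode_cdh(2) gen)
  also have "\<dots> = antipode cdh_hopf (y * cdh_gen g) * antipode cdh_hopf x"
    by (simp only: antipode_cdh(2) mult.assoc)
  finally show ?case .
qed (simp_all add: antipode_cdh cdh_scale_mult distrib_left distrib_right)

lemma bilinear_plus:
  "bilinear_map s t r B \<Longrightarrow> bilinear_map s t r C \<Longrightarrow> bilinear_map s t r (\<lambda>v w. B v w + C v w)"
  by (simp add: bilinear_map_def linear_plus)

lemma cdh_bilinear_translate:
  assumes "bilinear_map cdh_scale cdh_scale r B"
  shows "bilinear_map cdh_scale cdh_scale r (\<lambda>x y. B (a * x) (b * y))"
    "bilinear_map cdh_scale cdh_scale r (\<lambda>x y. B (x * a) (y * b))"
    "bilinear_map cdh_scale cdh_scale r (\<lambda>x y. B x (b * y))"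
    "bilinear_map cdh_scale cdh_scale r (\<lambda>x y. B x (y * b))"
proof -
  note lin = bilinear_mapD(1,2)[OF assms]
  show "bilinear_map cdh_scale cdh_scale r (\<lambda>x y. B (a * x) (b * y))"
    by (simp only: bilinear_map_def) (intro conjI allI cdh_linear_times(1)[OF lin(1)] cdh_linear_times(1)[OF lin(2)])
  show "bilinear_map cdh_scale cdh_scale r (\<lambda>x y. B (x * a) (y * b))"
    by (simp only: bilinear_map_def) (intro conjI allI cdh_linear_times(2)[OF lin(1)] cdh_linear_times(2)[OF lin(2)])
  show "bilinear_map cdh_scale cdh_scale r (\<lambda>x y. B x (b * y))"
    by (simp only: bilinear_map_def) (intro conjI allI cdh_linear_times(1)[OF lin(1)] lin(2))
  show "bilinear_map cdh_scale cdh_scale r (\<lambda>x y. B x (y * b))"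
    by (simp only: bilinear_map_def) (intro conjI allI cdh_linear_times(2)[OF lin(1)] lin(2))
qed

text \<open>
  The algebra acts from the right on bilinear forms by precomposition with the comultiplication of
  the generators.  Evaluating the form moved by \<open>x\<close> at \<open>(1, 1)\<close> is evaluation at the tensor
  \<open>\<Delta>(x)\<close>; in this way \<open>\<Delta>\<close> is seen to be well defined and multiplicative.
\<close>

definition form_scale :: "'k::field \<Rightarrow> ('a \<Rightarrow> 'b \<Rightarrow> 'k) \<Rightarrow> 'a \<Rightarrow> 'b \<Rightarrow> 'k" where
  "form_scale c B = (\<lambda>a b. c * B a b)"

lemma vector_space_form_scale:
  "vector_space (form_scale :: 'k::field \<Rightarrow> ('a \<Rightarrow> 'b \<Rightarrow> 'k) \<Rightarrow> _)"
  by (rule vector_space.intro) (simp_all add: fun_eq_iff form_scale_def, simp_all add: algebra_simps)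

definition form_op :: "cdh_gen \<Rightarrow> ('k::field cdh \<Rightarrow> 'k cdh \<Rightarrow> 'k) \<Rightarrow> 'k cdh \<Rightarrow> 'k cdh \<Rightarrow> 'k" where
  "form_op g B = (\<lambda>a b. tsum (cdh_comul_gen g) (\<lambda>a' b'. B (a' * a) (b' * b)))"

interpretation form_module: cdh_module "form_scale :: 'k::field \<Rightarrow> _"
  "{B. bilinear_map cdh_scale cdh_scale (*) B}" form_op
proof (rule cdh_module.intro)
  note bil = bilinear_map_def Vector_Spaces.linear_iff
  interpret vector_space "form_scale :: 'k \<Rightarrow> ('k cdh \<Rightarrow> 'k cdh \<Rightarrow> 'k) \<Rightarrow> _"
    by (rule vector_space_form_scale)
  show "subspace {B :: 'k cdh \<Rightarrow> 'k cdh \<Rightarrow> 'k. bilinear_map cdh_scale cdh_scale (*) B}"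
  proof (rule subspaceI)
    show "0 \<in> {B :: 'k cdh \<Rightarrow> 'k cdh \<Rightarrow> 'k. bilinear_map cdh_scale cdh_scale (*) B}"
      by (simp add: bil vector_space_cdh_scale vector_space_mult)
  qed (auto simp: bilinear_map_def form_scale_def plus_fun_def intro: linear_plus functional_mult_left)
  fix B C :: "'k cdh \<Rightarrow> 'k cdh \<Rightarrow> 'k" and g r
  assume B: "B \<in> {B. bilinear_map cdh_scale cdh_scale (*) B}"
  then have B': "bilinear_map cdh_scale cdh_scale (*) B" by simp
  note bd = bilinear_mapD(6-9)[OF B']
  show "form_op g B \<in> {B. bilinear_map cdh_scale cdh_scale (*) B}"
    using B' by (cases g) (simp_all add: form_op_def bilinear_plus cdh_bilinear_translate)
  show "form_op g (form_scale r B) = form_scale r (form_op g B)"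
    by (cases g) (simp_all add: form_op_def form_scale_def distrib_left)
  show "form_op Gen_d (form_op Gen_c B) = B" "form_op Gen_c (form_op Gen_d B) = B"
    by (simp_all add: form_op_def cdh_relations_assoc)
  have rel: "B a (h_bar * (c_bar * b)) + (B a (c_bar * (h_bar * b)) + B a (c_bar * (c_bar * b))) = B a (c_bar * b)" for a b
  proof -
    have "B a ((h_bar * c_bar + c_bar * h_bar + c_bar * c_bar) * b) = B a (c_bar * b)"
      by (simp only: cdh_relations)
    then show ?thesis by (simp add: distrib_right bd mult.assoc add.assoc)
  qed
  have rel': "B (h_bar * (c_bar * a)) b + (B (c_bar * (h_bar * a)) b + B (c_bar * (c_bar * a)) b) = B (c_bar * a) b" for a b
  proof -
    have "B ((h_bar * c_bar + c_bar * h_bar + c_bar * c_bar) * a) b = B (c_bar * a) b"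
      by (simp only: cdh_relations)
    then show ?thesis by (simp add: distrib_right bd mult.assoc add.assoc)
  qed
  show "form_op Gen_h (form_op Gen_h B) = form_op Gen_h B"
  proof (intro ext)
    fix a b
    show "form_op Gen_h (form_op Gen_h B) a b = form_op Gen_h B a b"
      using rel[of "h_bar * a" b] by (simp add: form_op_def cdh_relations_assoc algebra_simps)
  qed
  show "form_op Gen_c (form_op Gen_h B) + form_op Gen_h (form_op Gen_c B) +
      form_op Gen_c (form_op Gen_c B) = form_op Gen_c B"
  proof (intro ext)
    fix a b
    show "(form_op Gen_c (form_op Gen_h B) + form_op Gen_h (form_op Gen_c B) +
      form_op Gen_c (form_op Gen_c B)) a b = form_op Gen_c B a b"
      using rel[of "c_bar * a" b] rel'[of a "c_bar * (c_bar * b)"]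
      by (simp add: form_op_def algebra_simps)
  qed
  show "form_op g (B + C) = form_op g B + form_op g C"
    by (simp add: form_op_def tsum_add plus_fun_def)
qed (rule vector_space_form_scale)

lemma comul_cdh_space: "comul cdh_hopf x \<in> tensor_space cdh_scale cdh_scale"
  by (simp add: cdh_hopf_def tensor_space_def)

lemma sw_cdh_act:
  fixes B :: "'k::field cdh \<Rightarrow> 'k cdh \<Rightarrow> 'k"
  assumes B: "bilinear_map cdh_scale cdh_scale (*) B"
  shows "tsum (sw cdh_hopf x) (\<lambda>a b. B (a * a0) (b * b0)) = form_module.act B x a0 b0"
proof -
  let ?B = "\<lambda>a b. B (a * a0) (b * b0)"
  have B': "bilinear_map cdh_scale cdh_scale (*) ?B"
    by (rule cdh_bilinear_translate(2)[OF B])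
  have eval: "Vector_Spaces.linear form_scale (*) (\<lambda>B. B a0 b0)"
    by (rule linear_mapI) (simp_all add: vector_space_form_scale vector_space_mult form_scale_def)
  have letters: "tsum (cdh_comul_letters ws) (\<lambda>a b. B (a * a0) (b * b0)) = fold form_op ws B a0 b0"
    for ws B
  proof (induction ws arbitrary: B)
    case (Cons g ws)
    have "tsum (cdh_comul_letters (g # ws)) (\<lambda>a b. B (a * a0) (b * b0)) =
        tsum (cdh_comul_letters ws) (\<lambda>a b. form_op g B (a * a0) (b * b0))"
      by (simp add: tsum_concat tsum_map form_op_def mult.assoc tsum_swap[of "cdh_comul_gen g"])
    then show ?case by (simp add: Cons)
  qed simp
  have "tsum (sw cdh_hopf x) ?B = lin_ext (*) (\<lambda>(v, w). ?B v w)
      (lin_ext pm_scale (\<lambda>w. formal_sum (cdh_comul_letters (letters w))) (rep_cdh x))"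
    unfolding sw_def by (simp add: cdh_hopf_def tsum_sweedler_class[OF B'])
  also have "\<dots> = lin_ext (*) (\<lambda>w. tsum (cdh_comul_letters (letters w)) ?B) (rep_cdh x)"
    by (subst lin_ext_compose[OF linear_lin_ext[OF vector_space_mult]])
      (simp add: lin_ext_formal_sum[OF vector_space_mult] tsum_def)
  also have "\<dots> = form_module.act B x a0 b0"
    by (simp add: letters form_module.act_def form_module.free_act_def lin_ext_compose[OF eval])
  finally show ?thesis .
qed

lemma sw_cdh:
  fixes B :: "'k::field cdh \<Rightarrow> 'k cdh \<Rightarrow> 'k"
  assumes B: "bilinear_map cdh_scale cdh_scale (*) B"
  shows "tsum (sw cdh_hopf 1) B = B 1 1"
    and "tsum (sw cdh_hopf (x * y)) B =
      tsum (sw cdh_hopf x) (\<lambda>a b. tsum (sw cdh_hopf y) (\<lambda>a' b'. B (a * a') (b * b')))"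
    and "tsum (sw cdh_hopf (cdh_gen g)) B = tsum (cdh_comul_gen g) B"
    and "tsum (sw cdh_hopf (x * cdh_gen g)) B =
      tsum (sw cdh_hopf x) (\<lambda>a b. tsum (cdh_comul_gen g) (\<lambda>a' b'. B (a * a') (b * b')))"
    and "functional cdh_scale (\<lambda>x. tsum (sw cdh_hopf x) B)"
proof -
  have act: "tsum (sw cdh_hopf x) B = form_module.act B x 1 1"
    if "bilinear_map cdh_scale cdh_scale (*) B" for B :: "'k cdh \<Rightarrow> 'k cdh \<Rightarrow> 'k" and x
    by (rule sw_cdh_act[OF that, where ?a0.0 = 1 and ?b0.0 = 1, unfolded mult_1_right])
  have translate: "bilinear_map cdh_scale cdh_scale (*) (\<lambda>a' b'. B (a * a') (b * b'))" for a b
    by (rule cdh_bilinear_translate(1)[OF B])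
  have "form_module.act B x \<in> {B. bilinear_map cdh_scale cdh_scale (*) B}" for x
    using B by (intro form_module.act_closed) simp
  then have closed: "bilinear_map cdh_scale cdh_scale (*) (form_module.act B x)" for x by simp
  show "tsum (sw cdh_hopf 1) B = B 1 1"
    using B by (simp add: act form_module.act_one)
  have gen: "tsum (sw cdh_hopf (cdh_gen g)) B = tsum (cdh_comul_gen g) B"
    if "bilinear_map cdh_scale cdh_scale (*) B" for B :: "'k cdh \<Rightarrow> 'k cdh \<Rightarrow> 'k" and g
    using that by (simp add: act form_module.act_gen form_op_def)
  have mult: "tsum (sw cdh_hopf (x * y)) B =
      tsum (sw cdh_hopf x) (\<lambda>a b. tsum (sw cdh_hopf y) (\<lambda>a' b'. B (a * a') (b * b')))" for x y
  proof -
    have "tsum (sw cdh_hopf (x * y)) B = form_module.act (form_module.act B x) y 1 1"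
      using B by (simp add: act form_module.act_times)
    also have "\<dots> = tsum (sw cdh_hopf y) (form_module.act B x)"
      by (simp add: act[OF closed])
    also have "\<dots> = tsum (sw cdh_hopf y) (\<lambda>a' b'. tsum (sw cdh_hopf x) (\<lambda>a b. B (a * a') (b * b')))"
      by (simp add: sw_cdh_act[OF B])
    finally show ?thesis by (simp add: tsum_swap[of "sw cdh_hopf y"])
  qed
  show "tsum (sw cdh_hopf (x * y)) B =
      tsum (sw cdh_hopf x) (\<lambda>a b. tsum (sw cdh_hopf y) (\<lambda>a' b'. B (a * a') (b * b')))"
    by (rule mult)
  show "tsum (sw cdh_hopf (cdh_gen g)) B = tsum (cdh_comul_gen g) B" by (rule gen[OF B])
  show "tsum (sw cdh_hopf (x * cdh_gen g)) B =
      tsum (sw cdh_hopf x) (\<lambda>a b. tsum (cdh_comul_gen g) (\<lambda>a' b'. B (a * a') (b * b')))"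
    by (simp add: mult gen[OF translate])
  have "Vector_Spaces.linear cdh_scale form_scale (form_module.act B)"
    using B by (intro form_module.act_linear) simp
  then show "functional cdh_scale (\<lambda>x. tsum (sw cdh_hopf x) B)"
    using B by (simp add: act Vector_Spaces.linear_iff vector_space_mult form_scale_def)
qed

text \<open>
  Translating functionals on the right by a generator turns convolution at \<open>x g\<close> into convolution at
  \<open>x\<close>.  The coalgebra axioms below are therefore proved by induction on \<open>x\<close> for all functionals at once.
\<close>

lemma convolution_cdh:
  assumes f: "functional cdh_scale f" and g: "functional cdh_scale g"
  shows "convolution cdh_hopf f g 1 = f 1 * g 1"
    "convolution cdh_hopf f g (x * c_bar) = convolution cdh_hopf (\<lambda>a. f (a * c_bar)) (\<lambda>a. g (a * c_bar)) x"
    "convolution cdh_hopf f g (x * d_bar) = convolution cdh_hopf (\<lambda>a. f (a * d_bar)) (\<lambda>a. g (a * d_bar)) x"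
    "convolution cdh_hopf f g (x * h_bar) =
      convolution cdh_hopf (\<lambda>a. f (a * h_bar)) (\<lambda>a. g (a * c_bar)) x +
      convolution cdh_hopf f (\<lambda>a. g (a * h_bar)) x"
  by (simp_all add: convolution_tsum sw_cdh(1,4)[OF bilinear_product[OF f g]] tsum_add)

lemma convolution_cdh_functional:
  assumes "functional cdh_scale f" "functional cdh_scale g"
  shows "functional cdh_scale (convolution cdh_hopf f g)"
  using sw_cdh(5)[OF bilinear_product[OF assms]] by (simp add: convolution_tsum[abs_def])

lemma convolution_cdh_assoc:
  assumes "functional cdh_scale f" "functional cdh_scale g" "functional cdh_scale k"
  shows "convolution cdh_hopf (convolution cdh_hopf f g) k x =
    convolution cdh_hopf f (convolution cdh_hopf g k) x"
  using assms
proof (induction x arbitrary: f g k rule: cdh_induct)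
  case one
  then show ?case by (simp add: convolution_cdh convolution_cdh_functional)
next
  case (gen x y)
  note t = cdh_linear_times(2)[OF gen(2)] cdh_linear_times(2)[OF gen(3)] cdh_linear_times(2)[OF gen(4)]
  note fg = convolution_cdh_functional[OF gen(2,3)] and gk = convolution_cdh_functional[OF gen(3,4)]
  show ?case
  proof (cases y)
    case Gen_c
    then show ?thesis
      by (simp only: convolution_cdh(2)[OF fg gen(4)] convolution_cdh(2)[OF gen(2) gk]
          convolution_cdh(2)[OF gen(2,3)] convolution_cdh(2)[OF gen(3,4)] gen.IH[OF t])
  next
    case Gen_d
    then show ?thesis
      by (simp only: convolution_cdh(3)[OF fg gen(4)] convolution_cdh(3)[OF gen(2) gk]
          convolution_cdh(3)[OF gen(2,3)] convolution_cdh(3)[OF gen(3,4)] gen.IH[OF t])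
  next
    case Gen_h
    then show ?thesis
      by (simp only: convolution_cdh(2,4)[OF fg gen(4)] convolution_cdh(2,4)[OF gen(2) gk]
          convolution_cdh(2,4)[OF gen(2,3)] convolution_cdh(2,4)[OF gen(3,4)] convolution_plus
          gen.IH[OF t] gen.IH[OF gen(2) t(2,3)] gen.IH[OF gen(2,3) t(3)] add.assoc)
  qed
next
  case (plus x y)
  then show ?case
    by (simp add: linearD(1)[OF convolution_cdh_functional] convolution_cdh_functional)
next
  case (scale c x)
  then show ?case
    by (simp add: linearD(2)[OF convolution_cdh_functional] convolution_cdh_functional)
qed

lemma convolution_cdh_counit:
  assumes "functional cdh_scale f"
  shows "convolution cdh_hopf (counit cdh_hopf) f x = f x \<and> convolution cdh_hopf f (counit cdh_hopf) x = f x"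
  using assms
proof (induction x arbitrary: f rule: cdh_induct)
  case one
  then show ?case by (simp add: convolution_cdh counit_cdh_functional counit_cdh)
next
  case (gen x y)
  note t = cdh_linear_times(2)[OF gen(2)]
  have zero: "convolution cdh_hopf (\<lambda>a. 0) g x = 0" "convolution cdh_hopf g (\<lambda>a. 0) x = 0" for g
    by (simp_all add: convolution_tsum)
  show ?case
    by (cases y) (simp_all add: convolution_cdh[OF counit_cdh_functional gen(2)]
        convolution_cdh[OF gen(2) counit_cdh_functional] counit_cdh gen.IH[OF t] gen.IH[OF gen(2)] zero)
next
  case (plus x y)
  then show ?case
    by (simp add: linearD(1)[OF convolution_cdh_functional] linearD(1)[OF plus(3)] counit_cdh_functional)
next
  case (scale c x)
  then show ?case
    by (simp add: linearD(2)[OF convolution_cdh_functional] linearD(2)[OF scale(2)] counit_cdh_functional)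
qed

lemma cdh_bilinear_antipode:
  assumes f: "functional cdh_scale f"
  shows "bilinear_map cdh_scale cdh_scale (*) (\<lambda>a b. f (antipode cdh_hopf a * b))"
    "bilinear_map cdh_scale cdh_scale (*) (\<lambda>a b. f (a * antipode cdh_hopf b))"
  by (simp_all add: bilinear_map_def cdh_linear_times[OF f] linear_mapI vector_space_cdh_scale
      vector_space_mult antipode_cdh distrib_left distrib_right cdh_scale_mult linearD(1,2)[OF f])

lemma antipode_cdh_left:
  assumes "functional cdh_scale f"
  shows "tsum (sw cdh_hopf x) (\<lambda>a b. f (antipode cdh_hopf a * b)) = counit cdh_hopf x * f 1"
  using assms
proof (induction x arbitrary: f rule: cdh_induct)
  case one
  then show ?case by (simp add: sw_cdh(1)[OF cdh_bilinear_antipode(1)] antipode_cdh counit_cdh)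
next
  case (gen x y)
  note sw = sw_cdh(4)[OF cdh_bilinear_antipode(1)[OF gen(2)]]
  have IH: "tsum (sw cdh_hopf x) (\<lambda>a b. f (u * (antipode cdh_hopf a * (b * v)))) =
      counit cdh_hopf x * f (u * v)" for u v
    using gen.IH[OF cdh_linear_times(1)[OF cdh_linear_times(2)[OF gen(2), of v], of u]]
    by (simp add: mult.assoc)
  show ?case
    using IH[of c_bar d_bar] IH[of d_bar c_bar] IH[of "h_bar * d_bar" c_bar] IH[of 1 h_bar]
    by (cases y) (simp_all add: sw antipode_cdh counit_cdh mult.assoc cdh_relations(1,2) tsum_add
        linearD(4)[OF gen(2)] tsum_neg tsum_diff)
next
  case (plus x y)
  then show ?case
    by (simp add: linearD(1)[OF sw_cdh(5)[OF cdh_bilinear_antipode(1)]] counit_cdh distrib_right)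
next
  case (scale c x)
  then show ?case
    by (simp add: linearD(2)[OF sw_cdh(5)[OF cdh_bilinear_antipode(1)]] counit_cdh)
qed

lemma antipode_cdh_right:
  assumes "functional cdh_scale f"
  shows "tsum (sw cdh_hopf x) (\<lambda>a b. f (a * antipode cdh_hopf b)) = counit cdh_hopf x * f 1"
  using assms
proof (induction x arbitrary: f rule: cdh_induct)
  case one
  then show ?case by (simp add: sw_cdh(1)[OF cdh_bilinear_antipode(2)] antipode_cdh counit_cdh)
next
  case (gen x y)
  note sw = sw_cdh(4)[OF cdh_bilinear_antipode(2)[OF gen(2)]]
  show ?case
    using gen.IH[OF gen(2)]
    by (cases y) (simp_all add: sw antipode_cdh counit_cdh mult.assoc cdh_relations_assoc tsum_add
        linearD(4)[OF gen(2)] tsum_neg tsum_diff)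
next
  case (plus x y)
  then show ?case
    by (simp add: linearD(1)[OF sw_cdh(5)[OF cdh_bilinear_antipode(2)]] counit_cdh distrib_right)
next
  case (scale c x)
  then show ?case
    by (simp add: linearD(2)[OF sw_cdh(5)[OF cdh_bilinear_antipode(2)]] counit_cdh)
qed

lemma hopf_algebra_cdh: "hopf_algebra (cdh_hopf :: ('k::field, 'k cdh) hopf)"
proof (rule hopf_algebraI[OF algebra_cdh])
  show "point_separating (scl cdh_hopf) {f. functional cdh_scale f}"
    by (simp add: point_separating_dual vector_space_cdh_scale)
  fix f g k :: "'k cdh \<Rightarrow> 'k" and x y :: "'k cdh"
  assume f: "f \<in> {f. functional cdh_scale f}"
  then have f: "functional cdh_scale f" by simp
  show "convolution cdh_hopf (counit cdh_hopf) f x = f x" "convolution cdh_hopf f (counit cdh_hopf) x = f x"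
    by (simp_all add: convolution_cdh_counit f)
  show "tsum (sw cdh_hopf x) (\<lambda>a b. f (mul cdh_hopf (antipode cdh_hopf a) b)) = counit cdh_hopf x * f (unt cdh_hopf)"
    "tsum (sw cdh_hopf x) (\<lambda>a b. f (mul cdh_hopf a (antipode cdh_hopf b))) = counit cdh_hopf x * f (unt cdh_hopf)"
    by (simp_all add: antipode_cdh_left antipode_cdh_right f)
  assume g: "g \<in> {f. functional cdh_scale f}"
  then have g: "functional cdh_scale g" by simp
  show "functional (scl cdh_hopf) (convolution cdh_hopf f g)"
    by (simp add: convolution_cdh_functional f g)
  show "convolution cdh_hopf f g (mul cdh_hopf x y) = tsum (sw cdh_hopf x)
      (\<lambda>a b. tsum (sw cdh_hopf y) (\<lambda>a' b'. f (mul cdh_hopf a a') * g (mul cdh_hopf b b')))"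
    by (simp add: convolution_tsum sw_cdh(2)[OF bilinear_product[OF f g]])
  show "convolution cdh_hopf f g (unt cdh_hopf) = f (unt cdh_hopf) * g (unt cdh_hopf)"
    by (simp add: convolution_cdh f g)
  assume "k \<in> {f. functional cdh_scale f}"
  then show "convolution cdh_hopf (convolution cdh_hopf f g) k x = convolution cdh_hopf f (convolution cdh_hopf g k) x"
    by (simp add: convolution_cdh_assoc f g)
qed (simp_all add: comul_cdh_space algebra_hom_field_alg_iff counit_cdh_functional counit_cdh
    counit_cdh_times antipode_cdh_linear)

section \<open>Functionals that vanish on an ideal of finite codimension\<close>

lemma finite_codim_mono:
  fixes s :: "'k::field \<Rightarrow> 'v \<Rightarrow> 'v::ab_group_add"
  assumes "vector_space s" "finite_codim s J" "J \<subseteq> K"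
  shows "finite_codim s K"
proof -
  interpret vector_space s by fact
  obtain F where F: "finite F" "span (F \<union> J) = UNIV" using assms(2) by (auto simp: finite_codim_def)
  have "span (F \<union> J) \<subseteq> span (F \<union> K)" using assms(3) by (intro span_mono) auto
  then show ?thesis using F by (auto simp: finite_codim_def)
qed

lemma subspace_kernel:
  assumes "functional s f"
  shows "module.subspace s {x. f x = 0}"
proof -
  interpret vector_space s by (rule linear_space[OF assms])
  show ?thesis by (rule subspaceI) (simp_all add: linearD[OF assms])
qed

lemma finite_codim_kernel:
  assumes f: "functional s f"
  shows "finite_codim s {x. f x = 0}"
proof -
  interpret vector_space s by (rule linear_space[OF f])
  show ?thesis
  proof (cases "\<exists>v. f v \<noteq> 0")
    case True
    then obtain v where v: "f v \<noteq> 0" by blast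
    have "x \<in> span (insert v {x. f x = 0})" for x
    proof -
      have "f (x - s (f x / f v) v) = 0"
        using v by (simp add: linearD(2,5)[OF f])
      then have "x - s (f x / f v) v \<in> span {x. f x = 0}" by (intro span_base) simp
      then show ?thesis by (auto simp: span_insert)
    qed
    then show ?thesis by (auto simp: finite_codim_def intro!: exI[of _ "{v}"])
  next
    case False
    then show ?thesis by (auto simp: finite_codim_def intro!: exI[of _ "{}"])
  qed
qed

lemma finite_codim_common_kernel:
  fixes s :: "'k::field \<Rightarrow> 'v \<Rightarrow> 'v::ab_group_add"
  assumes "vector_space s" "\<forall>f\<in>set fs. functional s f"
  shows "module.subspace s {x. \<forall>f\<in>set fs. f x = 0} \<and> finite_codim s {x. \<forall>f\<in>set fs. f x = 0}"
proof -
  interpret vector_space s by fact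
  show ?thesis using assms(2)
  proof (induction fs)
    case Nil
    then show ?case by (auto simp: finite_codim_def intro!: exI[of _ "{}"])
  next
    case (Cons f fs)
    have "{x. \<forall>g\<in>set (f # fs). g x = 0} = {x. f x = 0} \<inter> {x. \<forall>g\<in>set fs. g x = 0}" by auto
    then show ?case
      using Cons subspace_kernel[of s f] finite_codim_kernel[of s f]
      by (auto intro: subspace_inter finite_codim_Int[OF \<open>vector_space s\<close>])
  qed
qed

text \<open>
  If \<open>f(x y)\<close> is a finite sum of products, then \<open>f\<close> vanishes on the largest two-sided ideal inside
  its kernel, and finitely many linear conditions suffice to lie in that ideal: modulo the left
  annihilator, which has finite codimension, only finitely many right multipliers matter.
\<close>

lemma finite_dualI:
  fixes A :: "('k::field, 'a::ab_group_add, 'z) alg_scheme"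
  assumes alg: "algebra A" and f: "functional (scl A) f"
    and xs: "\<And>p q. (p, q) \<in> set xs \<Longrightarrow> functional (scl A) q"
    and split: "\<And>x y. f (mul A x y) = tsum xs (\<lambda>p q. p x * q y)"
  shows "f \<in> finite_dual A"
proof -
  note ad = algebraD[OF alg]
  interpret vector_space "scl A" by (rule ad)
  define K where "K = {x. \<forall>q\<in>set (map snd xs). q x = 0}"
  have "finite_codim (scl A) K"
    unfolding K_def using xs by (intro conjunct2[OF finite_codim_common_kernel[OF ad(1)]]) auto
  then obtain F where F: "finite F" "span (F \<union> K) = UNIV" by (auto simp: finite_codim_def)
  obtain bs where bs: "set bs = F" using finite_list[OF F(1)] by blast
  define gs where "gs = concat (map (\<lambda>q. map (\<lambda>b x. q (mul A x b)) bs) (map snd xs))"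
  define J where "J = {x. \<forall>a b. f (mul A (mul A a x) b) = 0}"
  have zero: "tsum xs (\<lambda>p q. p x * q y) = 0" if "\<forall>q\<in>set (map snd xs). q y = 0" for x y
    using that unfolding tsum_def by (induction xs) auto
  have "f (mul A (mul A a x) b) = 0" if x: "\<forall>g\<in>set gs. g x = 0" for x a b
  proof -
    have lin: "functional (scl A) (\<lambda>b. f (mul A (mul A a x) b))"
      by (rule linear_compose'[OF ad(5) f])
    have "b \<in> span (F \<union> K)" by (simp add: F)
    then show ?thesis
    proof (induction rule: span_induct_alt)
      case base
      then show ?case by (simp add: linearD(3)[OF lin])
    next
      case (step c u v)
      have "f (mul A (mul A a x) u) = 0"
      proof (cases "u \<in> K")
        case True
        then show ?thesis by (simp add: split zero K_def)
      next
        case False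
        then have "\<forall>q\<in>set (map snd xs). q (mul A x u) = 0"
          using step(1) x bs by (auto simp: gs_def)
        then show ?thesis by (simp add: ad(2) split zero del: set_map)
      qed
      then show ?case using step by (simp add: linearD(1,2)[OF lin])
    qed
  qed
  then have sub: "{x. \<forall>g\<in>set gs. g x = 0} \<subseteq> J" by (auto simp: J_def)
  have "finite_codim (scl A) {x. \<forall>g\<in>set gs. g x = 0}"
  proof (rule conjunct2[OF finite_codim_common_kernel[OF ad(1)]], rule ballI)
    fix g assume "g \<in> set gs"
    then obtain p q b where "(p, q) \<in> set xs" "g = (\<lambda>x. q (mul A x b))" by (auto simp: gs_def)
    then show "functional (scl A) g" using linear_compose'[OF ad(6) xs] by simp
  qed
  from finite_codim_mono[OF ad(1) this sub] have cof: "finite_codim (scl A) J" .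
  have "two_sided_ideal A J"
    unfolding two_sided_ideal_def
  proof (intro conjI allI ballI)
    show "subspace J"
      by (rule subspaceI)
        (simp_all add: J_def linearD[OF ad(5)] linearD[OF ad(6)] linearD[OF f])
    fix a x assume "x \<in> J"
    then have "f (mul A (mul A u x) v) = 0" for u v by (simp add: J_def)
    then show "mul A a x \<in> J" "mul A x a \<in> J"
      unfolding J_def by (auto simp: ad(2)) (simp add: ad(2)[symmetric])
  qed
  moreover have "\<forall>x\<in>J. f x = 0"
  proof
    fix x assume "x \<in> J"
    then have "f (mul A (mul A (unt A) x) (unt A)) = 0" unfolding J_def by blast
    then show "f x = 0" by (simp add: ad)
  qed
  ultimately show ?thesis using cof f by (auto simp: finite_dual_def)
qed

text \<open>
  Extending a basis of \<open>J\<close> by finitely many vectors to a basis of the whole space, the coordinates at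
  the new vectors vanish on \<open>J\<close> and determine a vector modulo \<open>J\<close>.
\<close>

lemma finite_codim_coordinates:
  fixes s :: "'k::field \<Rightarrow> 'v \<Rightarrow> 'v::ab_group_add"
  assumes "vector_space s" "module.subspace s J" "finite_codim s J"
  shows "\<exists>bs. (\<forall>(p, b)\<in>set bs. functional s p \<and> (\<forall>x\<in>J. p x = 0)) \<and>
    (\<forall>x. x - tsum bs (\<lambda>p b. s (p x) b) \<in> J)"
proof -
  interpret vector_space s by fact
  obtain F where F: "finite F" "span (F \<union> J) = UNIV" using assms(3) by (auto simp: finite_codim_def)
  obtain B where B: "B \<subseteq> J" "independent B" "J \<subseteq> span B" by (rule maximal_independent_subset)
  obtain E where E: "B \<subseteq> E" "E \<subseteq> F \<union> B" "independent E" "F \<union> B \<subseteq> span E"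
    using maximal_independent_subset_extend[of B "F \<union> B"] B(2) by blast
  have "F \<union> J \<subseteq> span E"
    using E B(3) span_mono[OF E(1)] by auto
  then have spE: "span E = UNIV" using F(2) span_minimal[of "F \<union> J" "span E"] by auto
  have "finite (E - B)" by (rule finite_subset[OF _ F(1)]) (use E(2) in auto)
  then obtain es where es: "set es = E - B" "distinct es" using finite_distinct_list by blast
  define bs where "bs = map (\<lambda>e. (\<lambda>x. representation E x e, e)) es"
  have zero: "representation E x e = 0" if "x \<in> J" "e \<notin> B" for x e
  proof -
    have "representation E x = representation B x"
      using that(1) B(3) E(1,3) by (intro representation_extend) auto
    then show ?thesis using representation_ne_zero[of B x e] that(2) by auto
  qed
  have "x - tsum bs (\<lambda>p b. s (p x) b) \<in> J" for x
  proof -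
    let ?r = "representation E x"
    let ?S = "{e. ?r e \<noteq> 0}"
    have fin: "finite ?S" by (rule finite_representation)
    have "x = (\<Sum>e\<in>?S. s (?r e) e)"
      using E(3) spE by (simp add: sum_nonzero_representation_eq)
    also have "\<dots> = (\<Sum>e\<in>?S \<inter> B. s (?r e) e) + (\<Sum>e\<in>?S - B. s (?r e) e)"
      using fin by (subst sum.Int_Diff[of _ _ B]) auto
    also have "(\<Sum>e\<in>?S - B. s (?r e) e) = (\<Sum>e\<in>E - B. s (?r e) e)"
      by (rule sum.mono_neutral_left)
        (use \<open>finite (E - B)\<close> representation_ne_zero[of E x] in auto)
    also have "\<dots> = tsum bs (\<lambda>p b. s (p x) b)"
      using es by (simp add: bs_def tsum_def comp_def sum_list_distinct_conv_sum_set)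
    finally have "x - tsum bs (\<lambda>p b. s (p x) b) = (\<Sum>e\<in>?S \<inter> B. s (?r e) e)"
      by (simp only: diff_eq_eq)
    also have "\<dots> \<in> J"
      using B(1) by (intro subspace_sum[OF assms(2)] subspace_scale[OF assms(2)]) auto
    finally show ?thesis .
  qed
  moreover have "functional s (\<lambda>x. representation E x e)" for e
    by (rule linear_representation[OF E(3) spE])
  ultimately show ?thesis
    using zero es by (intro exI[of _ bs]) (auto simp: bs_def)
qed

text \<open>
  Conversely, if \<open>f\<close> vanishes on an ideal \<open>J\<close> of finite codimension, then \<open>f(x y)\<close> depends on \<open>x\<close> only
  modulo \<open>J\<close>, and expanding \<open>x\<close> in finitely many coordinates that vanish on \<open>J\<close> splits it.
\<close>

lemma finite_dual_split:
  assumes alg: "algebra A" and f: "f \<in> finite_dual A"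
  shows "\<exists>xs. (\<forall>(p, q)\<in>set xs. p \<in> finite_dual A \<and> q \<in> finite_dual A) \<and>
    (\<forall>x y. f (mul A x y) = tsum xs (\<lambda>p q. p x * q y))"
proof -
  note ad = algebraD[OF alg]
  obtain J where lf: "functional (scl A) f" and J: "two_sided_ideal A J" "finite_codim (scl A) J" "\<forall>x\<in>J. f x = 0"
    using f by (auto simp: finite_dual_def)
  have "module.subspace (scl A) J" using J(1) by (simp add: two_sided_ideal_def)
  from finite_codim_coordinates[OF ad(1) this J(2)] obtain bs where
    bs: "\<forall>(p, b)\<in>set bs. functional (scl A) p \<and> (\<forall>x\<in>J. p x = 0)"
      "\<And>x. x - tsum bs (\<lambda>p b. scl A (p x) b) \<in> J" by blast
  define xs where "xs = map (\<lambda>(p, b). (p, \<lambda>y. f (mul A b y))) bs"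
  have "f (mul A x y) = tsum xs (\<lambda>p q. p x * q y)" for x y
  proof -
    have lin: "functional (scl A) (\<lambda>x. f (mul A x y))"
      by (rule linear_compose'[OF ad(6) lf])
    have "f (mul A (x - tsum bs (\<lambda>p b. scl A (p x) b)) y) = 0"
      using bs(2) J(1,3) by (simp add: two_sided_ideal_def)
    then have "f (mul A x y) = f (mul A (tsum bs (\<lambda>p b. scl A (p x) b)) y)"
      by (simp add: linearD(5)[OF lin])
    also have "\<dots> = tsum bs (\<lambda>p b. p x * f (mul A b y))"
      by (simp add: tsum_linear[OF lin] linearD(2)[OF lin])
    also have "\<dots> = tsum xs (\<lambda>p q. p x * q y)"
      by (simp add: xs_def tsum_map)
    finally show ?thesis .
  qed
  moreover have "p \<in> finite_dual A \<and> q \<in> finite_dual A" if pq: "(p, q) \<in> set xs" for p q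
  proof -
    obtain b where b: "(p, b) \<in> set bs" "q = (\<lambda>y. f (mul A b y))" using pq by (auto simp: xs_def)
    have "functional (scl A) q" using linear_compose'[OF ad(5) lf] b(2) by simp
    moreover have "\<forall>x\<in>J. q x = 0" using J(1,3) b(2) by (simp add: two_sided_ideal_def)
    moreover have "functional (scl A) p" "\<forall>x\<in>J. p x = 0" using bs(1) b(1) by auto
    ultimately show ?thesis using J(1,2) unfolding finite_dual_def by blast
  qed
  ultimately show ?thesis by (intro exI[of _ xs]) auto
qed

section \<open>The finite dual of \<open>k\<langle>c, d, h\<rangle>/I\<close> is a Hopf algebra\<close>

text \<open>Multiplicativity of the comultiplication of a dual space is this interchange of sums.\<close>

lemma tsum_interchange:
  fixes \<phi> :: "_ \<Rightarrow> _ \<Rightarrow> 'k::comm_semiring_1"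
  shows "tsum X (\<lambda>a b. tsum Y (\<lambda>a' b'. tsum P (\<lambda>p q. \<phi> p a * \<psi> q a') * tsum Q (\<lambda>p q. \<phi>' p b * \<psi>' q b'))) =
    tsum P (\<lambda>p q. tsum Q (\<lambda>p' q'. tsum X (\<lambda>a b. \<phi> p a * \<phi>' p' b) * tsum Y (\<lambda>a' b'. \<psi> q a' * \<psi>' q' b')))"
    (is "?L = ?R")
proof -
  have "?L = tsum X (\<lambda>a b. tsum Y (\<lambda>a' b'. tsum P (\<lambda>p q. tsum Q (\<lambda>p' q'.
      (\<phi> p a * \<phi>' p' b) * (\<psi> q a' * \<psi>' q' b')))))"
    by (simp only: tsum_product mult.assoc mult.left_commute)
  also have "\<dots> = tsum P (\<lambda>p q. tsum Q (\<lambda>p' q'. tsum X (\<lambda>a b. tsum Y (\<lambda>a' b'.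
      (\<phi> p a * \<phi>' p' b) * (\<psi> q a' * \<psi>' q' b')))))"
    by (simp only: tsum_swap[of Y P] tsum_swap[of Y Q] tsum_swap[of X P] tsum_swap[of X Q])
  also have "\<dots> = ?R" by (simp only: tsum_product)
  finally show ?thesis .
qed

lemma finite_dual_functional: "f \<in> finite_dual cdh_hopf \<Longrightarrow> functional cdh_scale f"
  by (simp add: finite_dual_def)

lemma finite_dual_cdh_split:
  assumes "f \<in> finite_dual cdh_hopf"
  obtains xs where "\<And>p q. (p, q) \<in> set xs \<Longrightarrow> p \<in> finite_dual cdh_hopf \<and> q \<in> finite_dual cdh_hopf"
    "\<And>x y. f (x * y) = tsum xs (\<lambda>p q. p x * q y)"
  using finite_dual_split[OF algebra_cdh assms] by auto

lemma convolution_finite_dual: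
  assumes f: "f \<in> finite_dual cdh_hopf" and g: "g \<in> finite_dual cdh_hopf"
  shows "convolution cdh_hopf f g \<in> finite_dual cdh_hopf"
proof -
  obtain xs where xs: "\<And>p q. (p, q) \<in> set xs \<Longrightarrow> p \<in> finite_dual cdh_hopf \<and> q \<in> finite_dual cdh_hopf"
    "\<And>x y. f (x * y) = tsum xs (\<lambda>p q. p x * q y)" by (rule finite_dual_cdh_split[OF f]) blast
  obtain ys where ys: "\<And>p q. (p, q) \<in> set ys \<Longrightarrow> p \<in> finite_dual cdh_hopf \<and> q \<in> finite_dual cdh_hopf"
    "\<And>x y. g (x * y) = tsum ys (\<lambda>p q. p x * q y)" by (rule finite_dual_cdh_split[OF g]) blast
  note lin = f[THEN finite_dual_functional] g[THEN finite_dual_functional]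
  define zs where "zs = concat (map (\<lambda>(p, q). map (\<lambda>(p', q').
    (convolution cdh_hopf p p', convolution cdh_hopf q q')) ys) xs)"
  show ?thesis
  proof (rule finite_dualI[OF algebra_cdh, where xs = zs])
    show "functional (scl cdh_hopf) (convolution cdh_hopf f g)"
      using lin by (simp add: convolution_cdh_functional)
    show "functional (scl cdh_hopf) q" if pq: "(p, q) \<in> set zs" for p q
    proof -
      obtain p1 q1 p2 q2 where "(p1, q1) \<in> set xs" "(p2, q2) \<in> set ys" "q = convolution cdh_hopf q1 q2"
        using pq by (auto simp: zs_def)
      then show ?thesis
        using xs(1)[of p1 q1] ys(1)[of p2 q2] by (simp add: convolution_cdh_functional finite_dual_functional)
    qed
    show "convolution cdh_hopf f g (mul cdh_hopf x y) = tsum zs (\<lambda>p q. p x * q y)" for x y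
      by (simp add: zs_def tsum_concat tsum_map convolution_tsum sw_cdh(2)[OF bilinear_product[OF lin]]
          xs(2) ys(2)) (rule tsum_interchange)
  qed
qed

lemma counit_finite_dual: "counit cdh_hopf \<in> finite_dual cdh_hopf"
  by (rule finite_dualI[OF algebra_cdh, where xs = "[(counit cdh_hopf, counit cdh_hopf)]"])
    (simp_all add: counit_cdh_functional counit_cdh_times)

lemma antipode_finite_dual:
  assumes f: "f \<in> finite_dual cdh_hopf"
  shows "(\<lambda>x. f (antipode cdh_hopf x)) \<in> finite_dual cdh_hopf"
proof -
  obtain xs where xs: "\<And>p q. (p, q) \<in> set xs \<Longrightarrow> p \<in> finite_dual cdh_hopf \<and> q \<in> finite_dual cdh_hopf"
    "\<And>x y. f (x * y) = tsum xs (\<lambda>p q. p x * q y)" by (rule finite_dual_cdh_split[OF f]) blast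
  define zs where "zs = map (\<lambda>(p, q). (\<lambda>x. q (antipode cdh_hopf x), \<lambda>x. p (antipode cdh_hopf x))) xs"
  note lin = linear_compose'[OF antipode_cdh_linear finite_dual_functional]
  show ?thesis
  proof (rule finite_dualI[OF algebra_cdh, where xs = zs])
    show "functional (scl cdh_hopf) (\<lambda>x. f (antipode cdh_hopf x))"
      using lin[OF f] by simp
    show "functional (scl cdh_hopf) q" if pq: "(p, q) \<in> set zs" for p q
    proof -
      obtain p' q' where "(p', q') \<in> set xs" "q = (\<lambda>x. p' (antipode cdh_hopf x))"
        using pq by (auto simp: zs_def)
      then show ?thesis using xs(1)[of p' q'] lin[of p'] by simp
    qed
    show "f (antipode cdh_hopf (mul cdh_hopf x y)) = tsum zs (\<lambda>p q. p x * q y)" for x y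
      by (simp add: zs_def tsum_map antipode_cdh_times xs(2) mult.commute)
  qed
qed

lemma Rep_cdh_dual_functional: "functional cdh_scale (Rep_cdh_dual f)"
  by (rule finite_dual_functional[OF Rep_cdh_dual])

lemma cdh_dual_eqI: "(\<And>x. Rep_cdh_dual f x = Rep_cdh_dual g x) \<Longrightarrow> f = g"
  by (rule iffD1[OF Rep_cdh_dual_inject], rule ext)

lemma cdh_dual_hopf_simps [simp]:
  "scl cdh_dual_hopf = cdh_dual_scale"
  "Rep_cdh_dual (mul cdh_dual_hopf f g) = convolution cdh_hopf (Rep_cdh_dual f) (Rep_cdh_dual g)"
  "Rep_cdh_dual (unt cdh_dual_hopf) = counit cdh_hopf"
  "counit cdh_dual_hopf f = Rep_cdh_dual f 1"
  "Rep_cdh_dual (antipode cdh_dual_hopf f) = (\<lambda>x. Rep_cdh_dual f (antipode cdh_hopf x))"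
  by (simp_all add: cdh_dual_hopf_def Abs_cdh_dual_inverse[OF convolution_finite_dual[OF Rep_cdh_dual Rep_cdh_dual]]
      Abs_cdh_dual_inverse[OF counit_finite_dual] Abs_cdh_dual_inverse[OF antipode_finite_dual[OF Rep_cdh_dual]])

lemma vector_space_cdh_dual_scale: "vector_space cdh_dual_scale"
proof (rule vector_space.intro)
  fix a b and f g :: "'a cdh_dual"
  show "cdh_dual_scale a (f + g) = cdh_dual_scale a f + cdh_dual_scale a g"
    by (rule cdh_dual_eqI) (simp only: cdh_dual_scale.rep_eq plus_cdh_dual.rep_eq distrib_left)
  show "cdh_dual_scale (a + b) f = cdh_dual_scale a f + cdh_dual_scale b f"
    by (rule cdh_dual_eqI) (simp only: cdh_dual_scale.rep_eq plus_cdh_dual.rep_eq distrib_right)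
  show "cdh_dual_scale a (cdh_dual_scale b f) = cdh_dual_scale (a * b) f"
    by (rule cdh_dual_eqI) (simp only: cdh_dual_scale.rep_eq mult.assoc)
  show "cdh_dual_scale 1 f = f"
    by (rule cdh_dual_eqI) (simp only: cdh_dual_scale.rep_eq mult_1_left)
qed

lemma evaluation_functional: "functional cdh_dual_scale (\<lambda>f. Rep_cdh_dual f x)"
  by (rule linear_mapI[OF vector_space_cdh_dual_scale vector_space_mult])
    (simp_all add: cdh_dual_scale.rep_eq plus_cdh_dual.rep_eq)

lemma point_separating_evaluations:
  "point_separating cdh_dual_scale {\<lambda>f. Rep_cdh_dual f x | x. True}"
proof -
  have "f = 0" if "\<forall>e\<in>{\<lambda>f. Rep_cdh_dual f x | x. True}. e f = 0" for f :: "'a cdh_dual"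
  proof (rule cdh_dual_eqI)
    fix x show "Rep_cdh_dual f x = Rep_cdh_dual 0 x" using that by (auto simp: zero_cdh_dual.rep_eq)
  qed
  then show ?thesis
    by (auto simp: point_separating_def vector_space_cdh_dual_scale evaluation_functional)
qed

text \<open>
  The comultiplication is given as the unique tensor that evaluates at \<open>x\<close>, \<open>y\<close> to the value at \<open>x y\<close>.
  Such a tensor exists because elements of the finite dual split, and it is unique because evaluations
  separate points.
\<close>

lemma comul_cdh_dual:
  fixes f :: "'k::field cdh_dual"
  shows "comul cdh_dual_hopf f \<in> tensor_space cdh_dual_scale cdh_dual_scale"
  "convolution cdh_dual_hopf (\<lambda>p. Rep_cdh_dual p x) (\<lambda>q. Rep_cdh_dual q y) f = Rep_cdh_dual f (x * y)"
proof -
  let ?P = "\<lambda>T. T \<in> tensor_space cdh_dual_scale cdh_dual_scale \<and>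
       (\<forall>x y. Rep_cdh_dual f (x * y) =
          tsum (sweedler cdh_dual_scale cdh_dual_scale T) (\<lambda>p q. Rep_cdh_dual p x * Rep_cdh_dual q y))"
  have comul: "comul cdh_dual_hopf f = (THE T. ?P T)"
    unfolding tsum_def by (simp only: cdh_dual_hopf_def hopf.select_convs)
  have "\<exists>!T. ?P T"
  proof (rule ex_ex1I)
    obtain xs where xs: "\<And>p q. (p, q) \<in> set xs \<Longrightarrow> p \<in> finite_dual cdh_hopf \<and> q \<in> finite_dual cdh_hopf"
      "\<And>x y. Rep_cdh_dual f (x * y) = tsum xs (\<lambda>p q. p x * q y)"
      by (rule finite_dual_cdh_split[OF Rep_cdh_dual]) blast
    define zs where "zs = map (\<lambda>(p, q). (Abs_cdh_dual p, Abs_cdh_dual q)) xs"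
    have "tsum zs (\<lambda>p q. Rep_cdh_dual p x * Rep_cdh_dual q y) = tsum xs (\<lambda>p q. p x * q y)" for x y
      unfolding zs_def tsum_map unfolding tsum_def
      by (rule arg_cong[where f = sum_list], rule map_cong[OF refl])
        (use xs(1) in \<open>auto simp: Abs_cdh_dual_inverse\<close>)
    then have "?P (tens cdh_dual_scale cdh_dual_scale zs)"
      by (simp add: xs(2) tsum_sweedler_tens[OF bilinear_product[OF evaluation_functional evaluation_functional]])
    then show "\<exists>T. ?P T" ..
  next
    fix T T' assume T: "?P T" and T': "?P T'"
    show "T = T'"
    proof (rule tensor_eqI[OF point_separating_evaluations point_separating_evaluations])
      fix e e' :: "'k cdh_dual \<Rightarrow> 'k" assume "e \<in> {\<lambda>f. Rep_cdh_dual f x | x. True}" "e' \<in> {\<lambda>f. Rep_cdh_dual f x | x. True}"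
      then obtain x y where e: "e = (\<lambda>f. Rep_cdh_dual f x)" "e' = (\<lambda>f. Rep_cdh_dual f y)" by auto
      show "tsum (sweedler cdh_dual_scale cdh_dual_scale T) (\<lambda>v w. e v * e' w) =
          tsum (sweedler cdh_dual_scale cdh_dual_scale T') (\<lambda>v w. e v * e' w)"
        using T T' unfolding e by metis
    qed (use T T' in auto)
  qed
  from theI'[OF this] have "?P (comul cdh_dual_hopf f)" unfolding comul .
  then show "comul cdh_dual_hopf f \<in> tensor_space cdh_dual_scale cdh_dual_scale"
    "convolution cdh_dual_hopf (\<lambda>p. Rep_cdh_dual p x) (\<lambda>q. Rep_cdh_dual q y) f = Rep_cdh_dual f (x * y)"
    by (simp_all add: convolution_tsum sw_def)
qed

lemma sw_cdh_dual:
  "tsum (sw cdh_dual_hopf f) (\<lambda>p q. Rep_cdh_dual p x * Rep_cdh_dual q y) = Rep_cdh_dual f (x * y)"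
  using comul_cdh_dual(2) by (simp add: convolution_tsum)

lemma algebra_cdh_dual: "algebra cdh_dual_hopf"
proof -
  note conv = convolution_cdh_functional[OF Rep_cdh_dual_functional Rep_cdh_dual_functional]
  show ?thesis
    unfolding algebra_def
  proof (intro conjI allI)
    fix f g h :: "'a cdh_dual"
    have scale: "convolution cdh_hopf (\<lambda>x. c * p x) q y = c * convolution cdh_hopf p q y"
      "convolution cdh_hopf p (\<lambda>x. c * q x) y = c * convolution cdh_hopf p q y" for c :: 'a and p q y
      by (simp_all only: convolution_tsum tsum_mult(1)[symmetric] mult.assoc mult.left_commute[of _ c])
    show "Vector_Spaces.linear (scl cdh_dual_hopf) (scl cdh_dual_hopf) (mul cdh_dual_hopf f)"
      by (intro linear_mapI cdh_dual_eqI)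
        (simp_all add: vector_space_cdh_dual_scale plus_cdh_dual.rep_eq cdh_dual_scale.rep_eq
          convolution_plus scale)
    show "Vector_Spaces.linear (scl cdh_dual_hopf) (scl cdh_dual_hopf) (\<lambda>f. mul cdh_dual_hopf f g)"
      by (intro linear_mapI cdh_dual_eqI)
        (simp_all add: vector_space_cdh_dual_scale plus_cdh_dual.rep_eq cdh_dual_scale.rep_eq
          convolution_plus scale)
    show "mul cdh_dual_hopf (mul cdh_dual_hopf f g) h = mul cdh_dual_hopf f (mul cdh_dual_hopf g h)"
      by (rule cdh_dual_eqI) (simp add: convolution_cdh_assoc Rep_cdh_dual_functional)
    show "mul cdh_dual_hopf (unt cdh_dual_hopf) f = f" "mul cdh_dual_hopf f (unt cdh_dual_hopf) = f"
      by (rule cdh_dual_eqI, simp add: convolution_cdh_counit Rep_cdh_dual_functional)+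
  qed (simp add: vector_space_cdh_dual_scale)
qed

text \<open>
  Evaluations turn each axiom into a known one: coassociativity and the counit come from the
  associative algebra, and the antipode from its antipode.
\<close>

lemma hopf_algebra_cdh_dual: "hopf_algebra (cdh_dual_hopf :: ('k::field, 'k cdh_dual) hopf)"
proof (rule hopf_algebraI[OF algebra_cdh_dual])
  let ?F = "{\<lambda>f :: 'k cdh_dual. Rep_cdh_dual f x | x. True}"
  show "point_separating (scl cdh_dual_hopf) ?F"
    unfolding cdh_dual_hopf_simps by (rule point_separating_evaluations)
  show "comul cdh_dual_hopf f \<in> tensor_space (scl cdh_dual_hopf) (scl cdh_dual_hopf)" for f :: "'k cdh_dual"
    by (simp add: comul_cdh_dual)
  note conv = comul_cdh_dual(2)[abs_def]
  have counit: "counit cdh_dual_hopf = (\<lambda>f :: 'k cdh_dual. Rep_cdh_dual f 1)" by auto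
  fix e1 e2 e3 :: "'k cdh_dual \<Rightarrow> 'k" and f g :: "'k cdh_dual"
  assume "e1 \<in> ?F"
  then obtain x where e1: "e1 = (\<lambda>f. Rep_cdh_dual f x)" by auto
  show "convolution cdh_dual_hopf (counit cdh_dual_hopf) e1 f = e1 f"
    "convolution cdh_dual_hopf e1 (counit cdh_dual_hopf) f = e1 f"
    by (simp_all add: counit e1 comul_cdh_dual del: cdh_dual_hopf_simps)
  show "tsum (sw cdh_dual_hopf f) (\<lambda>p q. e1 (mul cdh_dual_hopf (antipode cdh_dual_hopf p) q)) =
      counit cdh_dual_hopf f * e1 (unt cdh_dual_hopf)"
    by (simp add: e1 convolution_tsum tsum_swap[of "sw cdh_dual_hopf f"] sw_cdh_dual
        antipode_cdh_left Rep_cdh_dual_functional; rule mult.commute)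
  show "tsum (sw cdh_dual_hopf f) (\<lambda>p q. e1 (mul cdh_dual_hopf p (antipode cdh_dual_hopf q))) =
      counit cdh_dual_hopf f * e1 (unt cdh_dual_hopf)"
    by (simp add: e1 convolution_tsum tsum_swap[of "sw cdh_dual_hopf f"] sw_cdh_dual
        antipode_cdh_right Rep_cdh_dual_functional; rule mult.commute)
  assume "e2 \<in> ?F"
  then obtain y where e2: "e2 = (\<lambda>f. Rep_cdh_dual f y)" by auto
  show "functional (scl cdh_dual_hopf) (convolution cdh_dual_hopf e1 e2)"
    by (simp add: e1 e2 comul_cdh_dual(2)[abs_def] evaluation_functional)
  show "convolution cdh_dual_hopf e1 e2 (mul cdh_dual_hopf f g) = tsum (sw cdh_dual_hopf f) (\<lambda>p q.
      tsum (sw cdh_dual_hopf g) (\<lambda>p' q'. e1 (mul cdh_dual_hopf p p') * e2 (mul cdh_dual_hopf q q')))"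
  proof -
    have "convolution cdh_dual_hopf e1 e2 (mul cdh_dual_hopf f g) =
        tsum (sw cdh_hopf x) (\<lambda>a b. tsum (sw cdh_hopf y) (\<lambda>a' b'.
          Rep_cdh_dual f (a * a') * Rep_cdh_dual g (b * b')))"
      by (simp add: e1 e2 comul_cdh_dual) (simp add: convolution_tsum
          sw_cdh(2)[OF bilinear_product[OF Rep_cdh_dual_functional Rep_cdh_dual_functional]])
    also have "\<dots> = tsum (sw cdh_dual_hopf f) (\<lambda>p q. tsum (sw cdh_dual_hopf g) (\<lambda>p' q'.
        convolution cdh_hopf (Rep_cdh_dual p) (Rep_cdh_dual p') x *
        convolution cdh_hopf (Rep_cdh_dual q) (Rep_cdh_dual q') y))"
      unfolding sw_cdh_dual[symmetric] convolution_tsum by (rule tsum_interchange)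
    finally show ?thesis by (simp add: e1 e2)
  qed
  show "convolution cdh_dual_hopf e1 e2 (unt cdh_dual_hopf) = e1 (unt cdh_dual_hopf) * e2 (unt cdh_dual_hopf)"
    by (simp add: e1 e2 comul_cdh_dual counit_cdh_times)
  assume "e3 \<in> ?F"
  then obtain z where e3: "e3 = (\<lambda>f. Rep_cdh_dual f z)" by auto
  show "convolution cdh_dual_hopf (convolution cdh_dual_hopf e1 e2) e3 f =
      convolution cdh_dual_hopf e1 (convolution cdh_dual_hopf e2 e3) f"
    by (simp add: e1 e2 e3 comul_cdh_dual(2) comul_cdh_dual(2)[abs_def] mult.assoc)
next
  show "algebra_hom cdh_dual_hopf field_alg (counit (cdh_dual_hopf :: ('k, 'k cdh_dual) hopf))"
    unfolding algebra_hom_field_alg_iff cdh_dual_hopf_simps(4)[abs_def]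
    by (simp add: evaluation_functional convolution_cdh(1) Rep_cdh_dual_functional counit_cdh)
  show "Vector_Spaces.linear (scl cdh_dual_hopf) (scl cdh_dual_hopf)
      (antipode (cdh_dual_hopf :: ('k, 'k cdh_dual) hopf))"
    by (intro linear_mapI cdh_dual_eqI)
      (simp_all add: vector_space_cdh_dual_scale plus_cdh_dual.rep_eq cdh_dual_scale.rep_eq)
qed

section \<open>The coaction \<open>\<rho>\<^sub>3\<close> and the action \<open>\<psi>\<^sub>3\<close>\<close>

lemma kk_simps [simp]:
  "scl kk r (a, b) = (r * a, r * b)" "mul kk (a, b) (a', b') = (a * a', b * b')" "unt kk = (1, 1)"
  "fst (scl kk r x) = r * fst x" "snd (scl kk r x) = r * snd x"
  "fst (mul kk x y) = fst x * fst y" "snd (mul kk x y) = snd x * snd y"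
  by (simp_all add: kk_def case_prod_unfold)

lemma vector_space_kk: "vector_space (scl kk)"
  by (intro vector_space.intro prod_eqI) (simp_all add: distrib_left distrib_right)

lemma algebra_kk: "algebra kk"
  unfolding algebra_def
  by (intro conjI allI linear_mapI vector_space_kk prod_eqI) (simp_all add: distrib_left distrib_right)

lemma kk_functionals: "functional (scl kk) fst" "functional (scl kk) snd"
  by (rule linear_mapI[OF vector_space_kk vector_space_mult], simp_all)+

lemma point_separating_kk: "point_separating (scl kk) {fst, snd}"
  by (auto simp: point_separating_def vector_space_kk kk_functionals prod_eq_iff)

lemma tsum_pair: "fst (tsum xs B) = tsum xs (\<lambda>a b. fst (B a b))" "snd (tsum xs B) = tsum xs (\<lambda>a b. snd (B a b))"
  by (induction xs) auto

text \<open>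
  In the basis of idempotents \<open>\<rho>\<^sub>3(a) = (1, 0) \<otimes> x + (0, 1) \<otimes> y\<close>, where \<open>x\<close> and \<open>y\<close> are the
  images of \<open>a\<close> under two algebra homomorphisms from \<open>k \<times> k\<close>: the relations \<open>h\<^sup>2 = h\<close> and
  \<open>hc + ch + c\<^sup>2 = c\<close> say precisely that \<open>h\<close> and \<open>h + c\<close>, the images of \<open>(1, 0)\<close>, are idempotent.
\<close>

definition coord1 :: "'k::field \<times> 'k \<Rightarrow> 'k cdh" where
  "coord1 a = cdh_scale (snd a) 1 + cdh_scale (fst a - snd a) (h_bar + c_bar)"

definition coord2 :: "'k::field \<times> 'k \<Rightarrow> 'k cdh" where
  "coord2 a = cdh_scale (snd a) 1 + cdh_scale (fst a - snd a) h_bar"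

lemmas cdh_scale_simps = vector_spaceD[OF vector_space_cdh_scale] vector_space_diff[OF vector_space_cdh_scale]

lemma affine_idempotent:
  fixes e :: "'k::field cdh"
  assumes "e * e = e"
  shows "(cdh_scale a 1 + cdh_scale (a' - a) e) * (cdh_scale b 1 + cdh_scale (b' - b) e) =
    cdh_scale (a * b) 1 + cdh_scale (a' * b' - a * b) e"
  by (simp add: distrib_left distrib_right cdh_scale_mult assms cdh_scale_simps left_diff_distrib
      right_diff_distrib mult.commute)

lemma coord_mul: "coord1 (mul kk a b) = coord1 a * coord1 b" "coord2 (mul kk a b) = coord2 a * coord2 b"
proof -
  have "(h_bar + c_bar) * (h_bar + c_bar) = (h_bar + (h_bar * c_bar + c_bar * h_bar + c_bar * c_bar) :: 'a cdh)"
    by (simp add: distrib_left distrib_right cdh_relations(3) add.assoc)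
  also have "\<dots> = h_bar + c_bar" by (simp only: cdh_relations)
  finally show "coord1 (mul kk a b) = coord1 a * coord1 b"
    by (simp add: coord1_def affine_idempotent)
  show "coord2 (mul kk a b) = coord2 a * coord2 b"
    by (simp add: coord2_def affine_idempotent cdh_relations(3))
qed

lemma linear_coord: "Vector_Spaces.linear (scl kk) cdh_scale coord1" "Vector_Spaces.linear (scl kk) cdh_scale coord2"
  by (rule linear_mapI[OF vector_space_kk vector_space_cdh_scale];
      simp add: coord1_def coord2_def cdh_scale_simps)+

lemma sweedler_rho3:
  assumes "bilinear_map (scl kk) cdh_scale r B"
  shows "tsum (sweedler (scl kk) cdh_scale (rho3 (a, b))) B = B (b, b) 1 + B (a - b, a - b) h_bar + B (a - b, 0) c_bar"
  by (simp add: rho3_def tsum_sweedler_tens[OF assms] add.assoc)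

lemma sweedler_rho3_coord:
  assumes g: "functional cdh_scale g"
  shows "tsum (sweedler (scl kk) cdh_scale (rho3 a)) (\<lambda>x y. fst x * g y) = g (coord1 a)"
    and "tsum (sweedler (scl kk) cdh_scale (rho3 a)) (\<lambda>x y. snd x * g y) = g (coord2 a)"
  by (cases a; simp add: sweedler_rho3[OF bilinear_product[OF kk_functionals(1) g]]
      sweedler_rho3[OF bilinear_product[OF kk_functionals(2) g]]
      coord1_def coord2_def linearD(1,2)[OF g] distrib_left add.assoc)+

text \<open>Both coordinates of the action are evaluations of the acting functional.\<close>

lemma psi3_coord: "psi3 f a = (Rep_cdh_dual f (coord1 a), Rep_cdh_dual f (coord2 a))"
proof (rule prod_eqI)
  have psi: "psi3 f a = tsum (sweedler (scl kk) cdh_scale (rho3 a)) (\<lambda>x y. scl kk (Rep_cdh_dual f y) x)"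
    by (simp add: psi3_def coaction_dual_def tsum_def)
  show "fst (psi3 f a) = fst (Rep_cdh_dual f (coord1 a), Rep_cdh_dual f (coord2 a))"
    using sweedler_rho3_coord(1)[OF Rep_cdh_dual_functional, of a f] by (simp add: psi tsum_pair mult.commute)
  show "snd (psi3 f a) = snd (Rep_cdh_dual f (coord1 a), Rep_cdh_dual f (coord2 a))"
    using sweedler_rho3_coord(2)[OF Rep_cdh_dual_functional, of a f] by (simp add: psi tsum_pair mult.commute)
qed

lemma counit_cdh_gen: "counit cdh_hopf (cdh_gen g) = cdh_counit_gen g"
  using counit_cdh(2)[of 1 g] by (simp add: counit_cdh(1))

lemma convolution_cdh_gen:
  assumes f: "functional cdh_scale f" and g: "functional cdh_scale g"
  shows "convolution cdh_hopf f g c_bar = f c_bar * g c_bar" "convolution cdh_hopf f g d_bar = f d_bar * g d_bar"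
    "convolution cdh_hopf f g h_bar = f h_bar * g c_bar + f 1 * g h_bar"
  by (simp_all add: convolution_tsum sw_cdh(3)[OF bilinear_product[OF f g]])

lemma unital_hopf_action_psi3: "unital_hopf_action cdh_dual_hopf kk (psi3 :: 'k::field cdh_dual \<Rightarrow> _)"
  unfolding unital_hopf_action_def hopf_action_def tsum_def[symmetric]
proof (intro conjI allI hopf_algebra_cdh_dual algebra_kk)
  fix f g :: "'k cdh_dual" and a b :: "'k \<times> 'k"
  note lin = linearD[OF Rep_cdh_dual_functional]
  note coord_lin = linearD[OF linear_coord(1)] linearD[OF linear_coord(2)]
  show "Vector_Spaces.linear (scl kk) (scl kk) (psi3 f)"
    by (rule linear_mapI) (simp_all add: vector_space_kk psi3_coord coord_lin lin)
  show "Vector_Spaces.linear (scl cdh_dual_hopf) (scl kk) (\<lambda>f. psi3 f a)"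
    by (rule linear_mapI) (simp_all add: vector_space_kk vector_space_cdh_dual_scale psi3_coord
        plus_cdh_dual.rep_eq cdh_dual_scale.rep_eq)
  show "psi3 (unt cdh_dual_hopf) a = a"
    by (simp add: psi3_coord coord1_def coord2_def counit_cdh counit_cdh_gen)
  show "psi3 (mul cdh_dual_hopf f g) a = psi3 f (psi3 g a)"
  proof -
    note fg = Rep_cdh_dual_functional[of f] Rep_cdh_dual_functional[of g]
    note conv = linearD(1,2)[OF convolution_cdh_functional[OF fg]] convolution_cdh(1)[OF fg] convolution_cdh_gen[OF fg]
    have rep: "Rep_cdh_dual p (coord1 b) = snd b * Rep_cdh_dual p 1 + (fst b - snd b) * (Rep_cdh_dual p h_bar + Rep_cdh_dual p c_bar)"
      "Rep_cdh_dual p (coord2 b) = snd b * Rep_cdh_dual p 1 + (fst b - snd b) * Rep_cdh_dual p h_bar" for p b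
      by (simp_all add: coord1_def coord2_def lin(1,2))
    have "convolution cdh_hopf (Rep_cdh_dual f) (Rep_cdh_dual g) (coord1 a) = Rep_cdh_dual f (coord1 (psi3 g a))"
      unfolding psi3_coord rep fst_conv snd_conv by (simp only: coord1_def conv) algebra
    moreover have "convolution cdh_hopf (Rep_cdh_dual f) (Rep_cdh_dual g) (coord2 a) = Rep_cdh_dual f (coord2 (psi3 g a))"
      unfolding psi3_coord rep fst_conv snd_conv by (simp only: coord2_def conv) algebra
    ultimately show ?thesis
      by (simp only: psi3_coord[of "mul cdh_dual_hopf f g" a] psi3_coord[of f "psi3 g a"] cdh_dual_hopf_simps(2))
  qed
  show "psi3 f (mul kk a b) = tsum (sw cdh_dual_hopf f) (\<lambda>p q. mul kk (psi3 p a) (psi3 q b))"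
    by (rule prod_eqI) (simp_all add: psi3_coord tsum_pair sw_cdh_dual coord_mul)
  show "psi3 f (unt kk) = scl kk (counit cdh_dual_hopf f) (unt kk)"
    by (simp add: psi3_coord coord1_def coord2_def)
qed

lemma rho3_tens: "tens (scl kk) cdh_scale (sweedler (scl kk) cdh_scale (rho3 a)) = rho3 a"
  by (rule tens_sweedler[OF vector_space_kk vector_space_cdh_scale]) (simp add: rho3_def case_prod_unfold)

lemma unital_hopf_coaction_rho3: "unital_hopf_coaction cdh_hopf kk (rho3 :: 'k::field \<times> 'k \<Rightarrow> _)"
  unfolding unital_hopf_coaction_def hopf_coaction_def Let_def tsum_def[symmetric] cdh_hopf_simps
proof (intro conjI allI hopf_algebra_cdh algebra_kk)
  note sep = point_separating_kk point_separating_dual[OF vector_space_cdh_scale]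
  show "tensor_linear (scl kk) (scl kk) cdh_scale (rho3 :: 'k \<times> 'k \<Rightarrow> _)"
  proof (rule tensor_linearI[OF sep])
    show "rho3 a \<in> tensor_space (scl kk) cdh_scale" for a :: "'k \<times> 'k"
      by (simp add: rho3_def case_prod_unfold)
    fix f g assume f: "f \<in> {fst, snd :: 'k \<times> 'k \<Rightarrow> 'k}" and "g \<in> {f :: 'k cdh \<Rightarrow> 'k. functional cdh_scale f}"
    then have g: "functional cdh_scale g" by simp
    show "functional (scl kk) (\<lambda>a. tsum (sweedler (scl kk) cdh_scale (rho3 a)) (\<lambda>v w. f v * g w))"
      using f linear_compose'[OF linear_coord(1) g] linear_compose'[OF linear_coord(2) g]
      by (auto simp: sweedler_rho3_coord[OF g])
  qed
  fix a b :: "'k \<times> 'k"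
  let ?sw = "\<lambda>a. sweedler (scl kk) cdh_scale (rho3 (a :: 'k \<times> 'k))"
  have "tens (scl kk) cdh_scale (?sw (mul kk a b)) =
      tens (scl kk) cdh_scale [(mul kk x y, g * h). (x, g) \<leftarrow> ?sw a, (y, h) \<leftarrow> ?sw b]"
  proof (rule tens_eqI[OF sep])
    fix f g assume f: "f \<in> {fst, snd :: 'k \<times> 'k \<Rightarrow> 'k}" and "g \<in> {f :: 'k cdh \<Rightarrow> 'k. functional cdh_scale f}"
    then have g: "functional cdh_scale g" by simp
    show "tsum (?sw (mul kk a b)) (\<lambda>v w. f v * g w) =
        tsum [(mul kk x y, g * h). (x, g) \<leftarrow> ?sw a, (y, h) \<leftarrow> ?sw b] (\<lambda>v w. f v * g w)"
      using f
      by (elim insertE emptyE) (simp_all only: tsum_concat tsum_map kk_simps mult.assoc[where 'a = 'k] tsum_mult(1)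
          sweedler_rho3_coord[OF g] sweedler_rho3_coord[OF cdh_linear_times(1)[OF g]]
          sweedler_rho3_coord[OF cdh_linear_times(2)[OF g]] coord_mul)
  qed
  then show "rho3 (mul kk a b) =
      tens (scl kk) cdh_scale [(mul kk x y, g * h). (x, g) \<leftarrow> ?sw a, (y, h) \<leftarrow> ?sw b]"
    by (simp only: rho3_tens)
  show "tens3 (scl kk) cdh_scale cdh_scale [(y, g, h). (x, h) \<leftarrow> ?sw a, (y, g) \<leftarrow> ?sw x] =
      tens3 (scl kk) cdh_scale cdh_scale [(x, g, g'). (x, h) \<leftarrow> ?sw a, (g, g') \<leftarrow> sw cdh_hopf h]"
  proof (rule tens3_eqI[OF sep(1,2,2)])
    fix f u w assume f: "f \<in> {fst, snd :: 'k \<times> 'k \<Rightarrow> 'k}" and "u \<in> {f :: 'k cdh \<Rightarrow> 'k. functional cdh_scale f}"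
      and "w \<in> {f :: 'k cdh \<Rightarrow> 'k. functional cdh_scale f}"
    then have u: "functional cdh_scale u" and w: "functional cdh_scale w" by simp_all
    note lin = linearD(1,2)[OF u] linearD(1,2)[OF w] linearD(1,2)[OF convolution_cdh_functional[OF u w]]
    obtain a1 a2 where a: "a = (a1, a2)" by (cases a)
    have right: "tsum3 [(x, g, g'). (x, h) \<leftarrow> ?sw a, (g, g') \<leftarrow> sw cdh_hopf h] (\<lambda>x y z. f x * u y * w z) =
        tsum (?sw a) (\<lambda>x h. f x * convolution cdh_hopf u w h)"
      by (simp only: tsum3_concat tsum3_map convolution_tsum tsum_mult(1)[symmetric] mult.assoc)
    have left: "tsum3 [(y, g, h). (x, h) \<leftarrow> ?sw a, (y, g) \<leftarrow> ?sw x] (\<lambda>x y z. f x * u y * w z) =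
        tsum (?sw a) (\<lambda>x h. tsum (?sw x) (\<lambda>y g. f y * u g) * w h)"
      by (simp only: tsum3_concat tsum3_map tsum_mult(2))
    show "tsum3 [(y, g, h). (x, h) \<leftarrow> ?sw a, (y, g) \<leftarrow> ?sw x] (\<lambda>x y z. f x * u y * w z) =
        tsum3 [(x, g, g'). (x, h) \<leftarrow> ?sw a, (g, g') \<leftarrow> sw cdh_hopf h] (\<lambda>x y z. f x * u y * w z)"
      unfolding right left using f
    proof (elim insertE emptyE)
      assume f: "f = fst"
      show "tsum (?sw a) (\<lambda>x h. tsum (?sw x) (\<lambda>y g. f y * u g) * w h) = tsum (?sw a) (\<lambda>x h. f x * convolution cdh_hopf u w h)"
        unfolding f sweedler_rho3_coord(1)[OF u] sweedler_rho3_coord(1)[OF convolution_cdh_functional[OF u w]]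
          a sweedler_rho3[OF bilinear_product[OF linear_compose'[OF linear_coord(1) u] w]]
        by (simp only: coord1_def fst_conv snd_conv lin convolution_cdh(1)[OF u w] convolution_cdh_gen[OF u w]) algebra
    next
      assume f: "f = snd"
      show "tsum (?sw a) (\<lambda>x h. tsum (?sw x) (\<lambda>y g. f y * u g) * w h) = tsum (?sw a) (\<lambda>x h. f x * convolution cdh_hopf u w h)"
        unfolding f sweedler_rho3_coord(2)[OF u] sweedler_rho3_coord(2)[OF convolution_cdh_functional[OF u w]]
          a sweedler_rho3[OF bilinear_product[OF linear_compose'[OF linear_coord(2) u] w]]
        by (simp only: coord2_def fst_conv snd_conv lin convolution_cdh(1)[OF u w] convolution_cdh_gen[OF u w]) algebra
    qed
  qed
  show "tsum (?sw a) (\<lambda>x h. scl kk (counit cdh_hopf h) x) = a"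
    using sweedler_rho3_coord[OF counit_cdh_functional, of a]
    by (intro prod_eqI) (simp_all add: tsum_pair mult.commute coord1_def coord2_def counit_cdh counit_cdh_gen)
  have "tens (scl kk) cdh_scale (?sw (unt kk)) = tens (scl kk) cdh_scale [(unt kk, 1 :: 'k cdh)]"
  proof (rule tens_eqI[OF sep])
    fix f g assume f: "f \<in> {fst, snd :: 'k \<times> 'k \<Rightarrow> 'k}" and "g \<in> {f :: 'k cdh \<Rightarrow> 'k. functional cdh_scale f}"
    then have g: "functional cdh_scale g" by simp
    show "tsum (?sw (unt kk)) (\<lambda>v w. f v * g w) = tsum [(unt kk, 1)] (\<lambda>v w. f v * g w)"
      using f by (elim insertE emptyE) (simp_all add: sweedler_rho3_coord[OF g] coord1_def coord2_def linearD(1,2)[OF g])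
  qed
  then show "rho3 (unt kk) = tens (scl kk) cdh_scale [(unt kk, 1 :: 'k cdh)]" by (simp only: rho3_tens)
qed

lemma rho3_e: "rho3 (1, 0) = tens (scl kk) cdh_scale [((1, 1), h_bar), ((1, 0), c_bar)]"
proof -
  have "tens (scl kk) cdh_scale (sweedler (scl kk) cdh_scale (rho3 (1, 0))) =
      tens (scl kk) cdh_scale [((1, 1), h_bar), ((1, 0), c_bar :: 'a cdh)]"
  proof (rule tens_eqI[OF point_separating_kk point_separating_dual[OF vector_space_cdh_scale]])
    fix f g assume f: "f \<in> {fst, snd :: 'a \<times> 'a \<Rightarrow> 'a}" and "g \<in> {f :: 'a cdh \<Rightarrow> 'a. functional cdh_scale f}"
    then have g: "functional cdh_scale g" by simp
    show "tsum (sweedler (scl kk) cdh_scale (rho3 (1, 0))) (\<lambda>v w. f v * g w) =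
        tsum [((1, 1), h_bar), ((1, 0), c_bar)] (\<lambda>v w. f v * g w)"
      using f by (elim insertE emptyE) (simp_all add: sweedler_rho3_coord[OF g] coord1_def coord2_def linearD(1,2)[OF g])
  qed
  then show ?thesis by (simp only: rho3_tens)
qed

text \<open>
  The matrices \<open>c \<mapsto> (1, x; 0, -1)\<close>, \<open>h \<mapsto> (0, y; 0, 1)\<close> satisfy the relations for all \<open>x\<close>, \<open>y\<close>;
  linear combinations of the coefficients in the first row take arbitrary values at \<open>1\<close>, \<open>h\<close> and \<open>c\<close>,
  over every field.
\<close>

lemma cdh_dual_interpolation:
  obtains f :: "'k::field cdh_dual" where
    "Rep_cdh_dual f 1 = \<alpha>" "Rep_cdh_dual f h_bar = \<beta>" "Rep_cdh_dual f c_bar = \<gamma>"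
proof -
  define \<delta> where "\<delta> = \<gamma> - \<alpha>"
  define op where "op g m = (case g of Gen_c \<Rightarrow> (fst m, \<delta> * fst m - snd m)
    | Gen_d \<Rightarrow> (fst m, \<delta> * fst m - snd m) | Gen_h \<Rightarrow> (0, \<beta> * fst m + snd m))" for g and m :: "'k \<times> 'k"
  interpret cdh_module "scl kk" UNIV op
  proof (rule cdh_module.intro)
    fix m n :: "'k \<times> 'k" and g and r :: 'k
    have comp: "fst (op g m) = (if g = Gen_h then 0 else fst m)"
      "snd (op g m) = (if g = Gen_h then \<beta> * fst m + snd m else \<delta> * fst m - snd m)" for g m
      by (cases g; simp add: op_def)+
    show "op g (m + n) = op g m + op g n"
      by (rule prod_eqI) (simp_all add: comp distrib_left)
    show "op g (scl kk r m) = scl kk r (op g m)"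
      by (rule prod_eqI) (simp_all add: comp distrib_left right_diff_distrib mult.left_commute)
    show "op Gen_d (op Gen_c m) = m" "op Gen_c (op Gen_d m) = m" "op Gen_h (op Gen_h m) = op Gen_h m"
      "op Gen_c (op Gen_h m) + op Gen_h (op Gen_c m) + op Gen_c (op Gen_c m) = op Gen_c m"
      by (rule prod_eqI; simp add: comp)+
  qed (rule vector_space_kk subspace_UNIV[OF vector_space_kk] UNIV_I)+
  define L where "L m = \<alpha> * fst m + snd m" for m :: "'k \<times> 'k"
  have L: "functional (scl kk) L"
    by (rule linear_mapI[OF vector_space_kk vector_space_mult]) (simp_all add: L_def distrib_left mult.left_commute)
  define f where "f x = L (act (1, 0) x)" for x
  have lin: "functional cdh_scale (\<lambda>x. g (act m x))" if "functional (scl kk) g" for g m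
    by (rule linear_compose'[OF act_linear that]) simp
  have split: "f (x * y) = fst (act (1, 0) x) * L (act (1, 0) y) + snd (act (1, 0) x) * L (act (0, 1) y)" for x y
  proof -
    have "Vector_Spaces.linear (scl kk) (*) (\<lambda>m. L (act m y))"
    proof (rule linear_mapI[OF vector_space_kk vector_space_mult])
      show "L (act (m + n) y) = L (act m y) + L (act n y)" for m n
        by (simp add: act_def free_act_add linearD(1)[OF L])
      show "L (act (scl kk r m) y) = r * L (act m y)" for r m
        by (simp add: act_def free_act_scale linearD(2)[OF L])
    qed
    note lin = linearD(1,2)[OF this]
    have expand: "L (act m y) = fst m * L (act (1, 0) y) + snd m * L (act (0, 1) y)" for m
    proof -
      have m: "m = scl kk (fst m) (1, 0) + scl kk (snd m) (0, 1)" by (simp add: prod_eq_iff)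
      show ?thesis by (subst m) (simp only: lin)
    qed
    show ?thesis unfolding f_def by (simp only: act_times[OF UNIV_I] expand[of "act (1, 0) x"])
  qed
  have "f \<in> finite_dual cdh_hopf"
  proof (rule finite_dualI[OF algebra_cdh])
    show "functional (scl cdh_hopf) f" using lin[OF L] by (simp add: f_def[abs_def])
    let ?xs = "[(\<lambda>x. fst (act (1, 0) x), \<lambda>y. L (act (1, 0) y)),
        (\<lambda>x. snd (act (1, 0) x), \<lambda>y. L (act (0, 1) y))]"
    show "functional (scl cdh_hopf) q" if "(p, q) \<in> set ?xs" for p q
      using that lin[OF L] by auto
    show "f (mul cdh_hopf x y) = tsum ?xs (\<lambda>p q. p x * q y)" for x y
      by (simp add: split)
  qed
  then have "Rep_cdh_dual (Abs_cdh_dual f) = f" by (rule Abs_cdh_dual_inverse)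
  then show thesis
    using that[of "Abs_cdh_dual f"] by (simp add: f_def L_def act_one act_gen op_def \<delta>_def)
qed

lemma kk_decomp: "a = scl kk (snd a) (1, 1) + scl kk (fst a - snd a) (1, 0)"
  by (simp add: prod_eq_iff)

lemma kk_linear_eqI:
  assumes T: "Vector_Spaces.linear (scl kk) (scl kk) T" and S: "Vector_Spaces.linear (scl kk) (scl kk) S"
    and "T (1, 1) = S (1, 1)" "T (1, 0) = S (1, 0)"
  shows "T = S"
proof
  fix a
  show "T a = S a"
    by (subst (1 2) kk_decomp) (simp only: linearD(1,2)[OF T] linearD(1,2)[OF S] assms(3,4))
qed

lemma psi3_basis:
  "psi3 f (1, 1) = scl kk (Rep_cdh_dual f 1) (1, 1)"
  "psi3 f (1, 0) = scl kk (Rep_cdh_dual f h_bar) (1, 1) + scl kk (Rep_cdh_dual f c_bar) (1, 0)"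
  by (simp_all add: psi3_coord coord1_def coord2_def linearD(1,2)[OF Rep_cdh_dual_functional] prod_eq_iff)

lemma linear_psi3: "Vector_Spaces.linear (scl kk) (scl kk) (psi3 f)"
  using unital_hopf_action_psi3 unfolding unital_hopf_action_def hopf_action_def by blast

lemma cosupp_psi3: "cosupp (psi3 :: 'k::field cdh_dual \<Rightarrow> _) =
  {T \<in> lin_End kk. \<exists>\<alpha> \<beta> \<gamma>. has_matrix kk ((1, 1), (1, 0)) T ((\<alpha>, \<beta>), (0, \<gamma>))}" (is "?L = ?R")
proof
  show "?L \<subseteq> ?R"
    by (auto simp: cosupp_def lin_End_def linear_psi3 has_matrix_def psi3_basis)
  show "?R \<subseteq> ?L"
  proof
    fix T :: "'k \<times> 'k \<Rightarrow> 'k \<times> 'k" assume "T \<in> ?R"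
    then obtain \<alpha> \<beta> \<gamma> where T: "Vector_Spaces.linear (scl kk) (scl kk) T"
      "has_matrix kk ((1, 1), (1, 0)) T ((\<alpha>, \<beta>), (0, \<gamma>))" by (auto simp: lin_End_def)
    obtain f :: "'k cdh_dual" where "Rep_cdh_dual f 1 = \<alpha>" "Rep_cdh_dual f h_bar = \<beta>" "Rep_cdh_dual f c_bar = \<gamma>"
      by (rule cdh_dual_interpolation)
    then have "T = psi3 f"
      using T(2) by (intro kk_linear_eqI[OF T(1) linear_psi3]) (simp_all add: psi3_basis has_matrix_def)
    then show "T \<in> ?L" by (auto simp: cosupp_def)
  qed
qed

section \<open>Cosupports and their dimensions\<close>

lemma vector_space_op_scale:
  assumes "vector_space (scl A)"
  shows "vector_space (op_scale A)"
  by (rule vector_space.intro) (simp_all only: fun_eq_iff op_scale_def plus_fun_apply vector_spaceD[OF assms] simp_thms)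

lemma hopf_actionD:
  assumes "hopf_action H A \<psi>"
  shows "hopf_algebra H" "algebra A" "Vector_Spaces.linear (scl A) (scl A) (\<psi> h)"
    "Vector_Spaces.linear (scl H) (scl A) (\<lambda>h. \<psi> h a)" "\<psi> (unt H) a = a" "\<psi> (mul H g h) a = \<psi> g (\<psi> h a)"
    "\<psi> h (mul A a b) = tsum (sw H h) (\<lambda>x y. mul A (\<psi> x a) (\<psi> y b))"
  using assms unfolding hopf_action_def tsum_def by blast+

lemma unital_subalgebra_cosupp:
  assumes "hopf_action H A \<psi>"
  shows "unital_subalgebra_End A (cosupp \<psi>)"
proof -
  note ad = hopf_actionD[OF assms]
  interpret vector_space "op_scale A" by (rule vector_space_op_scale[OF algebraD(1)[OF ad(2)]])
  have zero: "\<psi> 0 = 0" by (rule ext) (simp add: linearD(3)[OF ad(4)])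
  have add: "\<psi> (g + h) = \<psi> g + \<psi> h" for g h by (rule ext) (simp add: linearD(1)[OF ad(4)])
  have scale: "\<psi> (scl H c h) = op_scale A c (\<psi> h)" for c h
    by (rule ext) (simp add: linearD(2)[OF ad(4)] op_scale_def)
  have unit: "\<psi> (unt H) = id" by (rule ext) (simp add: ad(5))
  have comp: "\<psi> (mul H g h) = \<psi> g \<circ> \<psi> h" for g h by (rule ext) (simp add: ad(6))
  have mem: "\<psi> h \<in> cosupp \<psi>" for h by (auto simp: cosupp_def)
  have "subspace (cosupp \<psi>)"
  proof (rule subspaceI)
    show "0 \<in> cosupp \<psi>" using mem[of 0] by (simp only: zero)
    show "S + T \<in> cosupp \<psi>" if "S \<in> cosupp \<psi>" "T \<in> cosupp \<psi>" for S T
      using that unfolding cosupp_def by (auto simp: add[symmetric])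
    show "op_scale A c T \<in> cosupp \<psi>" if "T \<in> cosupp \<psi>" for c T
      using that unfolding cosupp_def by (auto simp: scale[symmetric])
  qed
  moreover have "cosupp \<psi> \<subseteq> lin_End A" using ad(3) by (auto simp: cosupp_def lin_End_def)
  moreover have "id \<in> cosupp \<psi>" using mem[of "unt H"] by (simp only: unit)
  moreover have "S \<circ> T \<in> cosupp \<psi>" if "S \<in> cosupp \<psi>" "T \<in> cosupp \<psi>" for S T
    using that unfolding cosupp_def by (auto simp: comp[symmetric])
  ultimately show ?thesis by (simp add: unital_subalgebra_End_def)
qed

text \<open>A vector in the span of the others would be killed by every functional that kills the others.\<close>

lemma independent_by_functionals:
  assumes "vector_space s"
    and "\<And>v. v \<in> B \<Longrightarrow> \<exists>f. functional s f \<and> f v \<noteq> 0 \<and> (\<forall>w\<in>B - {v}. f w = 0)"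
  shows "\<not> module.dependent s B"
proof -
  interpret vector_space s by fact
  show ?thesis
  proof
    assume "dependent B"
    then obtain v where v: "v \<in> B" "v \<in> span (B - {v})" by (auto simp: dependent_def)
    obtain f where f: "functional s f" "f v \<noteq> 0" "\<forall>w\<in>B - {v}. f w = 0" using assms(2)[OF v(1)] by blast
    have "f v = 0" using v(2)
    proof (induction rule: span_induct_alt)
      case base
      then show ?case by (simp add: linearD(3)[OF f(1)])
    next
      case (step c x y)
      then show ?case using f(3) by (simp add: linearD(1,2)[OF f(1)])
    qed
    then show False using f(2) by simp
  qed
qed

lemma op_functionals: "functional (op_scale kk) (\<lambda>T. fst (T a))" "functional (op_scale kk) (\<lambda>T. snd (T a))"
  "functional (op_scale kk) (\<lambda>T. fst (T a) - snd (T a))"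
  by (rule linear_mapI[OF vector_space_op_scale[OF vector_space_kk] vector_space_mult];
      simp add: op_scale_def right_diff_distrib)+

lemma dim_by_functionals:
  fixes V :: "('k::field \<times> 'k \<Rightarrow> 'k \<times> 'k) set"
  assumes "B \<subseteq> V" "V \<subseteq> module.span (op_scale kk) B" "card B = n"
    and "\<And>v. v \<in> B \<Longrightarrow> \<exists>f. functional (op_scale kk) f \<and> f v \<noteq> 0 \<and> (\<forall>w\<in>B - {v}. f w = 0)"
  shows "vector_space.dim (op_scale kk) V = n"
proof -
  interpret vector_space "op_scale kk :: 'k \<Rightarrow> _" by (rule vector_space_op_scale[OF vector_space_kk])
  show ?thesis
    using assms(1-3) independent_by_functionals[OF vector_space_op_scale[OF vector_space_kk] assms(4)]
    by (intro dim_unique)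
qed

lemma in_span_op:
  fixes B :: "('k::field \<times> 'k \<Rightarrow> 'k \<times> 'k) set"
  shows "T \<in> B \<Longrightarrow> op_scale kk c T \<in> module.span (op_scale kk) B"
    "S \<in> module.span (op_scale kk) B \<Longrightarrow> T \<in> module.span (op_scale kk) B \<Longrightarrow> S + T \<in> module.span (op_scale kk) B"
proof -
  interpret vector_space "op_scale kk :: 'k \<Rightarrow> _" by (rule vector_space_op_scale[OF vector_space_kk])
  show "T \<in> B \<Longrightarrow> op_scale kk c T \<in> span B" "S \<in> span B \<Longrightarrow> T \<in> span B \<Longrightarrow> S + T \<in> span B"
    by (auto intro: span_scale span_base span_add)
qed

lemma op_eqI: "(\<And>a. fst (S a) = fst (T a)) \<Longrightarrow> (\<And>a. snd (S a) = snd (T a)) \<Longrightarrow> S = T"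
  by (rule ext) (simp add: prod_eq_iff)

lemma dim_upper_triangular:
  "vector_space.dim (op_scale kk)
    {T \<in> lin_End (kk :: ('k::field, 'k \<times> 'k) alg). \<exists>\<alpha> \<beta> \<gamma>. has_matrix kk ((1, 1), (1, 0)) T ((\<alpha>, \<beta>), (0, \<gamma>))} = 3"
proof -
  define E1 E2 E3 :: "'k \<times> 'k \<Rightarrow> 'k \<times> 'k" where
    E: "E1 = (\<lambda>a. (snd a, snd a))" "E2 = (\<lambda>a. (fst a - snd a, fst a - snd a))" "E3 = (\<lambda>a. (fst a - snd a, 0))"
  have neq: "E1 \<noteq> E2" "E1 \<noteq> E3" "E2 \<noteq> E3"
    by (auto simp: E fun_eq_iff) (metis zero_neq_one)+
  have lin: "Vector_Spaces.linear (scl kk) (scl kk) E1" "Vector_Spaces.linear (scl kk) (scl kk) E2"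
    "Vector_Spaces.linear (scl kk) (scl kk) E3"
    by (rule linear_mapI[OF vector_space_kk vector_space_kk]; simp add: E prod_eq_iff right_diff_distrib)+
  show ?thesis
  proof (rule dim_by_functionals[where B = "{E1, E2, E3}"])
    have "has_matrix kk ((1, 1), (1, 0)) E1 ((1, 0), (0, 0))" "has_matrix kk ((1, 1), (1, 0)) E2 ((0, 1), (0, 0))"
      "has_matrix kk ((1, 1), (1, 0)) E3 ((0, 0), (0, 1))"
      by (simp_all add: has_matrix_def E prod_eq_iff)
    then show "{E1, E2, E3} \<subseteq> {T \<in> lin_End kk. \<exists>\<alpha> \<beta> \<gamma>. has_matrix kk ((1, 1), (1, 0)) T ((\<alpha>, \<beta>), (0, \<gamma>))}"
      using lin by (auto simp: lin_End_def)
    show "card {E1, E2, E3} = 3" using neq by simp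
    show "{T \<in> lin_End kk. \<exists>\<alpha> \<beta> \<gamma>. has_matrix kk ((1, 1), (1, 0)) T ((\<alpha>, \<beta>), (0, \<gamma>))} \<subseteq>
        module.span (op_scale kk) {E1, E2, E3}"
    proof
      fix T :: "'k \<times> 'k \<Rightarrow> 'k \<times> 'k"
      assume "T \<in> {T \<in> lin_End kk. \<exists>\<alpha> \<beta> \<gamma>. has_matrix kk ((1, 1), (1, 0)) T ((\<alpha>, \<beta>), (0, \<gamma>))}"
      then obtain \<alpha> \<beta> \<gamma> where T: "Vector_Spaces.linear (scl kk) (scl kk) T"
        "has_matrix kk ((1, 1), (1, 0)) T ((\<alpha>, \<beta>), (0, \<gamma>))" by (auto simp: lin_End_def)
      have "T = op_scale kk \<alpha> E1 + op_scale kk \<beta> E2 + op_scale kk \<gamma> E3"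
      proof (rule kk_linear_eqI[OF T(1)])
        show "Vector_Spaces.linear (scl kk) (scl kk) (op_scale kk \<alpha> E1 + op_scale kk \<beta> E2 + op_scale kk \<gamma> E3)"
          by (simp only: plus_fun_def op_scale_def) (intro linear_plus linear_scaled lin)
      qed (use T(2) in \<open>simp_all add: has_matrix_def op_scale_def E prod_eq_iff\<close>)
      then show "T \<in> module.span (op_scale kk) {E1, E2, E3}" by (simp add: in_span_op)
    qed
    fix v assume "v \<in> {E1, E2, E3}"
    then consider "v = E1" | "v = E2" | "v = E3" by blast
    then show "\<exists>f. functional (op_scale kk) f \<and> f v \<noteq> 0 \<and> (\<forall>w\<in>{E1, E2, E3} - {v}. f w = 0)"
    proof cases
      case 1
      then show ?thesis by (intro exI[of _ "\<lambda>T. fst (T (1, 1))"]) (simp add: op_functionals, auto simp: E)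
    next
      case 2
      then show ?thesis by (intro exI[of _ "\<lambda>T. snd (T (1, 0))"]) (simp add: op_functionals, auto simp: E)
    next
      case 3
      then show ?thesis
        by (intro exI[of _ "\<lambda>T. fst (T (1, 0)) - snd (T (1, 0))"]) (simp add: op_functionals, auto simp: E)
    qed
  qed
qed

section \<open>The action of the ground field\<close>

lemma field_hopf_simps [simp]:
  "scl field_hopf = (*)" "mul field_hopf = (*)" "unt field_hopf = 1" "counit field_hopf = id"
  "antipode field_hopf = id" "comul field_hopf x = tens (*) (*) [(x, 1)]"
  by (simp_all add: field_hopf_def)

lemma sw_field:
  assumes "bilinear_map (*) (*) r B"
  shows "tsum (sw field_hopf x) B = B x 1"
  using tsum_sweedler_tens[OF assms, of "[(x, 1)]"] by (simp add: sw_def)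

lemma functional_id: "functional (*) (\<lambda>x. x)"
  by (rule linear_mapI) (simp_all add: vector_space_mult)

lemma hopf_algebra_field: "hopf_algebra (field_hopf :: ('k::field, 'k) hopf)"
proof -
  have bil: "bilinear_map (*) (*) (*) (\<lambda>a b :: 'k. a * b)"
    by (rule bilinear_product[OF functional_id functional_id])
  have conv: "convolution field_hopf (\<lambda>x. x) (\<lambda>x. x) = (\<lambda>x :: 'k. x)"
    by (rule ext) (simp add: convolution_tsum sw_field[OF bil])
  have bil': "bilinear_map (*) (*) (*) (\<lambda>a' b' :: 'k. a * a' * (b * b'))" for a b
    by (intro bilinear_product functional_mult_left functional_id)
  have bil'': "bilinear_map (*) (*) (*) (\<lambda>a b :: 'k. a * y * b)" for y
    by (intro bilinear_product functional_mult_right functional_id)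
  have mult: "tsum (sw field_hopf x) (\<lambda>a b. tsum (sw field_hopf y) (\<lambda>a' b'. a * a' * (b * b'))) = x * y" for x y :: 'k
    by (simp only: sw_field[OF bil'] mult_1_right sw_field[OF bil''])
  show ?thesis
  proof (rule hopf_algebraI[where F = "{\<lambda>x. x}"])
    show "convolution field_hopf f g (mul field_hopf x y) = tsum (sw field_hopf x) (\<lambda>a b.
        tsum (sw field_hopf y) (\<lambda>a' b'. f (mul field_hopf a a') * g (mul field_hopf b b')))"
      if fg: "f \<in> {\<lambda>x. x}" "g \<in> {\<lambda>x. x}" for f g and x y :: 'k
    proof -
      have "f = (\<lambda>x. x)" "g = (\<lambda>x. x)" using fg by simp_all
      then show ?thesis by (simp only: field_hopf_simps conv mult)
    qed
    show "algebra (field_hopf :: ('k, 'k) hopf)"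
      unfolding algebra_def field_hopf_simps
      by (intro conjI allI linear_mapI vector_space_mult) (simp_all add: distrib_left distrib_right)
    show "point_separating (scl field_hopf) {\<lambda>x :: 'k. x}"
      by (simp add: point_separating_def vector_space_mult functional_id)
    show "Vector_Spaces.linear (scl field_hopf) (scl field_hopf) (antipode (field_hopf :: ('k, 'k) hopf))"
      by (simp add: id_def functional_id)
    show "algebra_hom (field_hopf :: ('k, 'k) hopf) field_alg (counit field_hopf)"
      by (simp add: algebra_hom_field_alg_iff id_def functional_id)
  qed (simp_all add: conv id_def convolution_tsum sw_field[OF bil] sw_field[OF bil'] sw_field[OF bil''] functional_id)
qed

lemma cosupp_psi1: "cosupp (psi1 :: 'k::field \<Rightarrow> _) = {\<lambda>a. scl kk \<alpha> a | \<alpha>. True}"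
  by (auto simp: cosupp_def psi1_def[abs_def])

lemma unital_hopf_action_psi1: "unital_hopf_action field_hopf kk (psi1 :: 'k::field \<Rightarrow> _)"
  unfolding unital_hopf_action_def hopf_action_def tsum_def[symmetric]
proof (intro conjI allI hopf_algebra_field algebra_kk)
  fix g h :: 'k and a b :: "'k \<times> 'k"
  show "Vector_Spaces.linear (scl kk) (scl kk) (psi1 h)"
    by (rule linear_mapI[OF vector_space_kk vector_space_kk]) (simp_all add: psi1_def prod_eq_iff distrib_left mult.left_commute)
  show "Vector_Spaces.linear (scl field_hopf) (scl kk) (\<lambda>h. psi1 h a)"
    by (simp, rule linear_mapI[OF vector_space_mult vector_space_kk]) (simp_all add: psi1_def prod_eq_iff distrib_right)
  show "psi1 (unt field_hopf) a = a" "psi1 (mul field_hopf g h) a = psi1 g (psi1 h a)"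
    "psi1 h (unt kk) = scl kk (counit field_hopf h) (unt kk)"
    by (simp_all add: psi1_def prod_eq_iff)
  have "bilinear_map (*) (*) (*) (\<lambda>x y :: 'k. x * u * (y * v))" for u v
    by (intro bilinear_product functional_mult_right functional_id)
  note sw = sw_field[OF this]
  show "psi1 h (mul kk a b) = tsum (sw field_hopf h) (\<lambda>x y. mul kk (psi1 x a) (psi1 y b))"
    by (rule prod_eqI) (simp_all only: tsum_pair psi1_def kk_simps sw mult_1_left, simp_all only: mult.assoc)
qed

lemma dim_cosupp_psi1: "vector_space.dim (op_scale kk) (cosupp (psi1 :: 'k::field \<Rightarrow> _)) = 1"
proof (rule dim_by_functionals[where B = "{id}"])
  have "id = (\<lambda>a :: 'k \<times> 'k. scl kk 1 a)" by (simp add: fun_eq_iff prod_eq_iff)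
  then show "{id} \<subseteq> cosupp (psi1 :: 'k \<Rightarrow> _)" unfolding cosupp_psi1 by blast
  show "cosupp (psi1 :: 'k \<Rightarrow> _) \<subseteq> module.span (op_scale kk) {id}"
    unfolding cosupp_psi1 using in_span_op(1)[of id "{id}"] by (auto simp: op_scale_def)
  show "\<exists>f. functional (op_scale kk) f \<and> f v \<noteq> 0 \<and> (\<forall>w\<in>{id} - {v}. f w = 0)" if "v \<in> {id}"
    for v :: "'k \<times> 'k \<Rightarrow> 'k \<times> 'k"
    using that by (intro exI[of _ "\<lambda>T. fst (T (1, 1))"]) (simp add: op_functionals)
qed simp

section \<open>Group algebras and the action of the group of order two\<close>

lemma group_hopf_simps [simp]:
  "scl group_hopf = pm_scale" "mul group_hopf = (*)" "unt group_hopf = 1"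
  by (simp_all add: group_hopf_def)

lemma algebra_group: "algebra (group_hopf :: ('k::field, 'g::group_add \<Rightarrow>\<^sub>0 'k) hopf)"
  unfolding algebra_def group_hopf_simps
  by (intro conjI allI linear_mapI vector_space_pm_scale)
    (simp_all add: distrib_left distrib_right pm_scale_mult mult.assoc vector_space_pm_scale)

lemma sw_group:
  assumes "bilinear_map pm_scale pm_scale r B"
  shows "tsum (sw group_hopf x) B = lin_ext r (\<lambda>g. B (Poly_Mapping.single g 1) (Poly_Mapping.single g 1)) x"
proof -
  have r: "vector_space r" by (rule bilinear_mapD[OF assms])
  have "tsum (sw group_hopf x) B = lin_ext r (\<lambda>(v, w). B v w) (lin_ext pm_scale
      (\<lambda>g. Poly_Mapping.single (Poly_Mapping.single g 1, Poly_Mapping.single g 1) 1) x)"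
    unfolding sw_def by (simp add: group_hopf_def tsum_sweedler_class[OF assms])
  also have "\<dots> = lin_ext r (\<lambda>g. B (Poly_Mapping.single g 1) (Poly_Mapping.single g 1)) x"
    by (subst lin_ext_compose[OF linear_lin_ext[OF r]])
      (simp add: lin_ext_single[OF r] vector_spaceD(4)[OF r])
  finally show ?thesis .
qed

lemma hopf_algebra_group: "hopf_algebra (group_hopf :: ('k::field, 'g::group_add \<Rightarrow>\<^sub>0 'k) hopf)"
proof (rule hopf_algebraI[OF algebra_group])
  let ?H = "group_hopf :: ('k, 'g \<Rightarrow>\<^sub>0 'k) hopf"
  let ?e = "\<lambda>g. Poly_Mapping.single g 1 :: 'g \<Rightarrow>\<^sub>0 'k"
  note lext = lin_ext_single[OF vector_space_mult] linearD(1,2)[OF linear_lin_ext[OF vector_space_mult]]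
  note lext_one = lin_ext_single[OF vector_space_mult, where x = 0 and c = 1, unfolded single_one mult_1_left]
  have conv: "convolution ?H f g = lin_ext (*) (\<lambda>a. f (?e a) * g (?e a))"
    if "functional pm_scale f" "functional pm_scale g" for f g
    by (rule ext) (simp add: convolution_tsum sw_group[OF bilinear_product[OF that]])
  have counit: "counit ?H = lin_ext (*) (\<lambda>g. 1)"
    by (simp add: group_hopf_def fun_eq_iff)
  have antipode: "antipode ?H = lin_ext pm_scale (\<lambda>g. ?e (- g))"
    by (simp add: group_hopf_def fun_eq_iff)
  have antipode_e: "antipode ?H (?e g) = ?e (- g)" for g
    by (simp add: antipode lin_ext_single[OF vector_space_pm_scale] vector_spaceD(4)[OF vector_space_pm_scale])
  have lin_counit: "functional pm_scale (counit ?H)" unfolding counit by (rule linear_lin_ext[OF vector_space_mult])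
  have lin_antipode: "Vector_Spaces.linear pm_scale pm_scale (antipode ?H)"
    unfolding antipode by (rule linear_lin_ext[OF vector_space_pm_scale])
  have single: "Poly_Mapping.single g c = pm_scale c (?e g)" for g c by (simp add: pm_scale_single)
  note mul_lin = algebraD(5,6)[OF algebra_group, unfolded group_hopf_simps]
  show "point_separating (scl ?H) {f. functional pm_scale f}"
    by (simp add: point_separating_dual[OF vector_space_pm_scale])
  show "comul ?H x \<in> tensor_space (scl ?H) (scl ?H)" for x
    by (simp add: group_hopf_def tensor_space_def)
  show "Vector_Spaces.linear (scl ?H) (scl ?H) (antipode ?H)" using lin_antipode by simp
  have counit_mul: "counit ?H (x * y) = counit ?H x * counit ?H y" for x y
  proof (induction x rule: pm_induct)
    case (single g c)
    show ?case
      by (induction y rule: pm_induct) (simp_all add: counit mult_single lext distrib_left)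
  next
    case (add p q)
    then show ?case by (simp add: counit lext distrib_right)
  qed
  have counit_one: "counit ?H 1 = 1"
    unfolding counit by (rule lext_one)
  show "algebra_hom ?H field_alg (counit ?H)"
    by (simp add: algebra_hom_field_alg_iff lin_counit counit_mul counit_one)
  fix f g k :: "('g \<Rightarrow>\<^sub>0 'k) \<Rightarrow> 'k" and x y :: "'g \<Rightarrow>\<^sub>0 'k"
  assume "f \<in> {f. functional pm_scale f}"
  then have f: "functional pm_scale f" by simp
  note f_ext = linear_eq_lin_ext[OF f]
  have counit_e: "counit ?H (?e g) = 1" for g by (simp add: counit lext)
  show "convolution ?H (counit ?H) f x = f x" "convolution ?H f (counit ?H) x = f x"
    by (simp_all add: conv f lin_counit counit_e f_ext[symmetric])
  have bil: "bilinear_map pm_scale pm_scale (*) (\<lambda>a b. f (antipode ?H a * b))"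
    "bilinear_map pm_scale pm_scale (*) (\<lambda>a b. f (a * antipode ?H b))"
    unfolding bilinear_map_def
    by (intro conjI allI linear_compose'[OF mul_lin(1) f] linear_compose'[OF mul_lin(2) f]
        linear_compose'[OF lin_antipode linear_compose'[OF mul_lin(1) f]]
        linear_compose'[OF lin_antipode linear_compose'[OF mul_lin(2) f]])+
  have const: "lin_ext (*) (\<lambda>g. f 1) x = counit ?H x * f 1"
    unfolding counit by (simp add: lin_ext_def sum_distrib_right)
  show "tsum (sw ?H x) (\<lambda>a b. f (mul ?H (antipode ?H a) b)) = counit ?H x * f (unt ?H)"
    using const by (simp add: sw_group[OF bil(1)] antipode_e mult_single)
  show "tsum (sw ?H x) (\<lambda>a b. f (mul ?H a (antipode ?H b))) = counit ?H x * f (unt ?H)"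
    using const by (simp add: sw_group[OF bil(2)] antipode_e mult_single)
  assume "g \<in> {f. functional pm_scale f}"
  then have g: "functional pm_scale g" by simp
  have lin_conv: "functional pm_scale (convolution ?H f g)"
    unfolding conv[OF f g] by (rule linear_lin_ext[OF vector_space_mult])
  then show "functional (scl ?H) (convolution ?H f g)" by simp
  show "convolution ?H f g (unt ?H) = f (unt ?H) * g (unt ?H)"
    unfolding group_hopf_simps conv[OF f g] by (subst lext_one) (simp only: single_one)
  show "convolution ?H f g (mul ?H x y) =
      tsum (sw ?H x) (\<lambda>a b. tsum (sw ?H y) (\<lambda>a' b'. f (mul ?H a a') * g (mul ?H b b')))"
    unfolding group_hopf_simps
  proof (induction y rule: pm_induct)
    case (single h d)
    have bil1: "bilinear_map pm_scale pm_scale (*) (\<lambda>a' b'. f (a * a') * g (b * b'))" for a b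
      by (rule bilinear_product[OF linear_compose'[OF mul_lin(1) f] linear_compose'[OF mul_lin(1) g]])
    have bil2: "bilinear_map pm_scale pm_scale (*) (\<lambda>a b. (d * f (a * ?e h)) * g (b * ?e h))"
      by (rule bilinear_product[OF functional_mult_left[OF linear_compose'[OF mul_lin(2) f]] linear_compose'[OF mul_lin(2) g]])
    have "tsum (sw ?H x) (\<lambda>a b. tsum (sw ?H (Poly_Mapping.single h d)) (\<lambda>a' b'. f (a * a') * g (b * b'))) =
        lin_ext (*) (\<lambda>a. (d * f (?e a * ?e h)) * g (?e a * ?e h)) x"
      by (simp only: sw_group[OF bil1] lext mult.assoc[symmetric] sw_group[OF bil2])
    also have "\<dots> = convolution ?H f g (x * Poly_Mapping.single h d)"
    proof (induction x rule: pm_induct)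
      case (single a c)
      show ?case by (simp add: conv f g lext mult_single)
    next
      case (add p q)
      then show ?case by (simp add: lext distrib_right linearD(1)[OF lin_conv])
    qed
    finally show ?case ..
  next
    case (add p q)
    have bil1: "bilinear_map pm_scale pm_scale (*) (\<lambda>a' b'. f (a * a') * g (b * b'))" for a b
      by (rule bilinear_product[OF linear_compose'[OF mul_lin(1) f] linear_compose'[OF mul_lin(1) g]])
    show ?case
      using add by (simp only: distrib_left linearD(1)[OF lin_conv] sw_group[OF bil1] lext tsum_add)
  qed
  assume "k \<in> {f. functional pm_scale f}"
  then have k: "functional pm_scale k" by simp
  have lin_conv': "functional pm_scale (convolution ?H g k)"
    unfolding conv[OF g k] by (rule linear_lin_ext[OF vector_space_mult])
  show "convolution ?H (convolution ?H f g) k x = convolution ?H f (convolution ?H g k) x"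
  proof -
    have "convolution ?H f g (?e a) = f (?e a) * g (?e a)" "convolution ?H g k (?e a) = g (?e a) * k (?e a)" for a
      by (simp_all add: conv[OF f g] conv[OF g k] lext)
    then show ?thesis by (simp only: conv[OF lin_conv k] conv[OF f lin_conv'] mult.assoc)
  qed
qed

lemma UNIV_bit: "(UNIV :: bit set) = {0, 1}"
proof -
  have "(b :: bit) = 0 \<or> b = 1" for b by (cases b rule: bit.exhaust) auto
  then show ?thesis by auto
qed

lemma psi2_coord:
  "fst (psi2 x a) = Poly_Mapping.lookup x 0 * fst a + Poly_Mapping.lookup x 1 * snd a"
  "snd (psi2 x a) = Poly_Mapping.lookup x 0 * snd a + Poly_Mapping.lookup x 1 * fst a"
proof -
  have "psi2 x a = (\<Sum>g\<in>{0, 1 :: bit}. scl kk (Poly_Mapping.lookup x g) (if g = 0 then a else prod.swap a))"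
    unfolding psi2_def by (rule lin_ext_superset[OF vector_space_kk]) (simp, metis UNIV_bit subset_UNIV)
  then show "fst (psi2 x a) = Poly_Mapping.lookup x 0 * fst a + Poly_Mapping.lookup x 1 * snd a"
    "snd (psi2 x a) = Poly_Mapping.lookup x 0 * snd a + Poly_Mapping.lookup x 1 * fst a"
    by simp_all
qed

lemma lookup_functional: "functional pm_scale (\<lambda>x. Poly_Mapping.lookup x g)"
  by (rule linear_mapI[OF vector_space_pm_scale vector_space_mult]) (simp_all add: lookup_add lookup_pm_scale)

lemma lookup_times_bit:
  fixes x y :: "bit \<Rightarrow>\<^sub>0 'k::field"
  shows "Poly_Mapping.lookup (x * y) 0 = Poly_Mapping.lookup x 0 * Poly_Mapping.lookup y 0 + Poly_Mapping.lookup x 1 * Poly_Mapping.lookup y 1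
    \<and> Poly_Mapping.lookup (x * y) 1 = Poly_Mapping.lookup x 0 * Poly_Mapping.lookup y 1 + Poly_Mapping.lookup x 1 * Poly_Mapping.lookup y 0"
proof (induction x rule: pm_induct)
  case (single g c)
  have bit: "b = 0 \<or> b = 1" for b :: bit using UNIV_bit by blast
  show ?case
  proof (induction y rule: pm_induct)
    case (single h d)
    show ?case using bit[of g] bit[of h] by (auto simp: mult_single lookup_single when_def)
  next
    case (add p q)
    then show ?case by (simp add: distrib_left lookup_add)
  qed
next
  case (add p q)
  then show ?case by (simp add: distrib_right lookup_add)
qed

lemma unital_hopf_action_psi2: "unital_hopf_action group_hopf kk (psi2 :: (bit \<Rightarrow>\<^sub>0 'k::field) \<Rightarrow> _)"
  unfolding unital_hopf_action_def hopf_action_def tsum_def[symmetric]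
proof (intro conjI allI hopf_algebra_group algebra_kk)
  fix g h :: "bit \<Rightarrow>\<^sub>0 'k" and a b :: "'k \<times> 'k"
  let ?l = Poly_Mapping.lookup
  show "Vector_Spaces.linear (scl kk) (scl kk) (psi2 h)"
    by (rule linear_mapI[OF vector_space_kk vector_space_kk]; rule prod_eqI;
        simp only: psi2_coord fst_add snd_add kk_simps; algebra)
  have lin: "Vector_Spaces.linear pm_scale (scl kk) (\<lambda>h. psi2 h a)" for a :: "'k \<times> 'k"
    by (rule linear_mapI[OF vector_space_pm_scale vector_space_kk]; rule prod_eqI;
        simp only: psi2_coord fst_add snd_add kk_simps lookup_add lookup_pm_scale; algebra)
  then show "Vector_Spaces.linear (scl group_hopf) (scl kk) (\<lambda>h. psi2 h a)" by simp
  show "psi2 (unt group_hopf) a = a"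
    by (rule prod_eqI) (simp_all add: psi2_coord lookup_one)
  show "psi2 (mul group_hopf g h) a = psi2 g (psi2 h a)"
    by (rule prod_eqI; simp only: psi2_coord group_hopf_simps lookup_times_bit; algebra)
  have swap: "psi2 (Poly_Mapping.single g 1) a = (if g = 0 then a else prod.swap a)" for g and a :: "'k \<times> 'k"
    unfolding psi2_def by (simp add: lin_ext_single[OF vector_space_kk] vector_spaceD(4)[OF vector_space_kk])
  have grouplike: "psi2 (Poly_Mapping.single g 1) (mul kk a b) =
      mul kk (psi2 (Poly_Mapping.single g 1) a) (psi2 (Poly_Mapping.single g 1) b)" for g
    by (simp add: swap prod_eq_iff)
  have bil: "bilinear_map pm_scale pm_scale (scl kk) (\<lambda>x y. mul kk (psi2 x a) (psi2 y b))"
    unfolding bilinear_map_def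
    by (intro conjI allI linear_compose'[OF lin algebraD(5)[OF algebra_kk]]
        linear_compose'[OF lin algebraD(6)[OF algebra_kk]])
  show "psi2 h (mul kk a b) = tsum (sw group_hopf h) (\<lambda>x y. mul kk (psi2 x a) (psi2 y b))"
    unfolding sw_group[OF bil] grouplike[symmetric] by (rule linear_eq_lin_ext[OF lin])
  have "counit group_hopf h = ?l h 0 + ?l h 1"
  proof -
    have "counit group_hopf h = (\<Sum>g\<in>{0, 1 :: bit}. ?l h g * 1)"
      unfolding group_hopf_def hopf.select_convs
      by (rule lin_ext_superset[OF vector_space_mult]) (simp, metis UNIV_bit subset_UNIV)
    then show ?thesis by simp
  qed
  then show "psi2 h (unt kk) = scl kk (counit group_hopf h) (unt kk)"
    by (intro prod_eqI) (simp_all add: psi2_coord)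
qed

lemma linear_psi2: "Vector_Spaces.linear (scl kk) (scl kk) (psi2 h)"
  using unital_hopf_action_psi2 unfolding unital_hopf_action_def hopf_action_def by blast

lemma psi2_C2_gen: "psi2 C2_gen (\<alpha>, \<beta>) = (\<beta>, \<alpha>)"
  by (simp add: prod_eq_iff psi2_coord C2_gen_def lookup_single)

lemma bit_algebra_element:
  obtains x :: "bit \<Rightarrow>\<^sub>0 'k::field" where "Poly_Mapping.lookup x 0 = \<alpha>" "Poly_Mapping.lookup x 1 = \<beta>"
  using that[of "Poly_Mapping.single 0 \<alpha> + Poly_Mapping.single 1 \<beta>"] by (simp add: lookup_add lookup_single)

lemma cosupp_psi2: "cosupp (psi2 :: (bit \<Rightarrow>\<^sub>0 'k::field) \<Rightarrow> _) = range (\<lambda>(\<alpha>, \<beta>) a. scl kk \<alpha> a + scl kk \<beta> (prod.swap a))"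
proof -
  have "psi2 x = (\<lambda>a. scl kk (Poly_Mapping.lookup x 0) a + scl kk (Poly_Mapping.lookup x 1) (prod.swap a))"
    for x :: "bit \<Rightarrow>\<^sub>0 'k"
    by (rule op_eqI) (simp_all add: psi2_coord)
  moreover have "\<exists>x :: bit \<Rightarrow>\<^sub>0 'k. Poly_Mapping.lookup x 0 = \<alpha> \<and> Poly_Mapping.lookup x 1 = \<beta>" for \<alpha> \<beta> :: 'k
    by (rule bit_algebra_element[of \<alpha> \<beta>]) blast
  ultimately show ?thesis
    unfolding cosupp_def by (auto simp: image_def) metis
qed

lemma cosupp_psi2_matrix: "cosupp (psi2 :: (bit \<Rightarrow>\<^sub>0 'k::field) \<Rightarrow> _) =
  {T \<in> lin_End kk. \<exists>\<alpha> \<beta>. has_matrix kk ((1, 0), (0, 1)) T ((\<alpha>, \<beta>), (\<beta>, \<alpha>))}" (is "?L = ?R")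
proof
  show "?L \<subseteq> ?R"
  proof
    fix T :: "'k \<times> 'k \<Rightarrow> 'k \<times> 'k" assume "T \<in> ?L"
    then obtain x where x: "T = psi2 x" by (auto simp: cosupp_def)
    have "has_matrix kk ((1, 0), (0, 1)) T
      ((Poly_Mapping.lookup x 0, Poly_Mapping.lookup x 1), (Poly_Mapping.lookup x 1, Poly_Mapping.lookup x 0))"
      by (simp add: has_matrix_def prod_eq_iff psi2_coord x)
    then show "T \<in> ?R" using linear_psi2[of x] by (auto simp: lin_End_def x)
  qed
  show "?R \<subseteq> ?L"
  proof
    fix T :: "'k \<times> 'k \<Rightarrow> 'k \<times> 'k" assume "T \<in> ?R"
    then obtain \<alpha> \<beta> where T: "Vector_Spaces.linear (scl kk) (scl kk) T"
      "has_matrix kk ((1, 0), (0, 1)) T ((\<alpha>, \<beta>), (\<beta>, \<alpha>))" by (auto simp: lin_End_def)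
    obtain x :: "bit \<Rightarrow>\<^sub>0 'k" where x: "Poly_Mapping.lookup x 0 = \<alpha>" "Poly_Mapping.lookup x 1 = \<beta>"
      by (rule bit_algebra_element)
    have basis: "T (1, 0) = psi2 x (1, 0)" "T (0, 1) = psi2 x (0, 1)"
      using T(2) by (simp_all add: has_matrix_def prod_eq_iff psi2_coord x)
    have "(1 :: 'k, 1 :: 'k) = (1, 0) + (0, 1)" by simp
    then have "T (1, 1) = psi2 x (1, 1)"
      using basis by (simp only: linearD(1)[OF T(1)] linearD(1)[OF linear_psi2])
    then have "T = psi2 x" using basis by (intro kk_linear_eqI[OF T(1) linear_psi2])
    then show "T \<in> ?L" by (auto simp: cosupp_def)
  qed
qed

lemma dim_cosupp_psi2: "vector_space.dim (op_scale kk) (cosupp (psi2 :: (bit \<Rightarrow>\<^sub>0 'k::field) \<Rightarrow> _)) = 2"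
proof (rule dim_by_functionals[where B = "{\<lambda>a. a, prod.swap}"])
  let ?id = "\<lambda>a :: 'k \<times> 'k. a" and ?swap = "prod.swap :: 'k \<times> 'k \<Rightarrow> _"
  have neq: "?id \<noteq> ?swap"
  proof
    assume "?id = ?swap"
    then have "?id (1, 0) = ?swap (1, 0)" by (rule fun_cong)
    then show False by simp
  qed
  then show "card {?id, ?swap} = 2" by simp
  have "?id = (\<lambda>(\<alpha>, \<beta>) a. scl kk \<alpha> a + scl kk \<beta> (prod.swap a)) (1, 0)"
    "?swap = (\<lambda>(\<alpha>, \<beta>) a. scl kk \<alpha> a + scl kk \<beta> (prod.swap a)) (0, 1)"
    by (rule op_eqI; simp)+
  then show "{?id, ?swap} \<subseteq> cosupp (psi2 :: (bit \<Rightarrow>\<^sub>0 'k) \<Rightarrow> _)" unfolding cosupp_psi2 by blast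
  show "cosupp (psi2 :: (bit \<Rightarrow>\<^sub>0 'k) \<Rightarrow> _) \<subseteq> module.span (op_scale kk) {?id, ?swap}"
  proof
    fix T :: "'k \<times> 'k \<Rightarrow> 'k \<times> 'k" assume "T \<in> cosupp (psi2 :: (bit \<Rightarrow>\<^sub>0 'k) \<Rightarrow> _)"
    then obtain \<alpha> \<beta> where "T = (\<lambda>a. scl kk \<alpha> a + scl kk \<beta> (prod.swap a))" unfolding cosupp_psi2 by auto
    then have "T = op_scale kk \<alpha> ?id + op_scale kk \<beta> ?swap" by (simp add: op_scale_def plus_fun_def)
    then show "T \<in> module.span (op_scale kk) {?id, ?swap}" by (simp add: in_span_op)
  qed
  fix v assume "v \<in> {?id, ?swap}"
  then consider "v = ?id" | "v = ?swap" by blast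
  then show "\<exists>f. functional (op_scale kk) f \<and> f v \<noteq> 0 \<and> (\<forall>w\<in>{?id, ?swap} - {v}. f w = 0)"
  proof cases
    case 1
    then show ?thesis by (intro exI[of _ "\<lambda>T. fst (T (1, 0))"]) (auto simp: op_functionals)
  next
    case 2
    then show ?thesis by (intro exI[of _ "\<lambda>T. snd (T (1, 0))"]) (auto simp: op_functionals)
  qed
qed

section \<open>The action of the Sweedler algebra\<close>

lemma h4_hopf_simps [simp]:
  "scl h4_hopf = h4_scale" "mul h4_hopf = h4_mult" "unt h4_hopf = (1, 0, 0, 0)"
  "counit h4_hopf (x1, xc, xv, xw) = x1 + xc" "antipode h4_hopf (x1, xc, xv, xw) = (x1, xc, xw, - xv)"
  by (simp_all add: h4_hopf_def h4_one_def)

lemma h4_scale_tuple: "h4_scale r (x1, xc, xv, xw) = (r * x1, r * xc, r * xv, r * xw)"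
  by (simp add: h4_scale_def)

lemma h4_mult_tuple: "h4_mult (x1, xc, xv, xw) (y1, yc, yv, yw) =
  (x1 * y1 + xc * yc, x1 * yc + xc * y1, x1 * yv + xv * y1 + xc * yw - xw * yc,
   x1 * yw + xw * y1 + xc * yv - xv * yc)"
  by (simp add: h4_mult_def)

lemmas h4_tuple = h4_scale_tuple h4_mult_tuple plus_prod_def fst_conv snd_conv prod.inject

lemma vector_space_h4: "vector_space (h4_scale :: 'k::field \<Rightarrow> _)"
proof (rule vector_space.intro)
  fix a b :: 'k and x y :: "'k h4"
  obtain x1 xc xv xw y1 yc yv yw where xy: "x = (x1, xc, xv, xw)" "y = (y1, yc, yv, yw)"
    by (cases x rule: prod_cases4; cases y rule: prod_cases4)
  show "h4_scale a (x + y) = h4_scale a x + h4_scale a y"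
    unfolding xy h4_tuple by (intro conjI; algebra)
  show "h4_scale (a + b) x = h4_scale a x + h4_scale b x"
    unfolding xy h4_tuple by (intro conjI; algebra)
  show "h4_scale a (h4_scale b x) = h4_scale (a * b) x"
    unfolding xy h4_tuple by (intro conjI; algebra)
  show "h4_scale 1 x = x"
    unfolding xy h4_tuple by simp
qed

lemma algebra_h4: "algebra (h4_hopf :: ('k::field, 'k h4) hopf)"
  unfolding algebra_def h4_hopf_simps
proof (intro conjI allI vector_space_h4 linear_mapI)
  fix r :: 'k and x y z :: "'k h4"
  obtain x1 xc xv xw y1 yc yv yw z1 zc zv zw where
    xyz: "x = (x1, xc, xv, xw)" "y = (y1, yc, yv, yw)" "z = (z1, zc, zv, zw)"
    by (cases x rule: prod_cases4; cases y rule: prod_cases4; cases z rule: prod_cases4)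
  show "h4_mult x (y + z) = h4_mult x y + h4_mult x z" "h4_mult x (h4_scale r y) = h4_scale r (h4_mult x y)"
    "h4_mult (y + z) x = h4_mult y x + h4_mult z x" "h4_mult (h4_scale r y) x = h4_scale r (h4_mult y x)"
    "h4_mult (h4_mult x y) z = h4_mult x (h4_mult y z)"
    unfolding xyz h4_tuple by (intro conjI; algebra)+
  show "h4_mult (1, 0, 0, 0) x = x" "h4_mult x (1, 0, 0, 0) = x"
    unfolding xyz h4_tuple by simp_all
qed

text \<open>
  A functional on \<open>H\<^sub>4\<close> amounts to four scalars, so the axioms, tested on functionals, become polynomial
  identities in the field.
\<close>

lemma h4_functional:
  fixes f :: "'k::field h4 \<Rightarrow> 'k"
  assumes f: "functional h4_scale f"
  obtains F1 Fc Fv Fw where "\<And>x1 xc xv xw. f (x1, xc, xv, xw) = x1 * F1 + xc * Fc + xv * Fv + xw * Fw"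
proof (rule that)
  fix x1 xc xv xw :: 'k
  have "f (x1, xc, xv, xw) = f (h4_scale x1 (1, 0, 0, 0) + h4_scale xc (0, 1, 0, 0) + h4_scale xv (0, 0, 1, 0) +
      h4_scale xw (0, 0, 0, 1))"
    by (simp add: h4_scale_tuple)
  then show "f (x1, xc, xv, xw) = x1 * f (1, 0, 0, 0) + xc * f (0, 1, 0, 0) + xv * f (0, 0, 1, 0) + xw * f (0, 0, 0, 1)"
    by (simp only: linearD(1,2)[OF f])
qed

lemma sw_h4:
  assumes B: "bilinear_map h4_scale h4_scale r B"
  shows "tsum (sw h4_hopf (x1, xc, xv, xw)) B =
    r x1 (B (1, 0, 0, 0) (1, 0, 0, 0)) + (r xc (B (0, 1, 0, 0) (0, 1, 0, 0)) +
    (r xv (B (0, 1, 0, 0) (0, 0, 1, 0)) + (r xv (B (0, 0, 1, 0) (1, 0, 0, 0)) +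
    (r xw (B (1, 0, 0, 0) (0, 0, 0, 1)) + r xw (B (0, 0, 0, 1) (0, 1, 0, 0))))))"
proof -
  have "comul h4_hopf (x1, xc, xv, xw) = tens h4_scale h4_scale
       [(h4_scale x1 h4_one, h4_one), (h4_scale xc h4_c, h4_c),
        (h4_scale xv h4_c, h4_v), (h4_scale xv h4_v, h4_one),
        (h4_scale xw h4_one, h4_cv), (h4_scale xw h4_cv, h4_c)]"
    by (simp add: h4_hopf_def)
  then have "tsum (sw h4_hopf (x1, xc, xv, xw)) B = tsum
       [(h4_scale x1 h4_one, h4_one), (h4_scale xc h4_c, h4_c),
        (h4_scale xv h4_c, h4_v), (h4_scale xv h4_v, h4_one),
        (h4_scale xw h4_one, h4_cv), (h4_scale xw h4_cv, h4_c)] B"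
    by (simp only: sw_def h4_hopf_simps tsum_sweedler_tens[OF B])
  then show ?thesis
    by (simp only: tsum_simps bilinear_mapD(8)[OF B] h4_one_def h4_c_def h4_v_def h4_relations(4) add_0_right)
qed

lemma hopf_algebra_h4: "hopf_algebra (h4_hopf :: ('k::field, 'k h4) hopf)"
proof (rule hopf_algebraI[OF algebra_h4])
  let ?H = "h4_hopf :: ('k, 'k h4) hopf"
  note mul_lin = algebraD(5,6)[OF algebra_h4, unfolded h4_hopf_simps]
  have conv: "convolution ?H f g (x1, xc, xv, xw) =
      x1 * (f (1, 0, 0, 0) * g (1, 0, 0, 0)) + (xc * (f (0, 1, 0, 0) * g (0, 1, 0, 0)) +
      (xv * (f (0, 1, 0, 0) * g (0, 0, 1, 0)) + (xv * (f (0, 0, 1, 0) * g (1, 0, 0, 0)) +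
      (xw * (f (1, 0, 0, 0) * g (0, 0, 0, 1)) + xw * (f (0, 0, 0, 1) * g (0, 1, 0, 0))))))"
    if "functional h4_scale f" "functional h4_scale g" for f g x1 xc xv xw
    unfolding convolution_tsum by (rule sw_h4[OF bilinear_product[OF that]])
  have counit: "functional h4_scale (counit ?H)"
  proof (rule linear_mapI[OF vector_space_h4 vector_space_mult])
    fix r :: 'k and x y :: "'k h4"
    obtain x1 xc xv xw y1 yc yv yw where xy: "x = (x1, xc, xv, xw)" "y = (y1, yc, yv, yw)"
      by (cases x rule: prod_cases4; cases y rule: prod_cases4)
    show "counit ?H (x + y) = counit ?H x + counit ?H y" "counit ?H (h4_scale r x) = r * counit ?H x"
      unfolding xy h4_tuple h4_hopf_simps by algebra+
  qed
  show antipode: "Vector_Spaces.linear (scl ?H) (scl ?H) (antipode ?H)"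
    unfolding h4_hopf_simps
  proof (rule linear_mapI[OF vector_space_h4 vector_space_h4])
    fix r :: 'k and x y :: "'k h4"
    obtain x1 xc xv xw y1 yc yv yw where xy: "x = (x1, xc, xv, xw)" "y = (y1, yc, yv, yw)"
      by (cases x rule: prod_cases4; cases y rule: prod_cases4)
    show "antipode ?H (x + y) = antipode ?H x + antipode ?H y" "antipode ?H (h4_scale r x) = h4_scale r (antipode ?H x)"
      unfolding xy h4_tuple h4_hopf_simps by simp_all
  qed
  show "algebra_hom ?H field_alg (counit ?H)"
    unfolding algebra_hom_field_alg_iff
  proof (intro conjI allI)
    fix x y :: "'k h4"
    obtain x1 xc xv xw y1 yc yv yw where xy: "x = (x1, xc, xv, xw)" "y = (y1, yc, yv, yw)"
      by (cases x rule: prod_cases4; cases y rule: prod_cases4)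
    show "counit ?H (mul ?H x y) = counit ?H x * counit ?H y"
      unfolding xy h4_hopf_simps h4_tuple by algebra
  qed (simp_all add: counit)
  show "point_separating (scl ?H) {f. functional h4_scale f}"
    by (simp add: point_separating_dual vector_space_h4)
  fix f g k :: "'k h4 \<Rightarrow> 'k" and x y :: "'k h4"
  obtain x1 xc xv xw y1 yc yv yw where xy: "x = (x1, xc, xv, xw)" "y = (y1, yc, yv, yw)"
    by (cases x rule: prod_cases4; cases y rule: prod_cases4)
  show "comul ?H x \<in> tensor_space (scl ?H) (scl ?H)"
    by (simp add: h4_hopf_def xy)
  assume "f \<in> {f. functional h4_scale f}"
  then have f: "functional h4_scale f" by simp
  obtain F1 Fc Fv Fw where F: "\<And>x1 xc xv xw. f (x1, xc, xv, xw) = x1 * F1 + xc * Fc + xv * Fv + xw * Fw"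
    by (rule h4_functional[OF f]) blast
  show "convolution ?H (counit ?H) f x = f x" "convolution ?H f (counit ?H) x = f x"
    unfolding xy conv[OF counit f] conv[OF f counit] h4_hopf_simps F by algebra+
  have bil: "bilinear_map h4_scale h4_scale (*) (\<lambda>a b. f (h4_mult (antipode ?H a) b))"
    "bilinear_map h4_scale h4_scale (*) (\<lambda>a b. f (h4_mult a (antipode ?H b)))"
    unfolding bilinear_map_def
    by (intro conjI allI linear_compose'[OF mul_lin(1) f] linear_compose'[OF mul_lin(2) f]
        linear_compose'[OF antipode[unfolded h4_hopf_simps] linear_compose'[OF mul_lin(1) f]]
        linear_compose'[OF antipode[unfolded h4_hopf_simps] linear_compose'[OF mul_lin(2) f]])+
  show "tsum (sw ?H x) (\<lambda>a b. f (mul ?H (antipode ?H a) b)) = counit ?H x * f (unt ?H)"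
    unfolding xy h4_hopf_simps sw_h4[OF bil(1)] h4_mult_tuple F by algebra
  show "tsum (sw ?H x) (\<lambda>a b. f (mul ?H a (antipode ?H b))) = counit ?H x * f (unt ?H)"
    unfolding xy h4_hopf_simps sw_h4[OF bil(2)] h4_mult_tuple F by algebra
  assume "g \<in> {f. functional h4_scale f}"
  then have g: "functional h4_scale g" by simp
  obtain G1 Gc Gv Gw where G: "\<And>x1 xc xv xw. g (x1, xc, xv, xw) = x1 * G1 + xc * Gc + xv * Gv + xw * Gw"
    by (rule h4_functional[OF g]) blast
  have conv_lin: "functional h4_scale (convolution ?H f g)"
    if f: "functional h4_scale f" and g: "functional h4_scale g" for f g
  proof (rule linear_mapI[OF vector_space_h4 vector_space_mult])
    fix r :: 'k and x y :: "'k h4"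
    obtain x1 xc xv xw y1 yc yv yw where xy: "x = (x1, xc, xv, xw)" "y = (y1, yc, yv, yw)"
      by (cases x rule: prod_cases4; cases y rule: prod_cases4)
    show "convolution ?H f g (x + y) = convolution ?H f g x + convolution ?H f g y"
      "convolution ?H f g (h4_scale r x) = r * convolution ?H f g x"
      unfolding xy h4_tuple conv[OF f g] by algebra+
  qed
  show "functional (scl ?H) (convolution ?H f g)" using conv_lin[OF f g] by simp
  show "convolution ?H f g (unt ?H) = f (unt ?H) * g (unt ?H)"
    unfolding h4_hopf_simps conv[OF f g] by algebra
  show "convolution ?H f g (mul ?H x y) =
      tsum (sw ?H x) (\<lambda>a b. tsum (sw ?H y) (\<lambda>a' b'. f (mul ?H a a') * g (mul ?H b b')))"
  proof -
    have bil1: "bilinear_map h4_scale h4_scale (*) (\<lambda>a' b'. f (h4_mult a a') * g (h4_mult b b'))" for a b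
      by (rule bilinear_product[OF linear_compose'[OF mul_lin(1) f] linear_compose'[OF mul_lin(1) g]])
    have bil2: "bilinear_map h4_scale h4_scale (*) (\<lambda>a b. f (h4_mult a e) * g (h4_mult b e'))" for e e'
      by (rule bilinear_product[OF linear_compose'[OF mul_lin(2) f] linear_compose'[OF mul_lin(2) g]])
    show ?thesis
      unfolding xy h4_hopf_simps sw_h4[OF bil1] tsum_add tsum_mult(1) sw_h4[OF bil2] h4_mult_tuple conv[OF f g] F G
      by algebra
  qed
  assume "k \<in> {f. functional h4_scale f}"
  then have k: "functional h4_scale k" by simp
  obtain K1 Kc Kv Kw where K: "\<And>x1 xc xv xw. k (x1, xc, xv, xw) = x1 * K1 + xc * Kc + xv * Kv + xw * Kw"
    by (rule h4_functional[OF k]) blast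
  show "convolution ?H (convolution ?H f g) k x = convolution ?H f (convolution ?H g k) x"
    unfolding xy conv[OF conv_lin[OF f g] k] conv[OF f conv_lin[OF g k]] conv[OF f g] conv[OF g k] F G K by algebra
qed

lemma psi3b_tuple: "psi3b (x1, xc, xv, xw) a =
  (x1 * fst a + xc * snd a + (xv + xw) * (fst a - snd a), x1 * snd a + xc * fst a + (xv + xw) * (fst a - snd a))"
  by (cases a) (simp add: psi3b_def Let_def distrib_right)

lemma unital_hopf_action_psi3b: "unital_hopf_action h4_hopf kk (psi3b :: 'k::field h4 \<Rightarrow> _)"
  unfolding unital_hopf_action_def hopf_action_def tsum_def[symmetric]
proof (intro conjI allI hopf_algebra_h4 algebra_kk)
  fix x y :: "'k h4" and a b :: "'k \<times> 'k"
  obtain x1 xc xv xw y1 yc yv yw where xy: "x = (x1, xc, xv, xw)" "y = (y1, yc, yv, yw)"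
    by (cases x rule: prod_cases4; cases y rule: prod_cases4)
  show "Vector_Spaces.linear (scl kk) (scl kk) (psi3b x)"
    by (rule linear_mapI[OF vector_space_kk vector_space_kk]; rule prod_eqI;
        simp only: xy psi3b_tuple fst_conv snd_conv fst_add snd_add kk_simps; algebra)
  have lin: "Vector_Spaces.linear h4_scale (scl kk) (\<lambda>x. psi3b x a)" for a :: "'k \<times> 'k"
  proof (rule linear_mapI[OF vector_space_h4 vector_space_kk])
    fix r :: 'k and x y :: "'k h4"
    obtain x1 xc xv xw y1 yc yv yw where xy: "x = (x1, xc, xv, xw)" "y = (y1, yc, yv, yw)"
      by (cases x rule: prod_cases4; cases y rule: prod_cases4)
    show "psi3b (x + y) a = psi3b x a + psi3b y a" "psi3b (h4_scale r x) a = scl kk r (psi3b x a)"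
      unfolding xy h4_tuple psi3b_tuple kk_simps by (intro conjI; algebra)+
  qed
  then show "Vector_Spaces.linear (scl h4_hopf) (scl kk) (\<lambda>x. psi3b x a)" by simp
  show "psi3b (unt h4_hopf) a = a"
    by (rule prod_eqI) (simp_all add: psi3b_tuple)
  show "psi3b (mul h4_hopf x y) a = psi3b x (psi3b y a)"
    unfolding xy h4_hopf_simps h4_mult_tuple psi3b_tuple fst_conv snd_conv prod.inject by (intro conjI; algebra)
  have bil: "bilinear_map h4_scale h4_scale (scl kk) (\<lambda>x y. mul kk (psi3b x a) (psi3b y b))"
    unfolding bilinear_map_def
    by (intro conjI allI linear_compose'[OF lin algebraD(5)[OF algebra_kk]]
        linear_compose'[OF lin algebraD(6)[OF algebra_kk]])
  show "psi3b x (mul kk a b) = tsum (sw h4_hopf x) (\<lambda>x y. mul kk (psi3b x a) (psi3b y b))"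
    unfolding xy sw_h4[OF bil] psi3b_tuple
    by (rule prod_eqI; simp only: fst_conv snd_conv fst_add snd_add kk_simps; algebra)
  show "psi3b x (unt kk) = scl kk (counit h4_hopf x) (unt kk)"
    unfolding xy psi3b_tuple h4_hopf_simps kk_simps fst_conv snd_conv by simp
qed

lemma psi3b_generators: "psi3b h4_c (\<alpha>, \<beta>) = (\<beta>, \<alpha>)" "psi3b h4_v (\<alpha>, \<beta>) = (\<alpha> - \<beta>, \<alpha> - \<beta>)"
  by (simp_all add: h4_c_def h4_v_def psi3b_tuple)

text \<open>
  The operators of \<open>v\<close> and \<open>cv\<close> agree; with \<open>c\<close> acting on the basis \<open>1, e\<close> by \<open>1 \<mapsto> 1\<close>,
  \<open>e \<mapsto> 1 - e\<close>, the diagonal entries of an operator in the cosupport are a sum and a difference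
  of two free parameters, and these take all pairs of values when \<open>2\<close> is invertible.
\<close>

lemma cosupp_psi3b:
  assumes "CHAR('k::field) \<noteq> 2"
  shows "cosupp (psi3b :: 'k h4 \<Rightarrow> _) =
    {T \<in> lin_End kk. \<exists>\<alpha> \<beta> \<gamma>. has_matrix kk ((1, 1), (1, 0)) T ((\<alpha>, \<beta>), (0, \<gamma>))}" (is "?L = ?R")
proof
  have lin: "Vector_Spaces.linear (scl kk) (scl kk) (psi3b x)" for x :: "'k h4"
    using unital_hopf_action_psi3b unfolding unital_hopf_action_def hopf_action_def by blast
  show "?L \<subseteq> ?R"
  proof
    fix T :: "'k \<times> 'k \<Rightarrow> 'k \<times> 'k" assume "T \<in> ?L"
    then obtain x1 xc xv xw where T: "T = psi3b (x1, xc, xv, xw)" by (auto simp: cosupp_def)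
    have "has_matrix kk ((1, 1), (1, 0)) T ((x1 + xc, xc + xv + xw), (0, x1 - xc))"
      by (simp add: T has_matrix_def psi3b_tuple algebra_simps)
    then show "T \<in> ?R" using lin T by (auto simp: lin_End_def)
  qed
  have two: "(2 :: 'k) \<noteq> 0"
  proof
    assume "(2 :: 'k) = 0"
    then have "of_nat 2 = (0 :: 'k)" by simp
    then have "CHAR('k) dvd 2" by (simp only: of_nat_eq_0_iff_char_dvd)
    moreover have "\<not> CHAR('k) dvd 1"
    proof
      assume "CHAR('k) dvd 1"
      then have "of_nat 1 = (0 :: 'k)" by (simp only: of_nat_eq_0_iff_char_dvd)
      then show False by simp
    qed
    moreover have "n = 1 \<or> n = 2" if "n dvd 2" for n :: nat
    proof -
      have "n \<le> 2" using dvd_imp_le[OF that] by simp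
      moreover have "n \<noteq> 0" using that by (metis dvd_0_left_iff zero_neq_numeral)
      ultimately show ?thesis by auto
    qed
    ultimately show False using assms by (metis dvd_refl)
  qed
  show "?R \<subseteq> ?L"
  proof
    fix T :: "'k \<times> 'k \<Rightarrow> 'k \<times> 'k" assume "T \<in> ?R"
    then obtain \<alpha> \<beta> \<gamma> where T: "Vector_Spaces.linear (scl kk) (scl kk) T"
      "has_matrix kk ((1, 1), (1, 0)) T ((\<alpha>, \<beta>), (0, \<gamma>))" by (auto simp: lin_End_def)
    define v where "v = (\<alpha> - \<gamma>) / 2"
    define u where "u = \<alpha> - v"
    have "2 * v = \<alpha> - \<gamma>" using two by (simp add: v_def)
    then have "u - v = \<gamma>" unfolding u_def by algebra
    moreover have "u + v = \<alpha>" by (simp add: u_def)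
    ultimately have "T = psi3b (u, v, \<beta> - v, 0)"
      using T(2) by (intro kk_linear_eqI[OF T(1) lin]) (auto simp: has_matrix_def psi3b_tuple algebra_simps)
    then show "T \<in> ?L" by (auto simp: cosupp_def)
  qed
qed

section \<open>The matrix coefficients of an action on \<open>k \<times> k\<close>\<close>

text \<open>
  In the basis \<open>1, e\<close> with \<open>e = (1, 0)\<close>, an action on \<open>k \<times> k\<close> is given by upper triangular matrices with
  entries \<open>\<epsilon>\<close>, \<open>\<alpha>\<close>, \<open>\<beta>\<close>, where \<open>h e = \<alpha>(h) 1 + \<beta>(h) e\<close>.
\<close>

locale kk_action =
  fixes H :: "('k::field, 'h::ab_group_add) hopf" and \<psi> :: "'h \<Rightarrow> 'k \<times> 'k \<Rightarrow> 'k \<times> 'k"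
  assumes action: "unital_hopf_action H kk \<psi>"
begin

lemma hopf_action: "hopf_action H kk \<psi>"
  using action by (simp only: unital_hopf_action_def)

lemmas actionD = hopf_actionD[OF hopf_action]

sublocale hopf H
  by unfold_locales (rule actionD)

definition \<alpha> :: "'h \<Rightarrow> 'k" where "\<alpha> h = snd (\<psi> h (1, 0))"
definition \<beta> :: "'h \<Rightarrow> 'k" where "\<beta> h = fst (\<psi> h (1, 0)) - snd (\<psi> h (1, 0))"

lemma psi_one: "\<psi> h (1, 1) = scl kk (counit H h) (1, 1)"
  using action by (simp add: unital_hopf_action_def)

lemma psi_e: "\<psi> h (1, 0) = (\<alpha> h + \<beta> h, \<alpha> h)"
  by (simp add: \<alpha>_def \<beta>_def)

lemma psi_coord:
  "fst (\<psi> h a) = snd a * counit H h + (fst a - snd a) * (\<alpha> h + \<beta> h)"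
  "snd (\<psi> h a) = snd a * counit H h + (fst a - snd a) * \<alpha> h"
proof -
  have "\<psi> h a = \<psi> h (scl kk (snd a) (1, 1) + scl kk (fst a - snd a) (1, 0))" by (simp only: kk_decomp[symmetric])
  also have "\<dots> = scl kk (snd a) (\<psi> h (1, 1)) + scl kk (fst a - snd a) (\<psi> h (1, 0))"
    by (simp only: linearD(1,2)[OF actionD(3)])
  finally show "fst (\<psi> h a) = snd a * counit H h + (fst a - snd a) * (\<alpha> h + \<beta> h)"
    "snd (\<psi> h a) = snd a * counit H h + (fst a - snd a) * \<alpha> h"
    by (simp_all only: psi_one psi_e kk_simps fst_add snd_add fst_conv snd_conv mult_1_right)
qed

lemma functional_coefficients: "functional (scl H) \<alpha>" "functional (scl H) \<beta>"
  by (rule linear_mapI[OF vs vector_space_mult];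
      simp add: \<alpha>_def \<beta>_def linearD(1,2)[OF actionD(4)] right_diff_distrib)+

lemma coefficients_unt: "\<alpha> (unt H) = 0" "\<beta> (unt H) = 1"
  by (simp_all add: \<alpha>_def \<beta>_def actionD(5))

lemma coefficients_mul:
  "\<alpha> (mul H g h) = \<alpha> g * \<beta> h + counit H g * \<alpha> h" "\<beta> (mul H g h) = \<beta> g * \<beta> h"
proof -
  have eq: "\<psi> (mul H g h) (1, 0) = \<psi> g (\<alpha> h + \<beta> h, \<alpha> h)"
    by (simp only: actionD(6)) (simp only: psi_e)
  have "snd (\<psi> (mul H g h) (1, 0)) = \<alpha> h * counit H g + \<beta> h * \<alpha> g"
    "fst (\<psi> (mul H g h) (1, 0)) = \<alpha> h * counit H g + \<beta> h * (\<alpha> g + \<beta> g)"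
    unfolding eq by (simp_all only: psi_coord fst_conv snd_conv add_diff_cancel_left')
  then show "\<alpha> (mul H g h) = \<alpha> g * \<beta> h + counit H g * \<alpha> h" "\<beta> (mul H g h) = \<beta> g * \<beta> h"
    unfolding \<alpha>_def[of "mul H g h"] \<beta>_def[of "mul H g h"] by algebra+
qed

text \<open>
  Since \<open>e\<close> is idempotent, so are \<open>\<alpha>\<close> and \<open>\<alpha> + \<beta>\<close>, its coordinates, under convolution; expanding the
  square of \<open>\<alpha> + \<beta>\<close> gives the relations of \<open>h\<close> and \<open>c\<close>.
\<close>

lemma coefficients_idempotent:
  "convolution H \<alpha> \<alpha> h = \<alpha> h"
  "convolution H \<alpha> \<beta> h + convolution H \<beta> \<alpha> h + convolution H \<beta> \<beta> h = \<beta> h"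
proof -
  have "\<psi> h (1, 0) = \<psi> h (mul kk (1, 0) (1, 0))" by simp
  also have "\<dots> = Sw h (\<lambda>x y. mul kk (\<psi> x (1, 0)) (\<psi> y (1, 0)))" by (rule actionD(7))
  finally have "snd (\<psi> h (1, 0)) = Sw h (\<lambda>x y. \<alpha> x * \<alpha> y)"
    "fst (\<psi> h (1, 0)) = Sw h (\<lambda>x y. (\<alpha> x + \<beta> x) * (\<alpha> y + \<beta> y))"
    by (simp_all only: tsum_pair kk_simps psi_e fst_conv snd_conv)
  then have eq: "\<alpha> h = Sw h (\<lambda>x y. \<alpha> x * \<alpha> y)"
    "\<alpha> h + \<beta> h = Sw h (\<lambda>x y. \<alpha> x * \<alpha> y) + Sw h (\<lambda>x y. \<beta> x * \<alpha> y) + (Sw h (\<lambda>x y. \<alpha> x * \<beta> y) + Sw h (\<lambda>x y. \<beta> x * \<beta> y))"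
    by (simp_all only: psi_e fst_conv snd_conv distrib_left distrib_right tsum_add)
  show "convolution H \<alpha> \<alpha> h = \<alpha> h" by (simp only: convolution_tsum eq(1)[symmetric])
  show "convolution H \<alpha> \<beta> h + convolution H \<beta> \<alpha> h + convolution H \<beta> \<beta> h = \<beta> h"
  proof -
    have "\<alpha> h + \<beta> h = \<alpha> h + (Sw h (\<lambda>x y. \<beta> x * \<alpha> y) + (Sw h (\<lambda>x y. \<alpha> x * \<beta> y) + Sw h (\<lambda>x y. \<beta> x * \<beta> y)))"
      by (simp only: eq(2)[unfolded eq(1)[symmetric]] add.assoc)
    then show ?thesis by (simp only: add_left_cancel convolution_tsum) (simp only: ac_simps)
  qed
qed

lemma psi_matrix: "has_matrix kk ((1, 1), (1, 0)) (\<psi> h) ((counit H h, \<alpha> h), (0, \<beta> h))"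
  by (simp add: has_matrix_def psi_one psi_e)

lemma cosupp_upper_triangular: "cosupp \<psi> \<subseteq> cosupp (psi3 :: 'k cdh_dual \<Rightarrow> _)"
  unfolding cosupp_psi3 using psi_matrix actionD(3) by (auto simp: cosupp_def lin_End_def)

text \<open>
  The triples \<open>(\<epsilon> h, \<alpha> h, \<beta> h)\<close> form a subspace of \<open>k\<^sup>3\<close>; a proper subspace would be annihilated by a
  functional, that is, by a linear relation between the three coefficients.
\<close>

lemma cosupp_full:
  assumes indep: "\<And>a b c. (\<And>h. a * counit H h + b * \<alpha> h + c * \<beta> h = 0) \<Longrightarrow> a = 0 \<and> b = 0 \<and> c = 0"
  shows "cosupp \<psi> = cosupp (psi3 :: 'k cdh_dual \<Rightarrow> _)"
proof (rule antisym[OF cosupp_upper_triangular])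
  define s :: "'k \<Rightarrow> 'k \<times> 'k \<times> 'k \<Rightarrow> 'k \<times> 'k \<times> 'k" where
    "s r v = (r * fst v, r * fst (snd v), r * snd (snd v))" for r v
  have vs3: "vector_space s"
    by (rule vector_space.intro; simp only: s_def prod_eq_iff fst_add snd_add fst_conv snd_conv
        distrib_left distrib_right mult.assoc mult_1_left simp_thms)
  define V where "V = range (\<lambda>h. (counit H h, \<alpha> h, \<beta> h))"
  interpret V: vector_space s by (rule vs3)
  have sub: "V.subspace V"
  proof (rule V.subspaceI)
    have "(0, 0, 0) = (counit H 0, \<alpha> 0, \<beta> 0)"
      by (simp only: linearD(3)[OF counit_functional] linearD(3)[OF functional_coefficients(1)]
          linearD(3)[OF functional_coefficients(2)])
    then show "0 \<in> V" unfolding V_def zero_prod_def by blast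
    fix u v assume "u \<in> V" "v \<in> V"
    then obtain g h where uv: "u = (counit H g, \<alpha> g, \<beta> g)" "v = (counit H h, \<alpha> h, \<beta> h)" by (auto simp: V_def)
    have "u + v = (counit H (g + h), \<alpha> (g + h), \<beta> (g + h))"
      by (simp only: uv plus_prod_def fst_conv snd_conv linearD(1)[OF counit_functional]
          linearD(1)[OF functional_coefficients(1)] linearD(1)[OF functional_coefficients(2)])
    then show "u + v \<in> V" unfolding V_def by blast
  next
    fix r u assume "u \<in> V"
    then obtain g where u: "u = (counit H g, \<alpha> g, \<beta> g)" by (auto simp: V_def)
    have "s r u = (counit H (scl H r g), \<alpha> (scl H r g), \<beta> (scl H r g))"
      by (simp only: u s_def fst_conv snd_conv linearD(2)[OF counit_functional]
          linearD(2)[OF functional_coefficients(1)] linearD(2)[OF functional_coefficients(2)])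
    then show "s r u \<in> V" unfolding V_def by blast
  qed
  have all: "v \<in> V" for v
  proof (rule ccontr)
    assume "v \<notin> V"
    then obtain L where L: "functional s L" "\<forall>u\<in>V. L u = 0" "L v = 1"
      using annihilating_functional[OF vs3 sub] by blast
    have expand: "L u = fst u * L (1, 0, 0) + fst (snd u) * L (0, 1, 0) + snd (snd u) * L (0, 0, 1)" for u
    proof -
      have "L u = L (s (fst u) (1, 0, 0) + s (fst (snd u)) (0, 1, 0) + s (snd (snd u)) (0, 0, 1))"
        by (simp add: s_def)
      then show ?thesis by (simp only: linearD(1,2)[OF L(1)])
    qed
    have "L (1, 0, 0) * counit H h + L (0, 1, 0) * \<alpha> h + L (0, 0, 1) * \<beta> h = 0" for h
    proof -
      have "L (counit H h, \<alpha> h, \<beta> h) = 0" using L(2) by (auto simp: V_def)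
      then show ?thesis by (simp only: expand[of "(counit H h, \<alpha> h, \<beta> h)"] fst_conv snd_conv mult.commute)
    qed
    from indep[OF this] have "L v = 0" by (simp only: expand[of v]) simp
    then show False using L(3) by simp
  qed
  show "cosupp (psi3 :: 'k cdh_dual \<Rightarrow> _) \<subseteq> cosupp \<psi>"
    unfolding cosupp_psi3
  proof
    fix T :: "'k \<times> 'k \<Rightarrow> 'k \<times> 'k"
    assume "T \<in> {T \<in> lin_End kk. \<exists>\<alpha> \<beta> \<gamma>. has_matrix kk ((1, 1), (1, 0)) T ((\<alpha>, \<beta>), (0, \<gamma>))}"
    then obtain p q r where T: "Vector_Spaces.linear (scl kk) (scl kk) T"
      "has_matrix kk ((1, 1), (1, 0)) T ((p, q), (0, r))" by (auto simp: lin_End_def)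
    obtain h where "(p, q, r) = (counit H h, \<alpha> h, \<beta> h)" using all[of "(p, q, r)"] by (auto simp: V_def)
    then have "T = \<psi> h"
      using T(2) psi_matrix[of h] by (intro kk_linear_eqI[OF T(1) actionD(3)]) (simp_all add: has_matrix_def)
    then show "T \<in> cosupp \<psi>" by (auto simp: cosupp_def)
  qed
qed

text \<open>
  A nontrivial linear relation between the coefficients \<open>\<epsilon>\<close>, \<open>\<alpha>\<close>, \<open>\<beta>\<close> forces the relation that
  characterises the span of the identity and the swap.  Evaluation at the unit of \<open>H\<close> shows that
  the given relation has the form \<open>a (\<epsilon> - \<beta>) + b \<alpha> = 0\<close>.  If \<open>b = 0\<close>, then \<open>\<beta> = \<epsilon>\<close> and the
  convolution identity for \<open>\<beta>\<close> reads \<open>2 \<alpha> + \<epsilon> = \<epsilon>\<close>.  Otherwise \<open>\<alpha> = t (\<epsilon> - \<beta>)\<close>, and the same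
  identity reads \<open>(2 t - 1) (\<beta> - \<beta> * \<beta>) = 0\<close>: either \<open>2 t = 1\<close>, which is the claim, or \<open>\<beta>\<close> is an
  invertible idempotent, hence the counit, and \<open>\<alpha> = 0\<close>.
\<close>

lemma dependent_coefficients:
  assumes rel: "\<And>h. a * counit H h + b * \<alpha> h + c * \<beta> h = 0" and nontrivial: "\<not> (a = 0 \<and> b = 0 \<and> c = 0)"
  shows "counit H h = \<beta> h + 2 * \<alpha> h"
proof -
  have c: "c = - a" using rel[of "unt H"] by (simp add: coefficients_unt counit_unt add_eq_0_iff)
  note \<alpha> = functional_coefficients(1) and \<beta> = functional_coefficients(2)
  show ?thesis
  proof (cases "b = 0")
    case True
    then have "a \<noteq> 0" using nontrivial c by auto
    have "\<beta> g = counit H g" for g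
    proof -
      have "a * (counit H g - \<beta> g) = 0" using rel[of g] True c by (simp add: right_diff_distrib)
      then show ?thesis using \<open>a \<noteq> 0\<close> by simp
    qed
    then have eq: "\<beta> = counit H" by (rule ext)
    have "\<alpha> h + \<alpha> h + counit H h = counit H h"
      using coefficients_idempotent(2)[of h]
      by (simp only: eq convolution_counit[OF \<alpha>] convolution_counit[OF counit_functional])
    then show ?thesis by (simp add: eq)
  next
    case False
    define t where "t = - (a / b)"
    have \<alpha>_eq: "\<alpha> g = t * (counit H g - \<beta> g)" for g
    proof -
      have "b * \<alpha> g = - a * (counit H g - \<beta> g)" using rel[of g] c by (simp add: algebra_simps eq_neg_iff_add_eq_0)
      moreover have "b * t = - a" using False by (simp add: t_def)
      ultimately have "b * \<alpha> g = b * (t * (counit H g - \<beta> g))" by (simp only: mult.assoc[symmetric])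
      then show ?thesis using False by simp
    qed
    show ?thesis
    proof (cases "2 * t = 1")
      case True
      have "2 * \<alpha> h = (2 * t) * (counit H h - \<beta> h)" by (simp only: \<alpha>_eq mult.assoc)
      then show ?thesis by (simp add: True)
    next
      case False
      have "convolution H \<beta> \<beta> g = \<beta> g" for g
      proof -
        have "convolution H \<alpha> \<beta> g = t * (convolution H (counit H) \<beta> g - convolution H \<beta> \<beta> g)"
          "convolution H \<beta> \<alpha> g = t * (convolution H \<beta> (counit H) g - convolution H \<beta> \<beta> g)"
          by (simp_all only: convolution_tsum \<alpha>_eq tsum_mult(1)[symmetric] tsum_diff[symmetric]
              left_diff_distrib right_diff_distrib mult.assoc mult.left_commute)
        then have "t * (\<beta> g - convolution H \<beta> \<beta> g) + t * (\<beta> g - convolution H \<beta> \<beta> g) + convolution H \<beta> \<beta> g = \<beta> g"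
          using coefficients_idempotent(2)[of g] by (simp only: convolution_counit[OF \<beta>])
        then have "t * (\<beta> g - convolution H \<beta> \<beta> g) + t * (\<beta> g - convolution H \<beta> \<beta> g) = \<beta> g - convolution H \<beta> \<beta> g"
          by (simp only: eq_diff_eq)
        then have "(2 * t - 1) * (\<beta> g - convolution H \<beta> \<beta> g) = 0"
          by (simp only: mult_2 left_diff_distrib distrib_right mult_1_left diff_self)
        then show ?thesis using False by simp
      qed
      then have idem: "convolution H \<beta> \<beta> = \<beta>" by (rule ext)
      note inverse = convolution_antipode[OF \<beta> coefficients_mul(2) coefficients_unt(2)]
      have \<beta>S: "functional (scl H) (\<lambda>h. \<beta> (antipode H h))" by (rule linear_compose'[OF antipode_linear \<beta>])
      have "\<beta> = convolution H (convolution H \<beta> \<beta>) (\<lambda>h. \<beta> (antipode H h))"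
        by (simp only: convolution_assoc[OF \<beta> \<beta> \<beta>S] inverse(1) convolution_counit[OF \<beta>])
      also have "\<dots> = counit H" by (simp only: idem inverse(1))
      finally have "\<beta> h = counit H h" by (rule fun_cong)
      then show ?thesis by (simp add: \<alpha>_eq)
    qed
  qed
qed

text \<open>
  In the dependent case \<open>\<psi> h\<close> is a combination of the identity, with coefficient \<open>\<alpha> h + \<beta> h\<close>, and the
  swap, with coefficient \<open>\<alpha> h\<close>.  If \<open>\<alpha>\<close> does not vanish, then both coefficients take arbitrary values,
  since the unit of \<open>H\<close> adjusts the first without changing the second.
\<close>

lemma cosupp_cases:
  "cosupp \<psi> = cosupp (psi1 :: 'k \<Rightarrow> _) \<or> cosupp \<psi> = cosupp (psi2 :: (bit \<Rightarrow>\<^sub>0 'k) \<Rightarrow> _) \<or>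
   cosupp \<psi> = cosupp (psi3 :: 'k cdh_dual \<Rightarrow> _)"
proof (cases "\<forall>a b c. (\<forall>h. a * counit H h + b * \<alpha> h + c * \<beta> h = 0) \<longrightarrow> a = 0 \<and> b = 0 \<and> c = 0")
  case True
  then have "cosupp \<psi> = cosupp (psi3 :: 'k cdh_dual \<Rightarrow> _)" by (intro cosupp_full) blast
  then show ?thesis by simp
next
  case False
  then obtain a b c where "\<And>h. a * counit H h + b * \<alpha> h + c * \<beta> h = 0" "\<not> (a = 0 \<and> b = 0 \<and> c = 0)" by blast
  then have \<epsilon>: "counit H h = \<beta> h + 2 * \<alpha> h" for h by (rule dependent_coefficients)
  have psi: "\<psi> h = (\<lambda>a. scl kk (\<alpha> h + \<beta> h) a + scl kk (\<alpha> h) (prod.swap a))" for h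
    by (rule op_eqI; simp only: psi_coord \<epsilon> kk_simps fst_add snd_add fst_swap snd_swap; algebra)
  have lin: "\<alpha> (scl H r g + scl H r' h) = r * \<alpha> g + r' * \<alpha> h" "\<beta> (scl H r g + scl H r' h) = r * \<beta> g + r' * \<beta> h"
    for r r' g h
    by (simp_all only: linearD(1,2)[OF functional_coefficients(1)] linearD(1,2)[OF functional_coefficients(2)])
  show ?thesis
  proof (cases "\<forall>h. \<alpha> h = 0")
    case True
    have psi': "\<psi> h = (\<lambda>a. scl kk (\<beta> h) a)" for h
      by (rule op_eqI) (simp_all add: psi_coord \<epsilon> True algebra_simps)
    have "\<beta> (scl H r (unt H)) = r" for r
      by (simp add: linearD(2)[OF functional_coefficients(2)] coefficients_unt)
    then have "\<psi> (scl H r (unt H)) = (\<lambda>a. scl kk r a)" for r by (simp only: psi')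
    then have "cosupp \<psi> = cosupp (psi1 :: 'k \<Rightarrow> _)"
      unfolding cosupp_psi1 by (auto simp: cosupp_def psi') metis
    then show ?thesis by simp
  next
    case False
    then obtain g where g: "\<alpha> g \<noteq> 0" by blast
    have "\<exists>h. \<alpha> h + \<beta> h = p \<and> \<alpha> h = q" for p q
    proof -
      define r where "r = q / \<alpha> g"
      define h where "h = scl H r g + scl H (p - q - r * \<beta> g) (unt H)"
      have "\<alpha> h = q" "\<beta> h = p - q" using g by (simp_all add: h_def lin coefficients_unt r_def)
      then show ?thesis by (intro exI[of _ h]) simp
    qed
    then have "cosupp \<psi> = cosupp (psi2 :: (bit \<Rightarrow>\<^sub>0 'k) \<Rightarrow> _)"
      unfolding cosupp_psi2 by (auto simp: cosupp_def psi image_def) metis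
    then show ?thesis by simp
  qed
qed

end

text \<open>Each cosupport in the classification is attained exactly, so the identity serves as the isomorphism.\<close>

lemma equivalent_if_cosupp_eq:
  assumes "cosupp \<psi> = cosupp \<psi>'"
  shows "equivalent_actions (kk :: ('k::field, 'k \<times> 'k) alg) \<psi> kk \<psi>'"
  unfolding equivalent_actions_def
proof (intro exI[of _ id] conjI)
  show "algebra_hom (kk :: ('k, 'k \<times> 'k) alg) kk id"
    by (auto simp: algebra_hom_def intro!: linear_mapI[OF vector_space_kk vector_space_kk])
qed (simp_all add: assms)

section \<open>Universality\<close>

lemma V_universalI:
  assumes action: "unital_hopf_action H0 A \<psi>0"
    and ex: "\<And>(H :: ('k::field, 'h::ab_group_add) hopf) \<psi>. unital_hopf_action H A \<psi> \<Longrightarrow> cosupp \<psi> \<subseteq> cosupp \<psi>0 \<Longrightarrow>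
      \<exists>\<phi>. hopf_hom H H0 \<phi> \<and> (\<forall>h a. \<psi> h a = \<psi>0 (\<phi> h) a) \<and>
        (\<forall>\<phi>'. hopf_hom H H0 \<phi>' \<longrightarrow> (\<forall>h a. \<psi> h a = \<psi>0 (\<phi>' h) a) \<longrightarrow> \<phi>' = \<phi>)"
  shows "V_universal TYPE('h) A (cosupp \<psi>0) H0 \<psi>0"
  unfolding V_universal_def
proof (intro conjI allI impI)
  show "unital_subalgebra_End A (cosupp \<psi>0)"
    using action unfolding unital_hopf_action_def by (intro unital_subalgebra_cosupp[of H0]) blast
  fix H :: "('k, 'h) hopf" and \<psi> assume "unital_hopf_action H A \<psi> \<and> cosupp \<psi> \<subseteq> cosupp \<psi>0"
  then show "\<exists>!\<phi>. hopf_hom H H0 \<phi> \<and> (\<forall>h a. \<psi> h a = \<psi>0 (\<phi> h) a)"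
    using ex[of H \<psi>] by blast
qed (simp_all add: action)

lemma universal_psi1: "V_universal TYPE('h::ab_group_add) kk (cosupp psi1) field_hopf (psi1 :: 'k::field \<Rightarrow> _)"
proof (rule V_universalI[OF unital_hopf_action_psi1])
  fix H :: "('k, 'h) hopf" and \<psi>
  assume act: "unital_hopf_action H kk \<psi>" and sub: "cosupp \<psi> \<subseteq> cosupp (psi1 :: 'k \<Rightarrow> _)"
  interpret kk_action H \<psi> by unfold_locales (rule act)
  have psi: "\<psi> h a = psi1 (counit H h) a" for h a
  proof -
    have "\<psi> h \<in> cosupp (psi1 :: 'k \<Rightarrow> _)" using sub by (auto simp: cosupp_def)
    then obtain r where r: "\<psi> h = (\<lambda>a. scl kk r a)" by (auto simp: cosupp_psi1)
    have "r = counit H h" using psi_one[of h] by (simp add: r)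
    then show ?thesis by (simp add: r psi1_def)
  qed
  have "tens (*) (*) [(counit H h, 1)] = tens (*) (*) [(counit H a, counit H b). (a, b) \<leftarrow> sw H h]" for h
  proof (rule tens_eqI)
    show "point_separating (*) {\<lambda>x :: 'k. x}" "point_separating (*) {\<lambda>x :: 'k. x}"
      by (simp_all add: point_separating_def vector_space_mult functional_id)
    fix f g assume "f \<in> {\<lambda>x :: 'k. x}" "g \<in> {\<lambda>x :: 'k. x}"
    then show "tsum [(counit H h, 1)] (\<lambda>v w. f v * g w) =
        tsum [(counit H a, counit H b). (a, b) \<leftarrow> sw H h] (\<lambda>v w. f v * g w)"
      by (simp add: tsum_map Sw_counit(1)[OF counit_functional])
  qed
  then have "hopf_hom H field_hopf (counit H)"
    by (simp add: hopf_hom_def algebra_hom_def counit_functional counit_mul counit_unt)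
  moreover have "\<phi>' = counit H" if "\<forall>h a. \<psi> h a = psi1 (\<phi>' h) a" for \<phi>'
  proof
    fix h
    have "psi1 (\<phi>' h) (1, 1) = psi1 (counit H h) (1, 1)" using that psi by metis
    then show "\<phi>' h = counit H h" by (simp add: psi1_def)
  qed
  ultimately show "\<exists>\<phi>. hopf_hom H field_hopf \<phi> \<and> (\<forall>h a. \<psi> h a = psi1 (\<phi> h) a) \<and>
      (\<forall>\<phi>'. hopf_hom H field_hopf \<phi>' \<longrightarrow> (\<forall>h a. \<psi> h a = psi1 (\<phi>' h) a) \<longrightarrow> \<phi>' = \<phi>)"
    using psi by blast
qed

text \<open>
  When \<open>e\<close> and \<open>1 - e\<close> are only permuted, the coordinates \<open>x\<close>, \<open>y\<close> of the orbit of \<open>e\<close> are orthogonal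
  idempotents of the dual space; this says that \<open>h \<mapsto> x(h) 1 + y(h) c\<close> is comultiplicative.
\<close>

lemma universal_psi2:
  "V_universal TYPE('h::ab_group_add) kk (cosupp psi2) group_hopf (psi2 :: (bit \<Rightarrow>\<^sub>0 'k::field) \<Rightarrow> _)"
proof (rule V_universalI[OF unital_hopf_action_psi2])
  fix H :: "('k, 'h) hopf" and \<psi>
  assume act: "unital_hopf_action H kk \<psi>" and sub: "cosupp \<psi> \<subseteq> cosupp (psi2 :: (bit \<Rightarrow>\<^sub>0 'k) \<Rightarrow> _)"
  interpret kk_action H \<psi> by unfold_locales (rule act)
  let ?l = "Poly_Mapping.lookup :: (bit \<Rightarrow>\<^sub>0 'k) \<Rightarrow> bit \<Rightarrow> 'k"
  define x where "x h = fst (\<psi> h (1, 0))" for h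
  define y where "y h = snd (\<psi> h (1, 0))" for h
  have psi: "\<psi> h = (\<lambda>a. scl kk (x h) a + scl kk (y h) (prod.swap a))" for h
  proof -
    have "\<psi> h \<in> cosupp (psi2 :: (bit \<Rightarrow>\<^sub>0 'k) \<Rightarrow> _)" using sub by (auto simp: cosupp_def)
    then obtain p q where pq: "\<psi> h = (\<lambda>a. scl kk p a + scl kk q (prod.swap a))" by (auto simp: cosupp_psi2)
    then have "x h = p" "y h = q" by (simp_all add: x_def y_def)
    then show ?thesis by (simp only: pq)
  qed
  have lin: "functional (scl H) x" "functional (scl H) y"
    using linear_compose'[OF actionD(4) kk_functionals(1)] linear_compose'[OF actionD(4) kk_functionals(2)]
    by (simp_all add: x_def[abs_def] y_def[abs_def])
  have counit: "counit H h = x h + y h" for h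
    using arg_cong[OF psi_one[of h], of fst] by (simp add: psi)
  have mult: "x (mul H g h) = x g * x h + y g * y h" "y (mul H g h) = x g * y h + y g * x h" for g h
    using actionD(6)[of g h "(1, 0)"] by (simp_all add: psi)
  have unit: "x (unt H) = 1" "y (unt H) = 0"
    by (simp_all add: x_def y_def actionD(5))
  have e: "\<psi> h (1, 0) = (x h, y h)" and e': "\<psi> h (0, 1) = (y h, x h)" for h
    by (simp add: x_def y_def) (simp add: psi)
  have "Sw h (\<lambda>a b. mul kk (\<psi> a (1, 0)) (\<psi> b (1, 0))) = (x h, y h)" for h
    by (simp only: actionD(7)[symmetric] kk_simps) (simp add: x_def y_def)
  from arg_cong[OF this, of fst] arg_cong[OF this, of snd]
  have idem: "Sw h (\<lambda>a b. x a * x b) = x h" "Sw h (\<lambda>a b. y a * y b) = y h" for h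
    by (simp_all only: tsum_pair kk_simps e fst_conv snd_conv)
  have "Sw h (\<lambda>a b. mul kk (\<psi> a (1, 0)) (\<psi> b (0, 1))) = (0, 0)" for h
    by (simp only: actionD(7)[symmetric] kk_simps) (simp add: psi)
  from arg_cong[OF this, of fst] arg_cong[OF this, of snd]
  have orth: "Sw h (\<lambda>a b. x a * y b) = 0" "Sw h (\<lambda>a b. y a * x b) = 0" for h
    by (simp_all only: tsum_pair kk_simps e e' fst_conv snd_conv)
  define \<phi> :: "'h \<Rightarrow> (bit \<Rightarrow>\<^sub>0 'k)" where
    "\<phi> h = Poly_Mapping.single 0 (x h) + Poly_Mapping.single 1 (y h)" for h
  have lookup: "?l (\<phi> h) 0 = x h" "?l (\<phi> h) 1 = y h" for h
    by (simp_all add: \<phi>_def lookup_add lookup_single)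
  have bit: "b = 0 \<or> b = 1" for b :: bit using UNIV_bit by blast
  have eqI: "u = v" if "?l u 0 = ?l v 0" "?l u 1 = ?l v 1" for u v
  proof (rule poly_mapping_eqI)
    fix b show "?l u b = ?l v b" using that bit[of b] by auto
  qed
  have act_eq: "\<psi> h a = psi2 (\<phi> h) a" for h a
    by (rule prod_eqI) (simp_all add: psi psi2_coord lookup)
  have alg: "algebra_hom H group_hopf \<phi>"
    unfolding algebra_hom_def group_hopf_simps
  proof (intro conjI allI linear_mapI vs vector_space_pm_scale)
    show "\<phi> (g + h) = \<phi> g + \<phi> h" for g h
      by (rule eqI) (simp_all add: lookup lookup_add linearD(1)[OF lin(1)] linearD(1)[OF lin(2)])
    show "\<phi> (scl H c h) = pm_scale c (\<phi> h)" for c h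
      by (rule eqI) (simp_all add: lookup lookup_pm_scale linearD(2)[OF lin(1)] linearD(2)[OF lin(2)])
    show "\<phi> (mul H g h) = \<phi> g * \<phi> h" for g h
      by (rule eqI) (simp_all add: lookup lookup_times_bit mult)
    show "\<phi> (unt H) = 1"
      by (rule eqI) (simp_all add: lookup unit lookup_one)
  qed
  have sep: "point_separating pm_scale {\<lambda>u. ?l u 0, \<lambda>u. ?l u 1}"
    using eqI[of _ 0] by (auto simp: point_separating_def vector_space_pm_scale lookup_functional)
  have sw_lookup: "tsum (sw group_hopf u) (\<lambda>p q. ?l p i * ?l q j) = (if i = j then ?l u i else 0)" for u i j
  proof -
    have "tsum (sw group_hopf u) (\<lambda>p q. ?l p i * ?l q j) =
        lin_ext (*) (\<lambda>g. ?l (Poly_Mapping.single g 1) i * ?l (Poly_Mapping.single g 1) j) u"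
      by (rule sw_group[OF bilinear_product[OF lookup_functional lookup_functional]])
    also have "\<dots> = (if i = j then ?l u i else 0)"
      by (induction u rule: pm_induct)
        (auto simp: lin_ext_single[OF vector_space_mult] lin_ext_linearD(1)[OF vector_space_mult]
          lookup_single lookup_add when_def)
    finally show ?thesis .
  qed
  have comul: "comul group_hopf (\<phi> h) = tens pm_scale pm_scale [(\<phi> a, \<phi> b). (a, b) \<leftarrow> sw H h]" for h
  proof -
    interpret G: hopf "group_hopf :: ('k, bit \<Rightarrow>\<^sub>0 'k) hopf" by unfold_locales (rule hopf_algebra_group)
    have "tens pm_scale pm_scale (sw group_hopf (\<phi> h)) = tens pm_scale pm_scale [(\<phi> a, \<phi> b). (a, b) \<leftarrow> sw H h]"
    proof (rule tens_eqI[OF sep sep])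
      fix f g assume "f \<in> {\<lambda>u. ?l u 0, \<lambda>u. ?l u 1}" "g \<in> {\<lambda>u. ?l u 0, \<lambda>u. ?l u 1}"
      then obtain i j where fg: "f = (\<lambda>u. ?l u i)" "g = (\<lambda>u. ?l u j)" by auto
      show "tsum (sw group_hopf (\<phi> h)) (\<lambda>v w. f v * g w) = tsum [(\<phi> a, \<phi> b). (a, b) \<leftarrow> sw H h] (\<lambda>v w. f v * g w)"
        unfolding fg sw_lookup tsum_map using bit[of i] bit[of j]
        by (elim disjE) (simp_all add: lookup idem orth)
    qed
    then show ?thesis using G.comul_eq_tens[of "\<phi> h"] by simp
  qed
  have "counit group_hopf (\<phi> h) = counit H h" for h
  proof -
    have "psi2 (\<phi> h) (unt kk) = scl kk (counit group_hopf (\<phi> h)) (unt kk)"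
      using unital_hopf_action_psi2 unfolding unital_hopf_action_def by blast
    then have "fst (psi2 (\<phi> h) (1, 1)) = counit group_hopf (\<phi> h)" by simp
    then show ?thesis by (simp add: psi2_coord lookup counit)
  qed
  then have hom: "hopf_hom H group_hopf \<phi>"
    unfolding hopf_hom_def using alg comul by simp
  have "\<phi>' = \<phi>" if "\<forall>h a. \<psi> h a = psi2 (\<phi>' h) a" for \<phi>'
  proof
    fix h
    have "psi2 (\<phi>' h) (1, 0) = psi2 (\<phi> h) (1, 0)" using that act_eq by metis
    then have "fst (psi2 (\<phi>' h) (1, 0)) = fst (psi2 (\<phi> h) (1, 0))" "snd (psi2 (\<phi>' h) (1, 0)) = snd (psi2 (\<phi> h) (1, 0))"
      by simp_all
    then show "\<phi>' h = \<phi> h" by (intro eqI) (simp_all add: psi2_coord)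
  qed
  then show "\<exists>\<phi>. hopf_hom H group_hopf \<phi> \<and> (\<forall>h a. \<psi> h a = psi2 (\<phi> h) a) \<and>
      (\<forall>\<phi>'. hopf_hom H group_hopf \<phi>' \<longrightarrow> (\<forall>h a. \<psi> h a = psi2 (\<phi>' h) a) \<longrightarrow> \<phi>' = \<phi>)"
    using hom act_eq by blast
qed

text \<open>
  The coefficients \<open>\<alpha>\<close> and \<open>\<beta>\<close> of an action satisfy the relations of \<open>h\<close> and \<open>c\<close> in the dual
  algebra of \<open>H\<close>, and \<open>\<beta>\<close> is invertible with inverse \<open>\<beta> \<circ> S\<close>.  Hence \<open>k\<langle>c, d, h\<rangle>/I\<close> acts on the dual space of
  \<open>H\<close> by right convolution, and moving the counit gives an algebra homomorphism into that dual.
  Its transpose is the universal homomorphism.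
\<close>

context kk_action
begin

definition coefficient :: "cdh_gen \<Rightarrow> 'h \<Rightarrow> 'k" where
  "coefficient g = (case g of Gen_c \<Rightarrow> \<beta> | Gen_d \<Rightarrow> (\<lambda>h. \<beta> (antipode H h)) | Gen_h \<Rightarrow> \<alpha>)"

lemma coefficient_simps [simp]:
  "coefficient Gen_c = \<beta>" "coefficient Gen_d = (\<lambda>h. \<beta> (antipode H h))" "coefficient Gen_h = \<alpha>"
  by (simp_all add: coefficient_def)

lemma functional_coefficient: "functional (scl H) (coefficient g)"
  by (cases g) (simp_all add: functional_coefficients linear_compose'[OF antipode_linear functional_coefficients(2)])

lemma coefficient_inverse:
  "convolution H \<beta> (\<lambda>h. \<beta> (antipode H h)) = counit H" "convolution H (\<lambda>h. \<beta> (antipode H h)) \<beta> = counit H"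
  by (rule convolution_antipode[OF functional_coefficients(2) coefficients_mul(2) coefficients_unt(2)])+

lemma coefficient_unt: "coefficient g (unt H) = cdh_counit_gen g"
  by (cases g) (simp_all add: coefficients_unt antipode_unt)

sublocale dual_module: cdh_module "\<lambda>c f h. c * f h" "{f. functional (scl H) f}" "\<lambda>g f. convolution H f (coefficient g)"
proof (rule cdh_module.intro)
  show vs: "vector_space (\<lambda>(c :: 'k) f (h :: 'h). c * f h)"
    by (rule vector_space.intro) (simp_all only: fun_eq_iff plus_fun_apply distrib_left distrib_right mult.assoc mult_1_left simp_thms)
  interpret F: vector_space "\<lambda>(c :: 'k) f (h :: 'h). c * f h" by (rule vs)
  show "F.subspace {f. functional (scl H) f}"
  proof (rule F.subspaceI)
    show "0 \<in> {f. functional (scl H) f}"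
      using linear_zero_map[OF hopf.vs[OF hopf_axioms] vector_space_mult] by (simp add: zero_fun_def)
  qed (auto simp: plus_fun_def intro: linear_plus functional_mult_left)
  fix f k :: "'h \<Rightarrow> 'k" and g and r :: 'k
  show "convolution H (f + k) (coefficient g) = convolution H f (coefficient g) + convolution H k (coefficient g)"
    by (rule ext) (simp add: plus_fun_def convolution_plus)
  show "convolution H (\<lambda>h. r * f h) (coefficient g) = (\<lambda>h. r * convolution H f (coefficient g) h)"
    by (rule ext) (simp only: convolution_tsum tsum_mult(1)[symmetric] mult.assoc)
  assume "f \<in> {f. functional (scl H) f}"
  then have f: "functional (scl H) f" by simp
  show "convolution H f (coefficient g) \<in> {f. functional (scl H) f}"
    by (simp add: convolution_functional[OF f functional_coefficient])
  note \<alpha> = functional_coefficients(1) and \<beta> = functional_coefficients(2)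
  note \<beta>S = functional_coefficient[of Gen_d, unfolded coefficient_simps]
  show "convolution H (convolution H f (coefficient Gen_c)) (coefficient Gen_d) = f"
    by (simp only: coefficient_simps convolution_assoc[OF f \<beta> \<beta>S] coefficient_inverse convolution_counit[OF f])
  show "convolution H (convolution H f (coefficient Gen_d)) (coefficient Gen_c) = f"
    by (simp only: coefficient_simps convolution_assoc[OF f \<beta>S \<beta>] coefficient_inverse convolution_counit[OF f])
  have "convolution H \<alpha> \<alpha> = \<alpha>" by (rule ext) (rule coefficients_idempotent(1))
  then show "convolution H (convolution H f (coefficient Gen_h)) (coefficient Gen_h) = convolution H f (coefficient Gen_h)"
    by (simp only: coefficient_simps convolution_assoc[OF f \<alpha> \<alpha>])
  have "convolution H f (\<lambda>h. convolution H \<alpha> \<beta> h + convolution H \<beta> \<alpha> h + convolution H \<beta> \<beta> h) = convolution H f \<beta>"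
    by (simp only: coefficients_idempotent(2))
  then show "convolution H (convolution H f (coefficient Gen_h)) (coefficient Gen_c) +
      convolution H (convolution H f (coefficient Gen_c)) (coefficient Gen_h) +
      convolution H (convolution H f (coefficient Gen_c)) (coefficient Gen_c) = convolution H f (coefficient Gen_c)"
    by (simp only: coefficient_simps convolution_assoc[OF f \<alpha> \<beta>] convolution_assoc[OF f \<beta> \<alpha>]
        convolution_assoc[OF f \<beta> \<beta>] fun_eq_iff plus_fun_apply convolution_plus simp_thms)
qed

definition dual_map :: "'k cdh \<Rightarrow> 'h \<Rightarrow> 'k" where
  "dual_map = dual_module.act (counit H)"

lemma counit_mem: "counit H \<in> {f. functional (scl H) f}"
  by (simp add: counit_functional)

lemma functional_dual_map: "functional (scl H) (dual_map x)"
  using dual_module.act_closed[OF counit_mem, of x] by (simp add: dual_map_def)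

lemma dual_map_one: "dual_map 1 = counit H"
  by (simp only: dual_map_def dual_module.act_one[OF counit_mem])

lemma dual_map_times_gen: "dual_map (x * cdh_gen g) = convolution H (dual_map x) (coefficient g)"
  by (simp only: dual_map_def dual_module.act_times_gen[OF counit_mem])

lemma dual_map_linear:
  "dual_map (x + y) h = dual_map x h + dual_map y h" "dual_map (cdh_scale c x) h = c * dual_map x h"
  by (simp_all only: dual_map_def dual_module.act_plus[OF counit_mem] dual_module.act_cdh_scale[OF counit_mem] plus_fun_apply)

lemma dual_map_gen: "dual_map (cdh_gen g) = coefficient g"
  using dual_map_times_gen[of 1 g]
  by (simp add: dual_map_one convolution_counit[OF functional_coefficient])

lemma dual_map_functional: "functional cdh_scale (\<lambda>x. dual_map x h)"
  by (rule linear_mapI[OF vector_space_cdh_scale vector_space_mult]) (simp_all only: dual_map_linear)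

lemma dual_map_times: "dual_map (x * y) h = convolution H (dual_map x) (dual_map y) h"
proof (induction y arbitrary: h rule: cdh_induct)
  case one
  then show ?case by (simp add: dual_map_one convolution_counit[OF functional_dual_map])
next
  case (gen y g)
  have IH: "dual_map (x * y) = convolution H (dual_map x) (dual_map y)" by (rule ext) (rule gen)
  have "dual_map (x * (y * cdh_gen g)) = dual_map (x * y * cdh_gen g)" by (simp only: mult.assoc)
  then show ?case
    by (simp only: dual_map_times_gen IH
        convolution_assoc[OF functional_dual_map functional_dual_map functional_coefficient])
next
  case (plus y z)
  then show ?case by (simp only: distrib_left dual_map_linear convolution_tsum tsum_add)
next
  case (scale c y)
  then show ?case
    by (simp only: cdh_scale_mult dual_map_linear convolution_tsum tsum_mult(1)[symmetric] mult.left_commute)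
qed

text \<open>
  The terms of the comultiplication of \<open>h \<in> H\<close> split the functional \<open>x \<mapsto> dual_map x h\<close> into finitely many
  products, because \<open>dual_map\<close> is multiplicative.
\<close>

lemma dual_map_finite_dual: "(\<lambda>x. dual_map x h) \<in> finite_dual cdh_hopf"
proof (rule finite_dualI[OF algebra_cdh])
  let ?xs = "map (\<lambda>(a, b). (\<lambda>x. dual_map x a, \<lambda>x. dual_map x b)) (sw H h)"
  show "functional (scl cdh_hopf) (\<lambda>x. dual_map x h)" by (simp add: dual_map_functional)
  show "functional (scl cdh_hopf) q" if "(p, q) \<in> set ?xs" for p q
    using that by (auto simp: dual_map_functional)
  show "dual_map (mul cdh_hopf x y) h = tsum ?xs (\<lambda>p q. p x * q y)" for x y
    by (simp add: tsum_map dual_map_times convolution_tsum)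
qed

lemma dual_map_unt: "dual_map x (unt H) = counit cdh_hopf x"
proof (induction x rule: cdh_induct)
  case (gen x g)
  have "dual_map (x * cdh_gen g) (unt H) = dual_map x (unt H) * coefficient g (unt H)"
    unfolding dual_map_times_gen convolution_tsum
    by (rule Sw_unt[OF bilinear_product[OF functional_dual_map functional_coefficient]])
  then show ?case by (simp add: gen counit_cdh coefficient_unt)
qed (simp_all add: dual_map_one counit_unt counit_cdh dual_map_linear)

text \<open>
  The two sides agree at \<open>1\<close>, and \<open>\<alpha>\<close>, \<open>\<beta>\<close> and \<open>\<beta> \<circ> S\<close> respond to products in \<open>H\<close> as the generators \<open>h\<close>, \<open>c\<close> and
  \<open>d\<close> do to the comultiplication.
\<close>

lemma dual_map_mul:
  "dual_map x (mul H g h) = convolution cdh_hopf (\<lambda>x. dual_map x g) (\<lambda>x. dual_map x h) x"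
proof (induction x arbitrary: g h rule: cdh_induct)
  case one
  then show ?case by (simp add: dual_map_one counit_mul convolution_cdh(1) dual_map_functional)
next
  case (gen x y)
  note lin = dual_map_functional[of g] dual_map_functional[of h]
  \<comment> \<open>The step for a coefficient that is a product of functionals in the two arguments.\<close>
  have product: "Sw g (\<lambda>a b. Sw h (\<lambda>a' b'. dual_map x (mul H a a') * (p b * q b'))) =
      tsum (sw cdh_hopf x) (\<lambda>u v. convolution H (dual_map u) p g * convolution H (dual_map v) q h)" for p q
  proof -
    have "Sw g (\<lambda>a b. Sw h (\<lambda>a' b'. dual_map x (mul H a a') * (p b * q b'))) =
        Sw g (\<lambda>a b. Sw h (\<lambda>a' b'. tsum (sw cdh_hopf x) (\<lambda>u v. (dual_map u a * p b) * (dual_map v a' * q b'))))"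
      by (simp only: gen convolution_tsum tsum_mult(2)[symmetric]) (simp only: mult.assoc mult.left_commute)
    also have "\<dots> = tsum (sw cdh_hopf x) (\<lambda>u v. Sw g (\<lambda>a b. Sw h (\<lambda>a' b'. (dual_map u a * p b) * (dual_map v a' * q b'))))"
      by (simp only: tsum_swap[of "sw H h" "sw cdh_hopf x"] tsum_swap[of "sw H g" "sw cdh_hopf x"])
    finally show ?thesis by (simp only: convolution_tsum tsum_product)
  qed
  have step: "dual_map (x * cdh_gen y) (mul H g h) =
      Sw g (\<lambda>a b. Sw h (\<lambda>a' b'. dual_map x (mul H a a') * coefficient y (mul H b b')))"
    unfolding dual_map_times_gen convolution_tsum
    by (rule Sw_mul[OF bilinear_product[OF functional_dual_map functional_coefficient]])
  show ?case
  proof (cases y)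
    case Gen_c
    have "dual_map (x * c_bar) (mul H g h) = Sw g (\<lambda>a b. Sw h (\<lambda>a' b'. dual_map x (mul H a a') * (\<beta> b * \<beta> b')))"
      using step[unfolded Gen_c] by (simp only: coefficient_simps coefficients_mul)
    also have "\<dots> = convolution cdh_hopf (\<lambda>x. dual_map x g) (\<lambda>x. dual_map x h) (x * c_bar)"
      unfolding product convolution_cdh(2)[OF lin]
      by (simp only: convolution_tsum[of cdh_hopf] dual_map_times_gen coefficient_simps)
    finally show ?thesis by (simp only: Gen_c)
  next
    case Gen_d
    note antipode_mul = character_antipode_mul[OF functional_coefficients(2) coefficients_mul(2) coefficients_unt(2)]
    have "dual_map (x * d_bar) (mul H g h) =
        Sw g (\<lambda>a b. Sw h (\<lambda>a' b'. dual_map x (mul H a a') * (\<beta> (antipode H b) * \<beta> (antipode H b'))))"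
      using step[unfolded Gen_d] by (simp only: coefficient_simps antipode_mul)
    also have "\<dots> = convolution cdh_hopf (\<lambda>x. dual_map x g) (\<lambda>x. dual_map x h) (x * d_bar)"
      unfolding product[of "\<lambda>b. \<beta> (antipode H b)" "\<lambda>b. \<beta> (antipode H b)"] convolution_cdh(3)[OF lin]
      by (simp only: convolution_tsum[of cdh_hopf] dual_map_times_gen coefficient_simps)
    finally show ?thesis by (simp only: Gen_d)
  next
    case Gen_h
    have "dual_map (x * h_bar) (mul H g h) =
        Sw g (\<lambda>a b. Sw h (\<lambda>a' b'. dual_map x (mul H a a') * (\<alpha> b * \<beta> b'))) +
        Sw g (\<lambda>a b. Sw h (\<lambda>a' b'. dual_map x (mul H a a') * (counit H b * \<alpha> b')))"
      using step[unfolded Gen_h] by (simp only: coefficient_simps coefficients_mul(1) distrib_left tsum_add)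
    also have "\<dots> = convolution cdh_hopf (\<lambda>x. dual_map x g) (\<lambda>x. dual_map x h) (x * h_bar)"
      unfolding product convolution_counit[OF functional_dual_map] convolution_cdh(4)[OF lin]
      by (simp only: convolution_tsum[of cdh_hopf] dual_map_times_gen coefficient_simps)
    finally show ?thesis by (simp only: Gen_h)
  qed
next
  case (plus x y)
  then show ?case by (simp only: dual_map_linear linearD(1)[OF convolution_cdh_functional[OF dual_map_functional dual_map_functional]])
next
  case (scale c x)
  then show ?case by (simp only: dual_map_linear linearD(2)[OF convolution_cdh_functional[OF dual_map_functional dual_map_functional]])
qed

definition transpose :: "'h \<Rightarrow> 'k cdh_dual" where
  "transpose h = Abs_cdh_dual (\<lambda>x. dual_map x h)"

lemma Rep_transpose: "Rep_cdh_dual (transpose h) = (\<lambda>x. dual_map x h)"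
  by (simp add: transpose_def Abs_cdh_dual_inverse[OF dual_map_finite_dual])

lemma hopf_hom_transpose: "hopf_hom H cdh_dual_hopf transpose"
  unfolding hopf_hom_def algebra_hom_def
proof (intro conjI allI)
  show "Vector_Spaces.linear (scl H) (scl cdh_dual_hopf) transpose"
    unfolding cdh_dual_hopf_simps
    by (rule linear_mapI[OF vs vector_space_cdh_dual_scale]; rule cdh_dual_eqI)
      (simp_all only: Rep_transpose plus_cdh_dual.rep_eq cdh_dual_scale.rep_eq linearD(1,2)[OF functional_dual_map])
  show "transpose (mul H g h) = mul cdh_dual_hopf (transpose g) (transpose h)" for g h
    by (rule cdh_dual_eqI) (simp only: cdh_dual_hopf_simps Rep_transpose dual_map_mul)
  show "transpose (unt H) = unt cdh_dual_hopf"
    by (rule cdh_dual_eqI) (simp only: cdh_dual_hopf_simps Rep_transpose dual_map_unt)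
  show "counit cdh_dual_hopf (transpose h) = counit H h" for h
    by (simp only: cdh_dual_hopf_simps Rep_transpose dual_map_one)
  fix h
  interpret D: hopf "cdh_dual_hopf :: ('k, 'k cdh_dual) hopf" by unfold_locales (rule hopf_algebra_cdh_dual)
  have "tens cdh_dual_scale cdh_dual_scale (sw cdh_dual_hopf (transpose h)) =
      tens cdh_dual_scale cdh_dual_scale [(transpose a, transpose b). (a, b) \<leftarrow> sw H h]"
  proof (rule tens_eqI[OF point_separating_evaluations point_separating_evaluations])
    fix e e' assume "e \<in> {\<lambda>f :: 'k cdh_dual. Rep_cdh_dual f x | x. True}" "e' \<in> {\<lambda>f :: 'k cdh_dual. Rep_cdh_dual f x | x. True}"
    then obtain x y where e: "e = (\<lambda>f. Rep_cdh_dual f x)" "e' = (\<lambda>f. Rep_cdh_dual f y)" by auto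
    show "tsum (sw cdh_dual_hopf (transpose h)) (\<lambda>v w. e v * e' w) =
        tsum [(transpose a, transpose b). (a, b) \<leftarrow> sw H h] (\<lambda>v w. e v * e' w)"
      by (simp only: e sw_cdh_dual tsum_map Rep_transpose dual_map_times convolution_tsum)
  qed
  then show "comul cdh_dual_hopf (transpose h) =
      tens (scl cdh_dual_hopf) (scl cdh_dual_hopf) [(transpose a, transpose b). (a, b) \<leftarrow> sw H h]"
    using D.comul_eq_tens[of "transpose h"] by (simp only: cdh_dual_hopf_simps)
qed

lemma psi_eq_psi3_transpose: "\<psi> h a = psi3 (transpose h) a"
  by (rule prod_eqI) (simp_all add: psi_coord psi3_coord Rep_transpose coord1_def coord2_def dual_map_linear
      dual_map_one dual_map_gen add.commute)

text \<open>
  A second homomorphism gives, by evaluation, another multiplicative map from \<open>k\<langle>c, d, h\<rangle>/I\<close> to the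
  dual of \<open>H\<close>.  The action determines its values at \<open>c\<close> and \<open>h\<close>, and its value at \<open>d\<close> is the
  convolution inverse of the one at \<open>c\<close>.
\<close>

lemma transpose_unique:
  assumes hom: "hopf_hom H cdh_dual_hopf \<phi>" and psi: "\<And>h a. \<psi> h a = psi3 (\<phi> h) a"
  shows "\<phi> = transpose"
proof -
  define G where "G x h = Rep_cdh_dual (\<phi> h) x" for x h
  have lin: "Vector_Spaces.linear (scl H) cdh_dual_scale \<phi>"
    using hom unfolding hopf_hom_def algebra_hom_def cdh_dual_hopf_simps by blast
  have G: "functional (scl H) (G x)" for x
    using linear_compose'[OF lin evaluation_functional] by (simp add: G_def[abs_def])
  have G_one: "G 1 = counit H"
    using hom unfolding hopf_hom_def cdh_dual_hopf_simps by (simp add: G_def[abs_def])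
  interpret D: hopf "cdh_dual_hopf :: ('k, 'k cdh_dual) hopf" by unfold_locales (rule hopf_algebra_cdh_dual)
  have times: "G (x * y) = convolution H (G x) (G y)" for x y
  proof
    fix h
    have "tens cdh_dual_scale cdh_dual_scale (sw cdh_dual_hopf (\<phi> h)) =
        tens cdh_dual_scale cdh_dual_scale [(\<phi> a, \<phi> b). (a, b) \<leftarrow> sw H h]"
      using hom D.comul_eq_tens[of "\<phi> h"] by (simp add: hopf_hom_def)
    from tens_eqD[OF this bilinear_product[OF evaluation_functional[of x] evaluation_functional[of y]]]
    show "G (x * y) h = convolution H (G x) (G y) h"
      by (simp only: sw_cdh_dual tsum_map convolution_tsum G_def)
  qed
  have e: "\<psi> h (1, 0) = (Rep_cdh_dual (\<phi> h) h_bar + Rep_cdh_dual (\<phi> h) c_bar, Rep_cdh_dual (\<phi> h) h_bar)" for h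
    by (simp add: psi psi3_basis)
  have gen_c: "G c_bar = coefficient Gen_c" and gen_h: "G h_bar = coefficient Gen_h"
    by (rule ext, simp add: G_def \<alpha>_def \<beta>_def e)+
  have "convolution H \<beta> (G d_bar) = counit H"
    using times[of c_bar d_bar] by (simp add: cdh_relations G_one gen_c)
  then have "convolution H (convolution H (coefficient Gen_d) \<beta>) (G d_bar) = coefficient Gen_d"
    by (simp only: convolution_assoc[OF functional_coefficient functional_coefficients(2) G]
        convolution_counit[OF functional_coefficient])
  then have gen_d: "G d_bar = coefficient Gen_d"
    by (simp only: coefficient_simps coefficient_inverse convolution_counit[OF G])
  have G_gen: "G (cdh_gen g) = coefficient g" for g
    by (cases g) (simp_all only: gen_c gen_d gen_h)
  have "G x h = dual_map x h" for x h
  proof (induction x arbitrary: h rule: cdh_induct)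
    case one
    then show ?case by (simp only: G_one dual_map_one)
  next
    case (gen x g)
    then have "G x = dual_map x" by (intro ext)
    then show ?case by (simp only: times G_gen dual_map_times_gen)
  next
    case (plus x y)
    then show ?case by (simp only: G_def dual_map_linear linearD(1)[OF Rep_cdh_dual_functional])
  next
    case (scale c x)
    then show ?case by (simp only: G_def dual_map_linear linearD(2)[OF Rep_cdh_dual_functional])
  qed
  then show ?thesis
    by (intro ext cdh_dual_eqI) (simp only: Rep_transpose G_def)
qed

end

lemma universal_psi3:
  "V_universal TYPE('h::ab_group_add) kk (cosupp psi3) cdh_dual_hopf (psi3 :: 'k::field cdh_dual \<Rightarrow> _)"
proof (rule V_universalI[OF unital_hopf_action_psi3])
  fix H :: "('k, 'h) hopf" and \<psi>
  assume act: "unital_hopf_action H kk \<psi>"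
  interpret kk_action H \<psi> by unfold_locales (rule act)
  show "\<exists>\<phi>. hopf_hom H cdh_dual_hopf \<phi> \<and> (\<forall>h a. \<psi> h a = psi3 (\<phi> h) a) \<and>
      (\<forall>\<phi>'. hopf_hom H cdh_dual_hopf \<phi>' \<longrightarrow> (\<forall>h a. \<psi> h a = psi3 (\<phi>' h) a) \<longrightarrow> \<phi>' = \<phi>)"
    using hopf_hom_transpose psi_eq_psi3_transpose transpose_unique by blast
qed

section \<open>The classification\<close>

theorem theorem4p6:
  "\<comment> \<open>classification\<close>
   (\<forall>(H :: ('k::field, 'h::ab_group_add) hopf) \<psi>. unital_hopf_action H kk \<psi> \<longrightarrow>
      equivalent_actions kk \<psi> kk (psi1 :: 'k \<Rightarrow> _) \<or>
      equivalent_actions kk \<psi> kk (psi2 :: (bit \<Rightarrow>\<^sub>0 'k) \<Rightarrow> _) \<or>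
      equivalent_actions kk \<psi> kk (psi3 :: 'k cdh_dual \<Rightarrow> _)) \<and>
   \<comment> \<open>the action of the ground field\<close>
   (unital_hopf_action field_hopf kk (psi1 :: 'k \<Rightarrow> _) \<and>
    vector_space.dim (op_scale kk) (cosupp (psi1 :: 'k \<Rightarrow> _)) = 1 \<and>
    cosupp (psi1 :: 'k \<Rightarrow> _) = {\<lambda>a. scl kk \<alpha> a | \<alpha>. True}) \<and>
   \<comment> \<open>the action of the group algebra of the group of order two\<close>
   (unital_hopf_action group_hopf kk (psi2 :: (bit \<Rightarrow>\<^sub>0 'k) \<Rightarrow> _) \<and>
    (\<forall>\<alpha> \<beta> :: 'k. psi2 C2_gen (\<alpha>, \<beta>) = (\<beta>, \<alpha>)) \<and>
    vector_space.dim (op_scale kk) (cosupp (psi2 :: (bit \<Rightarrow>\<^sub>0 'k) \<Rightarrow> _)) = 2 \<and>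
    cosupp (psi2 :: (bit \<Rightarrow>\<^sub>0 'k) \<Rightarrow> _) =
      {T \<in> lin_End kk. \<exists>\<alpha> \<beta>. has_matrix kk ((1, 0), (0, 1)) T ((\<alpha>, \<beta>), (\<beta>, \<alpha>))}) \<and>
   \<comment> \<open>the action of the finite dual\<close>
   (hopf_algebra (cdh_hopf :: ('k, 'k cdh) hopf) \<and>
    unital_hopf_coaction cdh_hopf kk (rho3 :: 'k \<times> 'k \<Rightarrow> _) \<and>
    rho3 (1 :: 'k, 0) = tens (scl kk) (scl cdh_hopf) [((1, 1), h_bar), ((1, 0), c_bar)] \<and>
    unital_hopf_action cdh_dual_hopf kk (psi3 :: 'k cdh_dual \<Rightarrow> _) \<and>
    vector_space.dim (op_scale kk) (cosupp (psi3 :: 'k cdh_dual \<Rightarrow> _)) = 3 \<and>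
    cosupp (psi3 :: 'k cdh_dual \<Rightarrow> _) =
      {T \<in> lin_End kk. \<exists>\<alpha> \<beta> \<gamma>. has_matrix kk ((1, 1), (1, 0)) T ((\<alpha>, \<beta>), (0, \<gamma>))} \<and>
    (CHAR('k) \<noteq> 2 \<longrightarrow>
      unital_hopf_action h4_hopf kk (psi3b :: 'k h4 \<Rightarrow> _) \<and>
      (\<forall>\<alpha> \<beta> :: 'k. psi3b h4_c (\<alpha>, \<beta>) = (\<beta>, \<alpha>) \<and> psi3b h4_v (\<alpha>, \<beta>) = (\<alpha> - \<beta>, \<alpha> - \<beta>)) \<and>
      equivalent_actions kk (psi3b :: 'k h4 \<Rightarrow> _) kk (psi3 :: 'k cdh_dual \<Rightarrow> _))) \<and>
   \<comment> \<open>universality\<close>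
   V_universal TYPE('h) kk (cosupp psi1) field_hopf (psi1 :: 'k \<Rightarrow> _) \<and>
   V_universal TYPE('h) kk (cosupp psi2) group_hopf (psi2 :: (bit \<Rightarrow>\<^sub>0 'k) \<Rightarrow> _) \<and>
   V_universal TYPE('h) kk (cosupp psi3) cdh_dual_hopf (psi3 :: 'k cdh_dual \<Rightarrow> _)"
proof (intro conjI allI impI)
  fix H :: "('k, 'h) hopf" and \<psi> assume "unital_hopf_action H kk \<psi>"
  then interpret kk_action H \<psi> by unfold_locales
  show "equivalent_actions kk \<psi> kk (psi1 :: 'k \<Rightarrow> _) \<or> equivalent_actions kk \<psi> kk (psi2 :: (bit \<Rightarrow>\<^sub>0 'k) \<Rightarrow> _) \<or>
      equivalent_actions kk \<psi> kk (psi3 :: 'k cdh_dual \<Rightarrow> _)"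
    using cosupp_cases by (elim disj_forward) (rule equivalent_if_cosupp_eq, assumption)+
next
  show "rho3 (1 :: 'k, 0) = tens (scl kk) (scl cdh_hopf) [((1, 1), h_bar), ((1, 0), c_bar)]"
    by (simp only: rho3_e cdh_hopf_simps)
next
  show "vector_space.dim (op_scale kk) (cosupp (psi3 :: 'k cdh_dual \<Rightarrow> _)) = 3"
    by (simp only: cosupp_psi3 dim_upper_triangular)
next
  assume char: "CHAR('k) \<noteq> 2"
  show "equivalent_actions kk (psi3b :: 'k h4 \<Rightarrow> _) kk (psi3 :: 'k cdh_dual \<Rightarrow> _)"
    by (intro equivalent_if_cosupp_eq) (simp only: cosupp_psi3 cosupp_psi3b[OF char])
qed (rule unital_hopf_action_psi1 dim_cosupp_psi1 cosupp_psi1 unital_hopf_action_psi2 psi2_C2_gen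
    dim_cosupp_psi2 cosupp_psi2_matrix hopf_algebra_cdh unital_hopf_coaction_rho3
    unital_hopf_action_psi3 cosupp_psi3 unital_hopf_action_psi3b psi3b_generators
    universal_psi1 universal_psi2 universal_psi3)+

end
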